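(* Let $G$ and $H$ be finite simple undirected graphs and let $c$ denote the number of connected components of $G$. Then for any integer $k\geq 1$, one has (i) $\operatorname{proj\,dim} I_{G\to H}^k\geq |V(H)|-1$; (ii) $\operatorname{proj\,dim} I_{G\to H}^{(k)}\geq |V(H)|-1$; (iii) $\operatorname{reg} I_{G\to H}^k\geq k|V(G)|+(|V(G)|-c)(\alpha(H)-1)$; (iv) $\operatorname{reg} I_{G\to H}^{(k)}\geq k|V(G)|+(|V(G)|-c)(\alpha(H)-1)$.
   Context: All graphs are finite, simple, undirected, with nonempty vertex sets. Let $V(G)=[n]=\{1,\dots,n\}$ and $V(H)=[m]$. A weak homomorphism from $G$ to $H$ is a map $\phi:V(G)\to V(H)$ such that for every $\{x,y\}\in E(G)$ either $\phi(x)=\phi(y)$ or $\{\phi(x),\phi(y)\}\in E(H)$; the set of these is $\mathrm{WHom}(G,H)$. Let $K$ be a field and $S=K[x_{ij}: i\in[n], j\in[m]]$. For $\phi\in\mathrm{WHom}(G,H)$ put $u_\phi=\prod_{i=1}^n x_{i\phi(i)}$, and $I_{G\to H}=(u_\phi:\phi\in\mathrm{WHom}(G,H))\subseteq S$, a squarefree monomial ideal. $\alpha(H)$ is the independence number of $H$ (largest size of a set of pairwise nonadjacent vertices). For a graded $S$-module $M$ with graded Betti numbers $\beta_{i,j}(M)$, $\operatorname{reg} M=\max\{j-i:\beta_{i,j}(M)\ne0\}$ and $\operatorname{proj\,dim}M=\max\{i:\beta_{i,j}(M)\neq 0\text{ for some }j\}$. For a squarefree monomial ideal $I$ with irredundant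 primary decomposition $I=\mathfrak p_1\cap\cdots\cap\mathfrak p_r$ (each $\mathfrak p_i$ generated by variables), $I^{(k)}=\mathfrak p_1^k\cap\cdots\cap\mathfrak p_r^k$. *)

theory Defs
  imports
    "HOL-Library.Poly_Mapping"
    "HOL-Library.Cardinality"
    "HOL-Library.Extended_Real"
    "Jordan_Normal_Form.Matrix_Kernel"
begin

section \<open>Graphs\<close>

text \<open>
  A finite graph is given by its set of edges; its vertex set is the whole (finite, nonempty)
  vertex type, which plays the role of \<open>[n]\<close>.
\<close>

definition simple_graph :: "'v set set \<Rightarrow> bool" where
  "simple_graph E \<longleftrightarrow> (\<forall>e\<in>E. card e = 2)"

definition num_components :: "'v set set \<Rightarrow> nat" where
  "num_components E = card (UNIV // {(x, y). {x, y} \<in> E}\<^sup>*)"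

definition independent_set :: "'v set set \<Rightarrow> 'v set \<Rightarrow> bool" where
  "independent_set E A \<longleftrightarrow> (\<forall>x\<in>A. \<forall>y\<in>A. {x, y} \<notin> E)"

definition independence_number :: "'v set set \<Rightarrow> nat" where
  "independence_number E = Max {card A | A. independent_set E A}"

definition weak_homs :: "'v set set \<Rightarrow> 'w set set \<Rightarrow> ('v \<Rightarrow> 'w) set" where
  "weak_homs G H = {\<phi>. \<forall>x y. {x, y} \<in> G \<longrightarrow> \<phi> x = \<phi> y \<or> {\<phi> x, \<phi> y} \<in> H}"


section \<open>Polynomials and ideals\<close>

text \<open>
  The polynomial ring with coefficients in \<open>'k\<close> and variables indexed by the type \<open>'x\<close>:
  finitely supported functions from exponent vectors to coefficients.
\<close>

type_synonym ('x, 'k) polyn = "('x \<Rightarrow>\<^sub>0 nat) \<Rightarrow>\<^sub>0 'k"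

definition var :: "'x \<Rightarrow> ('x, 'k::comm_ring_1) polyn" where
  "var x = Poly_Mapping.single (Poly_Mapping.single x 1) 1"

definition mon_deg :: "('x \<Rightarrow>\<^sub>0 nat) \<Rightarrow> nat" where
  "mon_deg t = (\<Sum>x\<in>Poly_Mapping.keys t. Poly_Mapping.lookup t x)"

definition ideal_gen :: "'a::comm_ring_1 set \<Rightarrow> 'a set" where
  "ideal_gen B = Modules.module.span (*) B"

definition ideal_mult :: "'a::comm_ring_1 set \<Rightarrow> 'a set \<Rightarrow> 'a set" where
  "ideal_mult I J = ideal_gen {a * b | a b. a \<in> I \<and> b \<in> J}"

primrec ideal_power :: "'a::comm_ring_1 set \<Rightarrow> nat \<Rightarrow> 'a set" where
  "ideal_power I 0 = UNIV"
| "ideal_power I (Suc k) = ideal_mult I (ideal_power I k)"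

definition var_ideal :: "'x set \<Rightarrow> ('x, 'k::comm_ring_1) polyn set" where
  "var_ideal A = ideal_gen (var ` A)"

text \<open>
  An irredundant primary decomposition all of whose components are generated by variables is
  recorded by the family of the sets of variables generating the components. For a squarefree
  monomial ideal (the only case of interest) there is exactly one such family.
\<close>

definition irredundant_decomposition ::
    "('x, 'k::comm_ring_1) polyn set \<Rightarrow> 'x set set \<Rightarrow> bool" where
  "irredundant_decomposition I \<A> \<longleftrightarrow>
     finite \<A> \<and> I = (\<Inter>A\<in>\<A>. var_ideal A) \<and>
     (\<forall>A\<in>\<A>. I \<noteq> (\<Inter>B\<in>\<A> - {A}. var_ideal B))"

definition symbolic_power ::
    "('x, 'k::comm_ring_1) polyn set \<Rightarrow> nat \<Rightarrow> ('x, 'k) polyn set" where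
  "symbolic_power I k =
     (\<Inter>A\<in>(SOME \<A>. irredundant_decomposition I \<A>). ideal_power (var_ideal A) k)"

definition weak_hom_ideal ::
    "'v::finite set set \<Rightarrow> 'w set set \<Rightarrow> ('v \<times> 'w, 'k::comm_ring_1) polyn set" where
  "weak_hom_ideal G H = ideal_gen ((\<lambda>\<phi>. \<Prod>i\<in>UNIV. var (i, \<phi> i)) ` weak_homs G H)"


section \<open>Minimal graded free resolutions and their invariants\<close>

text \<open>
  A graded free resolution
  \<open>\<dots> \<rightarrow> F\<^sub>2 \<rightarrow> F\<^sub>1 \<rightarrow> F\<^sub>0 \<rightarrow> I \<rightarrow> 0\<close>
  of an ideal \<open>I\<close> of the polynomial ring \<open>S\<close> is encoded as follows. The list \<open>degs i\<close> consists of
  the degrees of the basis elements of \<open>F\<^sub>i\<close>, that is, \<open>F\<^sub>i\<close> is the direct sum of the modules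
  \<open>S(-j)\<close> with \<open>j\<close> running through \<open>degs i\<close>. The one-row matrix \<open>d 0\<close> describes the augmentation
  from \<open>F\<^sub>0\<close> to \<open>S\<close>, with image \<open>I\<close>, and \<open>d (i + 1)\<close> is the matrix of the differential from
  \<open>F\<^sub>i\<^sub>+\<^sub>1\<close> to \<open>F\<^sub>i\<close>. All these maps are homogeneous of degree zero; since \<open>I\<close> lives in nonnegative
  degrees, generators of negative degree do not occur in a minimal resolution. A resolution of
  finite length has \<open>degs i = []\<close> for large \<open>i\<close>.
\<close>

definition graded_free_resolution ::
    "('x, 'k::field) polyn set \<Rightarrow> (nat \<Rightarrow> nat list) \<Rightarrow> (nat \<Rightarrow> ('x, 'k) polyn mat) \<Rightarrow> bool" where
  "graded_free_resolution I degs d \<longleftrightarrow>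
     d 0 \<in> carrier_mat 1 (length (degs 0)) \<and>
     (\<forall>i. d (Suc i) \<in> carrier_mat (length (degs i)) (length (degs (Suc i)))) \<and>
     (\<forall>b < length (degs 0). \<forall>t \<in> Poly_Mapping.keys (d 0 $$ (0, b)). mon_deg t = degs 0 ! b) \<and>
     (\<forall>i. \<forall>a < length (degs i). \<forall>b < length (degs (Suc i)).
        \<forall>t \<in> Poly_Mapping.keys (d (Suc i) $$ (a, b)). mon_deg t + degs i ! a = degs (Suc i) ! b) \<and>
     (\<lambda>v. (d 0 *\<^sub>v v) $ 0) ` carrier_vec (length (degs 0)) = I \<and>
     (\<forall>i. mat_kernel (d i) = (\<lambda>v. d (Suc i) *\<^sub>v v) ` carrier_vec (length (degs (Suc i))))"

text \<open>
  Minimality: every differential maps \<open>F\<^sub>i\<^sub>+\<^sub>1\<close> into \<open>\<mm> F\<^sub>i\<close>, where \<open>\<mm>\<close> is the ideal generated by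
  all variables.
\<close>

definition minimal_graded_free_resolution ::
    "('x, 'k::field) polyn set \<Rightarrow> (nat \<Rightarrow> nat list) \<Rightarrow> (nat \<Rightarrow> ('x, 'k) polyn mat) \<Rightarrow> bool" where
  "minimal_graded_free_resolution I degs d \<longleftrightarrow>
     graded_free_resolution I degs d \<and>
     (\<forall>i. \<forall>a < length (degs i). \<forall>b < length (degs (Suc i)). d (Suc i) $$ (a, b) \<in> var_ideal UNIV)"

text \<open>
  The minimal graded free resolution of a homogeneous ideal in finitely many variables exists and
  is unique up to isomorphism, so the Betti numbers do not depend on the choice made here.
\<close>

definition graded_betti :: "('x, 'k::field) polyn set \<Rightarrow> nat \<Rightarrow> nat \<Rightarrow> nat" where
  "graded_betti I i j =
     count_list (fst (SOME (degs, d). minimal_graded_free_resolution I degs d) i) j"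

text \<open>
  Only finitely many graded Betti numbers are nonzero, so for nonzero \<open>I\<close> the suprema below are maxima.
\<close>

definition proj_dim :: "('x, 'k::field) polyn set \<Rightarrow> enat" where
  "proj_dim I = Sup {enat i | i. \<exists>j. graded_betti I i j \<noteq> 0}"

definition regularity :: "('x, 'k::field) polyn set \<Rightarrow> ereal" where
  "regularity I = Sup {ereal (real j - real i) | i j. graded_betti I i j \<noteq> 0}"

end

theory Submission
  imports Defs "HOL-Library.Function_Algebras"
begin

text \<open>
  Minimality of the resolution plays no role in a lower bound: if a Koszul cycle of homological degree
  \<open>i\<close> and internal degree \<open>j\<close> with coefficients in \<open>J\<close> is not the boundary of a Koszul chain with
  coefficients in \<open>J\<close>, then every graded free resolution of \<open>J\<close> has a generator of degree \<open>j\<close> in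
  position \<open>i\<close> (and some generator in position \<open>i\<close> if only some of the variables are used). For
  \<open>J = I\<^sup>k\<close> and the symbolic power alike, such cycles are written down explicitly.

  For the projective dimension, fix a vertex \<open>v\<close> of \<open>G\<close>; the variables \<open>x\<^sub>v\<^sub>w\<close> generate a minimal prime of
  \<open>I\<close>, and the monomial \<open>x\<^sub>v\<^sub>w\<^sub>0\<^bsup>k-1\<^esup> \<Prod> x\<^sub>u\<^sub>w\<^bsup>k\<^esup>\<close> (\<open>u \<noteq> v\<close>) lies outside \<open>J\<close>
  but is multiplied into \<open>J\<close> by each of these variables.

  For the regularity, let \<open>A\<close> be a maximum independent set of \<open>H\<close>. Weak homomorphisms into \<open>A\<close> are the
  maps that are constant on the components of \<open>G\<close>. In the multidegree that is \<open>k\<close> on one column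
  \<open>j\<^sub>0\<close> of \<open>A\<close>, \<open>1\<close> on the other columns of \<open>A\<close> and \<open>0\<close> elsewhere, the simplicial complex computing
  the Koszul homology of \<open>J\<close> is, up to homotopy, the join over the components of \<open>G\<close> of the boundaries
  of the simplex on \<open>A\<close>, a sphere. Its fundamental cycle is detected by an explicit cocycle.
\<close>

text \<open>\<open>graded_betti\<close> reads a resolution picked by choice, so two facts carry the
  bounds: a minimal resolution exists, and every graded free resolution has the claimed generator.
  For the second, a Koszul class of \<open>J\<close> travels along the resolution by connecting
  homomorphisms; each stage trades one homological degree for one position and keeps the internal
  degree, so a class in homological degree \<open>i\<close> ends as a generator in position
  \<open>i\<close>. For the first, all modules are multigraded: a homogeneous entry is a scalar
  times one monomial, and Dickson's lemma yields finite generation.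

  The regularity bound is a difference: the cycle has internal degree \<open>n(k + |A| - 1)\<close>,
  the size of its multidegree, and homological degree \<open>c(|A| - 1)\<close>, the number of
  vertices of a facet of the join.

  The obstacle is signs. Cycle and cocycle rest on cancellations that exchange two points of one
  component, respectively of one component and column. With the variables ordered by component, then
  column, then vertex, no point outside such a group separates the two.\<close>

section \<open>Monomials, divisibility and homogeneous parts of polynomials\<close>

lemma poly_mapping_decomp:
  fixes p :: "'a \<Rightarrow>\<^sub>0 'b::comm_monoid_add"
  assumes "finite A" "Poly_Mapping.keys p \<subseteq> A"
  shows "p = (\<Sum>t\<in>A. Poly_Mapping.single t (Poly_Mapping.lookup p t))"
proof (rule poly_mapping_eqI)
  fix k
  have "Poly_Mapping.lookup (\<Sum>t\<in>A. Poly_Mapping.single t (Poly_Mapping.lookup p t)) k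
     = (\<Sum>t\<in>A. if t = k then Poly_Mapping.lookup p k else 0)"
    by (auto simp: lookup_sum lookup_single when_def intro!: sum.cong)
  also have "\<dots> = Poly_Mapping.lookup p k"
    using assms by (auto simp: sum.delta in_keys_iff)
  finally show "Poly_Mapping.lookup p k
      = Poly_Mapping.lookup (\<Sum>t\<in>A. Poly_Mapping.single t (Poly_Mapping.lookup p t)) k" ..
qed

definition mon_le :: "('x \<Rightarrow>\<^sub>0 nat) \<Rightarrow> ('x \<Rightarrow>\<^sub>0 nat) \<Rightarrow> bool" where
  "mon_le s t \<longleftrightarrow> (\<forall>x. Poly_Mapping.lookup s x \<le> Poly_Mapping.lookup t x)"

lemma mon_le_add_diff: "mon_le s t \<Longrightarrow> s + (t - s) = t"
  by (rule poly_mapping_eqI) (simp add: mon_le_def lookup_add lookup_minus)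

lemma mon_le_iff_add: "mon_le s t \<longleftrightarrow> (\<exists>u. t = s + u)"
proof
  assume "mon_le s t"
  then show "\<exists>u. t = s + u" using mon_le_add_diff[of s t] by metis
qed (auto simp: mon_le_def lookup_add)

lemma mon_le_single [simp]: "mon_le (Poly_Mapping.single x (Suc 0)) t \<longleftrightarrow> x \<in> Poly_Mapping.keys t"
  by (auto simp: mon_le_def lookup_single when_def in_keys_iff Suc_le_eq)

lemma mon_le_trans: "mon_le s t \<Longrightarrow> mon_le t u \<Longrightarrow> mon_le s u"
  unfolding mon_le_def using le_trans by blast

lemma lookup_single_mult:
  fixes f :: "('x \<Rightarrow>\<^sub>0 nat) \<Rightarrow>\<^sub>0 'k::comm_ring_1"
  shows "Poly_Mapping.lookup (Poly_Mapping.single s c * f) t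
    = (if mon_le s t then c * Poly_Mapping.lookup f (t - s) else 0)"
proof -
  have eq: "Poly_Mapping.lookup (Poly_Mapping.single s c * f) t
      = c * (\<Sum>q. Poly_Mapping.lookup f q when t = s + q)"
    by (simp add: lookup_mult lookup_single when_mult)
  show ?thesis
  proof (cases "mon_le s t")
    case True
    then have *: "t = s + q \<longleftrightarrow> q = t - s" for q
      using mon_le_add_diff[OF True] by (metis add_diff_cancel_left')
    show ?thesis using True unfolding eq * by simp
  next
    case False
    then have "t \<noteq> s + q" for q by (auto simp: mon_le_iff_add)
    then show ?thesis using False unfolding eq by simp
  qed
qed

lemma mon_deg_UNIV: "mon_deg u = (\<Sum>x\<in>UNIV. Poly_Mapping.lookup (u :: 'x::finite \<Rightarrow>\<^sub>0 nat) x)"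
  unfolding mon_deg_def by (rule sum.mono_neutral_left) (auto simp: in_keys_iff)

lemma mon_deg_add: "mon_deg (s + t) = mon_deg s + mon_deg (t :: 'x::finite \<Rightarrow>\<^sub>0 nat)"
  by (simp add: mon_deg_UNIV lookup_add sum.distrib)

lemma mon_deg_single [simp]: "mon_deg (Poly_Mapping.single x n) = n"
  by (simp add: mon_deg_def)

lemma mon_deg_zero [simp]: "mon_deg 0 = 0"
  by (simp add: mon_deg_def)

lemma mon_deg_eq_0_iff [simp]: "mon_deg t = 0 \<longleftrightarrow> t = 0"
  by (auto simp: mon_deg_def in_keys_iff intro!: poly_mapping_eqI)

text \<open>With a degree condition as \<open>P\<close> this is the projection onto a homogeneous
  component; the predicate lets one construction serve both total degree and multidegree.\<close>

definition restr :: "('a \<Rightarrow> bool) \<Rightarrow> ('a \<Rightarrow>\<^sub>0 'b::comm_monoid_add) \<Rightarrow> ('a \<Rightarrow>\<^sub>0 'b)" where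
  "restr P p = (\<Sum>t\<in>{t \<in> Poly_Mapping.keys p. P t}. Poly_Mapping.single t (Poly_Mapping.lookup p t))"

lemma lookup_restr: "Poly_Mapping.lookup (restr P p) t = (if P t then Poly_Mapping.lookup p t else 0)"
proof -
  have "Poly_Mapping.lookup (restr P p) t
      = (\<Sum>s\<in>{s \<in> Poly_Mapping.keys p. P s}. if s = t then Poly_Mapping.lookup p t else 0)"
    by (auto simp: restr_def lookup_sum lookup_single when_def intro!: sum.cong)
  also have "\<dots> = (if P t then Poly_Mapping.lookup p t else 0)"
    by (auto simp: sum.delta in_keys_iff)
  finally show ?thesis .
qed

lemma keys_restr: "Poly_Mapping.keys (restr P p) = {t \<in> Poly_Mapping.keys p. P t}"
  by (auto simp: in_keys_iff lookup_restr split: if_splits)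

lemma restr_add: "restr P (p + q) = restr P p + restr P q"
  by (rule poly_mapping_eqI) (simp add: lookup_restr lookup_add)

lemma restr_zero [simp]: "restr P 0 = 0"
  by (rule poly_mapping_eqI) (simp add: lookup_restr)

lemma restr_sum: "restr P (\<Sum>i\<in>A. f i) = (\<Sum>i\<in>A. restr P (f i))"
  by (induction A rule: infinite_finite_induct) (simp_all add: restr_add)

lemma restr_eq_self: "(\<And>t. t \<in> Poly_Mapping.keys p \<Longrightarrow> P t) \<Longrightarrow> restr P p = p"
  by (rule poly_mapping_eqI) (auto simp: lookup_restr in_keys_iff)

lemma restr_eq_zero: "(\<And>t. t \<in> Poly_Mapping.keys p \<Longrightarrow> \<not> P t) \<Longrightarrow> restr P p = 0"
  by (rule poly_mapping_eqI) (auto simp: lookup_restr in_keys_iff)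

text \<open>Split \<open>f\<close> into its \<open>P\<close>-part and the rest: \<open>D\<close>
  carries the first into exponents satisfying \<open>Q\<close> and the second into exponents
  violating it. For homogeneous \<open>D\<close>, multiplication thus commutes with taking
  components, up to the shift in degree.\<close>

lemma restr_mult:
  fixes D f :: "('x, 'k::comm_ring_1) polyn"
  assumes "\<And>s t. s \<in> Poly_Mapping.keys D \<Longrightarrow> Q (s + t) \<longleftrightarrow> P t"
  shows "D * restr P f = restr Q (D * f)"
proof -
  have f: "f = restr P f + restr (\<lambda>t. \<not> P t) f"
    by (rule poly_mapping_eqI) (simp add: lookup_restr lookup_add)
  have 1: "restr Q (D * restr P f) = D * restr P f"
    using keys_mult[of D "restr P f"] assms
    by (intro restr_eq_self) (force simp: keys_restr)
  have 2: "restr Q (D * restr (\<lambda>t. \<not> P t) f) = 0"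
    using keys_mult[of D "restr (\<lambda>t. \<not> P t) f"] assms
    by (intro restr_eq_zero) (force simp: keys_restr)
  have "restr Q (D * f) = restr Q (D * restr P f) + restr Q (D * restr (\<lambda>t. \<not> P t) f)"
    by (subst f) (simp add: distrib_left restr_add)
  with 1 2 show ?thesis by simp
qed

text \<open>Without a constant term every monomial is divisible by a variable; \<open>\<chi>\<close>
  selects one, and the monomials are grouped by the selected variable.\<close>

lemma var_decomposition:
  fixes f :: "('x::finite, 'k::comm_ring_1) polyn"
  assumes "Poly_Mapping.lookup f 0 = 0"
  obtains g where "f = (\<Sum>x\<in>UNIV. var x * g x)"
proof -
  define \<chi> where "\<chi> t = (SOME x. x \<in> Poly_Mapping.keys t)" for t :: "'x \<Rightarrow>\<^sub>0 nat"
  define g where "g x = (\<Sum>t\<in>{t \<in> Poly_Mapping.keys f. \<chi> t = x}.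
     Poly_Mapping.single (t - Poly_Mapping.single x 1) (Poly_Mapping.lookup f t))" for x
  have \<chi>: "\<chi> t \<in> Poly_Mapping.keys t" if "t \<in> Poly_Mapping.keys f" for t
  proof -
    have "t \<noteq> 0" using that assms by (auto simp: in_keys_iff)
    then have "Poly_Mapping.keys t \<noteq> {}" by auto
    then show ?thesis unfolding \<chi>_def by (simp add: some_in_eq)
  qed
  have "var x * g x = (\<Sum>t\<in>{t \<in> Poly_Mapping.keys f. \<chi> t = x}. Poly_Mapping.single t (Poly_Mapping.lookup f t))" for x
    unfolding g_def sum_distrib_left var_def mult_single
    by (rule sum.cong) (use \<chi> in \<open>auto simp: mon_le_add_diff\<close>)
  then have "(\<Sum>x\<in>UNIV. var x * g x)
      = (\<Sum>x\<in>UNIV. \<Sum>t\<in>{t \<in> Poly_Mapping.keys f. \<chi> t = x}. Poly_Mapping.single t (Poly_Mapping.lookup f t))"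
    by simp
  also have "\<dots> = (\<Sum>t\<in>Poly_Mapping.keys f. Poly_Mapping.single t (Poly_Mapping.lookup f t))"
    by (rule sum.group) auto
  also have "\<dots> = f" using poly_mapping_decomp[of "Poly_Mapping.keys f" f] by simp
  finally show thesis using that[of g] by simp
qed

section \<open>The Koszul complex\<close>

text \<open>The sign that sorts \<open>e_x\<close> into the wedge product \<open>e_T\<close> when
  the variables are ordered by \<open>\<rho>\<close>.\<close>

definition ksgn :: "('x \<Rightarrow> nat) \<Rightarrow> 'x \<Rightarrow> 'x set \<Rightarrow> 'k::comm_ring_1" where
  "ksgn \<rho> x T = (- 1) ^ card {y \<in> T. \<rho> y < \<rho> x}"

text \<open>A Koszul chain is encoded by its coefficients, \<open>f T\<close> being that of
  \<open>e_T\<close>. The value at \<open>T\<close> therefore collects the simplices one element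
  larger, and the homological degree appears only as \<open>card T\<close>.\<close>

definition kdiff ::
    "('x \<Rightarrow> nat) \<Rightarrow> 'x set \<Rightarrow> ('x set \<Rightarrow> ('x, 'k::comm_ring_1) polyn) \<Rightarrow> 'x set \<Rightarrow> ('x, 'k) polyn" where
  "kdiff \<rho> X f T = (\<Sum>x\<in>X - T. Poly_Mapping.single (Poly_Mapping.single x (Suc 0)) (ksgn \<rho> x T) * f (insert x T))"

lemma lookup_kdiff:
  "Poly_Mapping.lookup (kdiff \<rho> X f T) t = (\<Sum>x\<in>X - T. if x \<in> Poly_Mapping.keys t
     then ksgn \<rho> x T * Poly_Mapping.lookup (f (insert x T)) (t - Poly_Mapping.single x (Suc 0)) else 0)"
  unfolding kdiff_def lookup_sum
  by (rule sum.cong) (simp_all add: lookup_single_mult)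

lemma kdiff_diff: "kdiff \<rho> X (\<lambda>T. f T - g T) T = kdiff \<rho> X f T - kdiff \<rho> X g T"
  by (simp add: kdiff_def right_diff_distrib sum_subtractf)

lemma kdiff_mult: "kdiff \<rho> X (\<lambda>T. c * f T) T = c * kdiff \<rho> X f T"
  by (simp add: kdiff_def sum_distrib_left mult_ac)

lemma kdiff_sum: "kdiff \<rho> X (\<lambda>T. \<Sum>i\<in>A. f i T) T = (\<Sum>i\<in>A. kdiff \<rho> X (f i) T)"
  unfolding kdiff_def sum_distrib_left by (rule sum.swap)

lemma keys_kdiff:
  assumes "t \<in> Poly_Mapping.keys (kdiff \<rho> X f T)"
  obtains x s where "x \<in> X - T" "s \<in> Poly_Mapping.keys (f (insert x T))"
    "t = Poly_Mapping.single x (Suc 0) + s"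
proof -
  have "\<exists>x\<in>X - T. x \<in> Poly_Mapping.keys t \<and>
      Poly_Mapping.lookup (f (insert x T)) (t - Poly_Mapping.single x (Suc 0)) \<noteq> 0"
  proof (rule ccontr)
    assume "\<not> ?thesis"
    then have "Poly_Mapping.lookup (kdiff \<rho> X f T) t = 0"
      unfolding lookup_kdiff by (intro sum.neutral) auto
    with assms show False by (simp add: in_keys_iff)
  qed
  then obtain x where x: "x \<in> X - T" "x \<in> Poly_Mapping.keys t"
      "Poly_Mapping.lookup (f (insert x T)) (t - Poly_Mapping.single x (Suc 0)) \<noteq> 0" by blast
  show thesis
    by (rule that[OF x(1), of "t - Poly_Mapping.single x (Suc 0)"])
      (use x mon_le_add_diff[of "Poly_Mapping.single x (Suc 0)" t] in \<open>auto simp: in_keys_iff\<close>)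
qed

text \<open>Exactly one of the two variables precedes the other, so inserting it first changes the
  other's count by one, while the reverse order of insertion changes nothing.\<close>

lemma ksgn_swap:
  assumes \<rho>: "inj \<rho>" and "finite T" "x \<notin> T" "y \<notin> T" "x \<noteq> y"
  shows "ksgn \<rho> x T * ksgn \<rho> y (insert x T) = - (ksgn \<rho> y T * ksgn \<rho> x (insert y T) :: 'k::comm_ring_1)"
proof -
  have c: "card {z \<in> insert u T. \<rho> z < \<rho> v} = card {z \<in> T. \<rho> z < \<rho> v} + (if \<rho> u < \<rho> v then 1 else 0)"
    if "u \<notin> T" for u v
  proof -
    have "{z \<in> insert u T. \<rho> z < \<rho> v} = (if \<rho> u < \<rho> v then insert u {z \<in> T. \<rho> z < \<rho> v} else {z \<in> T. \<rho> z < \<rho> v})"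
      by auto
    then show ?thesis using that assms(2) by simp
  qed
  have "\<rho> x \<noteq> \<rho> y" using \<rho> assms(5) by (auto dest: injD)
  then show ?thesis
    unfolding ksgn_def c[OF assms(3)] c[OF assms(4)] by (auto simp: power_add)
qed

text \<open>The terms indexed by \<open>(x, y)\<close> and \<open>(y, x)\<close> cancel.
  Antisymmetry of the whole sum would only show that twice it is zero, so the pairs are first split
  by the order of \<open>\<rho>\<close>; this covers characteristic 2.\<close>

lemma kdiff_kdiff:
  fixes f :: "'x::finite set \<Rightarrow> ('x, 'k::comm_ring_1) polyn"
  assumes \<rho>: "inj \<rho>"
  shows "kdiff \<rho> X (kdiff \<rho> X f) T = 0"
proof -
  define h where "h x y = Poly_Mapping.single (Poly_Mapping.single x (Suc 0) + Poly_Mapping.single y (Suc 0))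
     (ksgn \<rho> x T * ksgn \<rho> y (insert x T)) * f (insert x (insert y T))" for x y
  have h: "h x y = - h y x" if "x \<notin> T" "y \<notin> T" "x \<noteq> y" for x y
    unfolding h_def ksgn_swap[OF \<rho> finite that]
    by (simp add: single_uminus insert_commute add.commute)
  let ?P = "Sigma (X - T) (\<lambda>x. X - insert x T)"
  have "kdiff \<rho> X (kdiff \<rho> X f) T = (\<Sum>x\<in>X - T. \<Sum>y\<in>X - insert x T. h x y)"
    unfolding kdiff_def[of \<rho> X "kdiff \<rho> X f"] unfolding kdiff_def sum_distrib_left h_def
    by (intro sum.cong refl) (simp add: mult.assoc[symmetric] mult_single insert_commute)
  also have "\<dots> = (\<Sum>(x,y)\<in>?P. h x y)"
    by (rule sum.Sigma) auto
  also have "\<dots> = (\<Sum>(x,y)\<in>{(x,y)\<in>?P. \<rho> x < \<rho> y} \<union> {(x,y)\<in>?P. \<rho> y < \<rho> x}. h x y)"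
  proof (rule sum.cong)
    show "?P = {(x,y)\<in>?P. \<rho> x < \<rho> y} \<union> {(x,y)\<in>?P. \<rho> y < \<rho> x}"
      using \<rho> by (auto simp: inj_def) (metis linorder_neqE_nat)
  qed simp
  also have "\<dots> = (\<Sum>(x,y)\<in>{(x,y)\<in>?P. \<rho> x < \<rho> y}. h x y) + (\<Sum>(x,y)\<in>{(x,y)\<in>?P. \<rho> y < \<rho> x}. h x y)"
    by (rule sum.union_disjoint) auto
  also have "(\<Sum>(x,y)\<in>{(x,y)\<in>?P. \<rho> y < \<rho> x}. h x y) = (\<Sum>(x,y)\<in>{(x,y)\<in>?P. \<rho> x < \<rho> y}. - h x y)"
    by (rule sum.reindex_bij_witness[where i="\<lambda>(x,y). (y,x)" and j="\<lambda>(x,y). (y,x)"])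
      (auto intro!: h[symmetric])
  also have "(\<Sum>(x,y)\<in>{(x,y)\<in>?P. \<rho> x < \<rho> y}. h x y) + \<dots> = 0"
    by (simp add: sum.distrib[symmetric] case_prod_unfold)
  finally show ?thesis .
qed

lemma finite_lookup_shift:
  fixes p :: "('x, 'k::comm_ring_1) polyn"
  shows "finite {s. Poly_Mapping.lookup p (s + u) \<noteq> 0}"
proof (rule finite_imageD[of "\<lambda>s. s + u"])
  show "finite ((\<lambda>s. s + u) ` {s. Poly_Mapping.lookup p (s + u) \<noteq> 0})"
    by (rule finite_subset[OF _ finite_keys[of p]]) (auto simp: in_keys_iff)
qed (auto simp: inj_on_def)

text \<open>The contracting homotopy moves the smallest variable of the multidegree of
  \<open>x\<^sup>t e\<^sub>T\<close> from the monomial into the exterior part.\<close>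

lemma koszul_exact:
  fixes z :: "'x::finite set \<Rightarrow> ('x, 'k::comm_ring_1) polyn"
  assumes \<rho>: "inj \<rho>" and cyc: "\<And>T. T \<subseteq> X \<Longrightarrow> card T = p \<Longrightarrow> kdiff \<rho> X z T = 0"
  obtains v where "\<And>T. T \<subseteq> X \<Longrightarrow> card T = Suc p \<Longrightarrow> kdiff \<rho> X v T = z T"
proof -
  define \<mu> where "\<mu> Y = arg_min_on \<rho> Y" for Y
  have \<mu>: "\<mu> Y \<in> Y" "\<And>y. y \<in> Y \<Longrightarrow> y \<noteq> \<mu> Y \<Longrightarrow> \<rho> (\<mu> Y) < \<rho> y" if "Y \<noteq> {}" for Y
  proof -
    show "\<mu> Y \<in> Y" unfolding \<mu>_def using that by (intro arg_min_if_finite) auto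
    fix y assume y: "y \<in> Y" "y \<noteq> \<mu> Y"
    have "\<rho> (\<mu> Y) \<le> \<rho> y" unfolding \<mu>_def using that y by (intro arg_min_least) auto
    moreover have "\<rho> (\<mu> Y) \<noteq> \<rho> y" using y \<rho> by (auto dest: injD)
    ultimately show "\<rho> (\<mu> Y) < \<rho> y" by simp
  qed
  \<comment> \<open>The support in \<open>X\<close> of the multidegree of \<open>x^t e_T\<close>. It
    does not change when a variable of \<open>X\<close> moves between the monomial and the exterior
    part, so all terms of one boundary coefficient share the same smallest variable.\<close>
  define W where "W T t = T \<union> (Poly_Mapping.keys t \<inter> X)" for T :: "'x set" and t :: "'x \<Rightarrow>\<^sub>0 nat"
  define c where "c T t = (if \<mu> (W T t) \<in> T then
     Poly_Mapping.lookup (z (T - {\<mu> (W T t)})) (t + Poly_Mapping.single (\<mu> (W T t)) (Suc 0)) else 0)" for T t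
  define v where "v T = Poly_Mapping.Abs_poly_mapping (c T)" for T
  have fin: "finite {t. c T t \<noteq> 0}" for T
  proof (rule finite_subset)
    show "{t. c T t \<noteq> 0} \<subseteq> (\<Union>x\<in>UNIV. {t. Poly_Mapping.lookup (z (T - {x})) (t + Poly_Mapping.single x (Suc 0)) \<noteq> 0})"
      by (auto simp: c_def split: if_splits)
  qed (simp add: finite_lookup_shift)
  have v: "Poly_Mapping.lookup (v T) t = c T t" for T t
    unfolding v_def using fin by simp
  have "kdiff \<rho> X v T = z T" if T: "T \<subseteq> X" "card T = Suc p" for T
  proof (rule poly_mapping_eqI)
    fix t
    let ?s = "\<lambda>x::'x. Poly_Mapping.single x (Suc 0)"
    define m where "m = \<mu> (W T t)"
    have ne: "W T t \<noteq> {}" using T by (auto simp: W_def)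
    have m: "m \<in> W T t" "\<And>y. y \<in> W T t \<Longrightarrow> y \<noteq> m \<Longrightarrow> \<rho> m < \<rho> y"
      using \<mu>[OF ne] by (auto simp: m_def)
    have W: "W (insert x T) (t - ?s x) = W T t" if "x \<in> X - T" "x \<in> Poly_Mapping.keys t" for x
      using that by (auto simp: W_def in_keys_iff lookup_minus lookup_single when_def split: if_splits)
    have L: "Poly_Mapping.lookup (kdiff \<rho> X v T) t = (\<Sum>x\<in>X - T. if x \<in> Poly_Mapping.keys t
        then ksgn \<rho> x T * (if m \<in> insert x T then Poly_Mapping.lookup (z (insert x T - {m})) (t - ?s x + ?s m) else 0) else 0)"
      unfolding lookup_kdiff by (rule sum.cong) (simp_all add: v c_def W m_def[symmetric])
    show "Poly_Mapping.lookup (kdiff \<rho> X v T) t = Poly_Mapping.lookup (z T) t"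
    proof (cases "m \<in> T")
      \<comment> \<open>Only the term \<open>x = m\<close> survives, with sign 1 because
        \<open>m\<close> precedes all of \<open>T\<close>; it returns the coefficient of
        \<open>z T\<close>.\<close>
      case False
      have sg: "ksgn \<rho> m T = (1 :: 'k)"
      proof -
        have e: "{y \<in> T. \<rho> y < \<rho> m} = {}" using m(2) False by (force simp: W_def)
        show ?thesis unfolding ksgn_def e by simp
      qed
      have mX: "m \<in> X" "m \<in> Poly_Mapping.keys t" using m(1) False T by (auto simp: W_def)
      have "Poly_Mapping.lookup (kdiff \<rho> X v T) t = (\<Sum>x\<in>X - T. if x = m then Poly_Mapping.lookup (z T) t else 0)"
        unfolding L
      proof (rule sum.cong)
        fix x assume "x \<in> X - T"
        show "(if x \<in> Poly_Mapping.keys t then ksgn \<rho> x T * (if m \<in> insert x T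
            then Poly_Mapping.lookup (z (insert x T - {m})) (t - ?s x + ?s m) else 0) else 0)
          = (if x = m then Poly_Mapping.lookup (z T) t else 0)"
          using False mX mon_le_add_diff[of "?s m" t] sg by (auto simp: add.commute)
      qed simp
      also have "\<dots> = Poly_Mapping.lookup (z T) t" using mX False by (simp add: sum.delta)
      finally show ?thesis .
    next
      \<comment> \<open>Now the cycle condition at \<open>T - {m}\<close> and exponent
        \<open>t + m\<close> expresses the coefficient of \<open>z T\<close> through the remaining
        ones; having \<open>m\<close> in the set or not flips each of their signs.\<close>
      case True
      let ?U = "T - {m}"
      have U: "?U \<subseteq> X" "card ?U = p" using T True by auto
      have XU: "X - ?U = insert m (X - T)" using True T by auto
      have sgm: "ksgn \<rho> m ?U = (1 :: 'k)"
      proof -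
        have e: "{y \<in> ?U. \<rho> y < \<rho> m} = {}" using m(2) by (force simp: W_def)
        show ?thesis unfolding ksgn_def e by simp
      qed
      have sgx: "ksgn \<rho> x T = - (ksgn \<rho> x ?U :: 'k)" if "x \<in> X - T" "x \<in> Poly_Mapping.keys t" for x
      proof -
        have "x \<noteq> m" using that True by auto
        then have "\<rho> m < \<rho> x" using m(2)[of x] that by (auto simp: W_def)
        then have "{y \<in> T. \<rho> y < \<rho> x} = insert m {y \<in> ?U. \<rho> y < \<rho> x}" using True by auto
        then show ?thesis by (simp add: ksgn_def)
      qed
      have "0 = Poly_Mapping.lookup (kdiff \<rho> X z ?U) (t + ?s m)" using cyc[OF U] by simp
      also have "\<dots> = Poly_Mapping.lookup (z T) t + (\<Sum>x\<in>X - T. if x \<in> Poly_Mapping.keys (t + ?s m)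
         then ksgn \<rho> x ?U * Poly_Mapping.lookup (z (insert x ?U)) (t + ?s m - ?s x) else 0)"
        unfolding lookup_kdiff XU
        using True sgm by (subst sum.insert) (auto simp: insert_absorb in_keys_iff lookup_add)
      also have "(\<Sum>x\<in>X - T. if x \<in> Poly_Mapping.keys (t + ?s m)
         then ksgn \<rho> x ?U * Poly_Mapping.lookup (z (insert x ?U)) (t + ?s m - ?s x) else 0)
         = - (\<Sum>x\<in>X - T. if x \<in> Poly_Mapping.keys t
        then ksgn \<rho> x T * (if m \<in> insert x T then Poly_Mapping.lookup (z (insert x T - {m})) (t - ?s x + ?s m) else 0) else 0)"
        unfolding sum_negf[symmetric]
      proof (rule sum.cong)
        fix x assume x: "x \<in> X - T"
        then have xm: "x \<noteq> m" using True by auto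
        have k: "x \<in> Poly_Mapping.keys (t + ?s m) \<longleftrightarrow> x \<in> Poly_Mapping.keys t"
          using xm by (auto simp: in_keys_iff lookup_add lookup_single)
        have i: "insert x T - {m} = insert x ?U" using xm by auto
        have e: "t + ?s m - ?s x = t - ?s x + ?s m" if "x \<in> Poly_Mapping.keys t"
          using that xm by (intro poly_mapping_eqI)
            (auto simp: lookup_add lookup_minus lookup_single when_def in_keys_iff)
        show "(if x \<in> Poly_Mapping.keys (t + ?s m)
         then ksgn \<rho> x ?U * Poly_Mapping.lookup (z (insert x ?U)) (t + ?s m - ?s x) else 0) =
         - (if x \<in> Poly_Mapping.keys t
        then ksgn \<rho> x T * (if m \<in> insert x T then Poly_Mapping.lookup (z (insert x T - {m})) (t - ?s x + ?s m) else 0) else 0)"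
          using True sgx[OF x] by (simp add: k i e)
      qed simp
      finally show ?thesis unfolding L by (simp add: algebra_simps)
    qed
  qed
  then show thesis by (rule that)
qed

section \<open>Koszul homology along a free resolution\<close>

text \<open>Vectors are functions on \<open>nat\<close>, so that free modules of all ranks share one
  type during the induction along the resolution.\<close>

definition lin :: "nat \<Rightarrow> (nat \<Rightarrow> nat \<Rightarrow> 'a::comm_ring_1) \<Rightarrow> (nat \<Rightarrow> 'a) \<Rightarrow> nat \<Rightarrow> 'a" where
  "lin n D f = (\<lambda>a. \<Sum>b<n. D a b * f b)"

text \<open>Vanishing of the \<open>p\<close>-th Koszul homology of \<open>M\<close> with respect to
  \<open>X\<close> in internal degree \<open>j\<close>, where the \<open>a\<close>-th basis element
  of the ambient free module has degree \<open>\<epsilon> a\<close>. The cycle is required to be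
  homogeneous, the bounding chain is not.\<close>

definition koszul_vanish ::
    "('x \<Rightarrow> nat) \<Rightarrow> 'x set \<Rightarrow> nat \<Rightarrow> nat \<Rightarrow> (nat \<Rightarrow> nat) \<Rightarrow> (nat \<Rightarrow> ('x, 'k::comm_ring_1) polyn) set \<Rightarrow> bool" where
  "koszul_vanish \<rho> X p j \<epsilon> M \<longleftrightarrow> (\<forall>z.
     (\<forall>T\<subseteq>X. card T = p \<longrightarrow> (\<lambda>a. z a T) \<in> M \<and>
        (\<forall>a. \<forall>t\<in>Poly_Mapping.keys (z a T). mon_deg t + \<epsilon> a + p = j)) \<longrightarrow>
     (\<forall>a. \<forall>T\<subseteq>X. card T + 1 = p \<longrightarrow> kdiff \<rho> X (z a) T = 0) \<longrightarrow>
     (\<exists>v. (\<forall>T\<subseteq>X. card T = Suc p \<longrightarrow> (\<lambda>a. v a T) \<in> M) \<and>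
        (\<forall>a. \<forall>T\<subseteq>X. card T = p \<longrightarrow> kdiff \<rho> X (v a) T = z a T)))"

lemma kdiff_cong:
  "(\<And>x. x \<in> X - T \<Longrightarrow> f (insert x T) = g (insert x T)) \<Longrightarrow> kdiff \<rho> X f T = kdiff \<rho> X g T"
  unfolding kdiff_def by (rule sum.cong) auto

lemma kdiff_lin:
  "kdiff \<rho> X (\<lambda>T. lin n D (\<lambda>b. f b T) a) T = lin n D (\<lambda>b. kdiff \<rho> X (f b) T) a"
  by (simp add: lin_def kdiff_sum kdiff_mult)

lemma lin_restr:
  fixes D :: "nat \<Rightarrow> nat \<Rightarrow> ('x::finite, 'k::comm_ring_1) polyn"
  assumes hom: "\<And>b t. b < n \<Longrightarrow> t \<in> Poly_Mapping.keys (D a b) \<Longrightarrow> mon_deg t + \<epsilon> a = \<eta> b"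
  shows "lin n D (\<lambda>b. restr (\<lambda>t. mon_deg t + \<eta> b + p = j) (f b)) a
    = restr (\<lambda>t. mon_deg t + \<epsilon> a + p = j) (lin n D f a)"
  unfolding lin_def restr_sum
proof (rule sum.cong)
  fix b assume "b \<in> {..<n}"
  then have h: "mon_deg t + \<epsilon> a = \<eta> b" if "t \<in> Poly_Mapping.keys (D a b)" for t
    using hom that by blast
  show "D a b * restr (\<lambda>t. mon_deg t + \<eta> b + p = j) (f b)
     = restr (\<lambda>t. mon_deg t + \<epsilon> a + p = j) (D a b * f b)"
    by (rule restr_mult) (use h in \<open>auto simp: mon_deg_add ac_simps\<close>)
qed simp

text \<open>The connecting homomorphism of the sequence \<open>0 \<rightarrow> N \<rightarrow> F \<rightarrow> M \<rightarrow> 0\<close>, where the free module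
  \<open>F\<close> has no Koszul homology in positive degree.\<close>

lemma koszul_vanish_step:
  fixes D :: "nat \<Rightarrow> nat \<Rightarrow> ('x::finite, 'k::comm_ring_1) polyn"
  assumes \<rho>: "inj \<rho>"
    and hom: "\<And>a b t. b < n \<Longrightarrow> t \<in> Poly_Mapping.keys (D a b) \<Longrightarrow> mon_deg t + \<epsilon> a = \<eta> b"
    and van: "koszul_vanish \<rho> X p j \<eta> {f. (\<forall>b\<ge>n. f b = 0) \<and> lin n D f = (\<lambda>_. 0)}"
  shows "koszul_vanish \<rho> X (Suc p) j \<epsilon> (range (lin n D))"
  unfolding koszul_vanish_def
proof (intro allI impI)
  let ?N = "{f. (\<forall>b\<ge>n. f b = 0) \<and> lin n D f = (\<lambda>_. 0)}"
  fix z :: "nat \<Rightarrow> 'x set \<Rightarrow> ('x, 'k) polyn"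
  assume z: "\<forall>T\<subseteq>X. card T = Suc p \<longrightarrow> (\<lambda>a. z a T) \<in> range (lin n D) \<and>
        (\<forall>a. \<forall>t\<in>Poly_Mapping.keys (z a T). mon_deg t + \<epsilon> a + Suc p = j)"
    and cyc: "\<forall>a. \<forall>T\<subseteq>X. card T + 1 = Suc p \<longrightarrow> kdiff \<rho> X (z a) T = 0"
  have "\<forall>T. \<exists>f. T \<subseteq> X \<longrightarrow> card T = Suc p \<longrightarrow> (\<lambda>a. z a T) = lin n D f" using z by blast
  then obtain f where f: "\<And>T. T \<subseteq> X \<Longrightarrow> card T = Suc p \<Longrightarrow> (\<lambda>a. z a T) = lin n D (f T)" by metis
  \<comment> \<open>A lift of the cycle to the free module, cut down to internal degree
    \<open>j\<close> so that its boundary is homogeneous, as the vanishing hypothesis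
    demands.\<close>
  define w where "w b T = (if b < n \<and> T \<subseteq> X \<and> card T = Suc p
     then restr (\<lambda>t. mon_deg t + \<eta> b + Suc p = j) (f T b) else 0)" for b T
  have wz: "lin n D (\<lambda>b. w b T) a = z a T" if T: "T \<subseteq> X" "card T = Suc p" for T a
  proof -
    have "lin n D (\<lambda>b. w b T) a = lin n D (\<lambda>b. restr (\<lambda>t. mon_deg t + \<eta> b + Suc p = j) (f T b)) a"
      unfolding lin_def by (rule sum.cong) (use T in \<open>auto simp: w_def\<close>)
    also have "\<dots> = restr (\<lambda>t. mon_deg t + \<epsilon> a + Suc p = j) (lin n D (f T) a)"
      by (rule lin_restr) (rule hom)
    also have "lin n D (f T) a = z a T" using fun_cong[OF f[OF T], of a] by simp
    also have "restr (\<lambda>t. mon_deg t + \<epsilon> a + Suc p = j) (z a T) = z a T"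
      by (rule restr_eq_self) (use z T in blast)
    finally show ?thesis .
  qed
  \<comment> \<open>The image of the class under the connecting homomorphism: \<open>D\<close> maps
    the boundary of the lift to the boundary of \<open>z\<close>, which is zero.\<close>
  define y where "y b T = kdiff \<rho> X (w b) T" for b T
  have yN: "(\<lambda>b. y b T) \<in> ?N \<and> (\<forall>b. \<forall>t\<in>Poly_Mapping.keys (y b T). mon_deg t + \<eta> b + p = j)"
    if T: "T \<subseteq> X" "card T = p" for T
  proof -
    have ins: "insert x T \<subseteq> X" "card (insert x T) = Suc p" if "x \<in> X - T" for x
      using T that by auto
    have "lin n D (\<lambda>b. y b T) a = 0" for a
    proof -
      have "lin n D (\<lambda>b. y b T) a = kdiff \<rho> X (\<lambda>T. lin n D (\<lambda>b. w b T) a) T"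
        unfolding y_def kdiff_lin ..
      also have "\<dots> = kdiff \<rho> X (z a) T"
        by (rule kdiff_cong) (rule wz[OF ins])
      also have "\<dots> = 0" using cyc T by simp
      finally show ?thesis .
    qed
    moreover have "y b T = 0" if "b \<ge> n" for b
      using that by (simp add: y_def w_def kdiff_def)
    moreover have "mon_deg t + \<eta> b + p = j" if "t \<in> Poly_Mapping.keys (y b T)" for b t
    proof -
      from that obtain x s where x: "x \<in> X - T" "s \<in> Poly_Mapping.keys (w b (insert x T))"
        "t = Poly_Mapping.single x 1 + s" unfolding y_def by (auto elim: keys_kdiff)
      then have "mon_deg s + \<eta> b + Suc p = j"
        by (auto simp: w_def keys_restr split: if_splits)
      then show ?thesis by (simp add: x(3) mon_deg_add)
    qed
    ultimately show ?thesis by auto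
  qed
  have yc: "\<forall>a. \<forall>T\<subseteq>X. card T + 1 = p \<longrightarrow> kdiff \<rho> X (y a) T = 0"
    unfolding y_def using kdiff_kdiff[OF \<rho>] by blast
  obtain u where u: "\<And>T. T \<subseteq> X \<Longrightarrow> card T = Suc p \<Longrightarrow> (\<lambda>a. u a T) \<in> ?N"
     and uy: "\<And>a T. T \<subseteq> X \<Longrightarrow> card T = p \<Longrightarrow> kdiff \<rho> X (u a) T = y a T"
    using van[unfolded koszul_vanish_def, rule_format, of y] yN yc by blast
  \<comment> \<open>Subtracting \<open>u\<close> turns the lift into a cycle of the free module,
    bounding in each coordinate. Since \<open>u\<close> takes values in the kernel, \<open>D\<close>
    still maps the corrected lift to \<open>z\<close>.\<close>
  have "\<exists>v. \<forall>T\<subseteq>X. card T = Suc p \<longrightarrow> kdiff \<rho> X v T = w b T - u b T" for b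
  proof -
    have "kdiff \<rho> X (\<lambda>T. w b T - u b T) T = 0" if "T \<subseteq> X" "card T = p" for T
      using uy[OF that] by (simp add: kdiff_diff y_def)
    from koszul_exact[OF \<rho> this] show ?thesis by blast
  qed
  then obtain v where v: "\<And>b T. T\<subseteq>X \<Longrightarrow> card T = Suc p \<Longrightarrow> kdiff \<rho> X (v b) T = w b T - u b T"
    by metis
  show "\<exists>v. (\<forall>T\<subseteq>X. card T = Suc (Suc p) \<longrightarrow> (\<lambda>a. v a T) \<in> range (lin n D)) \<and>
        (\<forall>a. \<forall>T\<subseteq>X. card T = Suc p \<longrightarrow> kdiff \<rho> X (v a) T = z a T)"
  proof (intro exI conjI allI impI)
    fix T assume T: "T \<subseteq> X" "card T = Suc p"
    fix a
    have "kdiff \<rho> X (\<lambda>T. lin n D (\<lambda>b. v b T) a) T = lin n D (\<lambda>b. w b T - u b T) a"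
      using v[OF T] by (simp add: kdiff_lin)
    also have "\<dots> = lin n D (\<lambda>b. w b T) a - lin n D (\<lambda>b. u b T) a"
      by (simp add: lin_def right_diff_distrib sum_subtractf)
    also have "\<dots> = z a T" using u[OF T] wz[OF T] by simp
    finally show "kdiff \<rho> X (\<lambda>T. lin n D (\<lambda>b. v b T) a) T = z a T" .
  qed auto
qed

text \<open>No generator has degree \<open>j\<close>, so an element of degree \<open>j\<close> is a
  combination whose coefficients lack constant terms; expanding these in the variables exhibits it
  as a boundary. Any variable may occur in the expansion, hence \<open>X = UNIV\<close> unless the
  module is zero.\<close>

lemma koszul_vanish_0:
  fixes D :: "nat \<Rightarrow> nat \<Rightarrow> ('x::finite, 'k::comm_ring_1) polyn"
  assumes hom: "\<And>a b t. b < n \<Longrightarrow> t \<in> Poly_Mapping.keys (D a b) \<Longrightarrow> mon_deg t + \<epsilon> a = \<eta> b"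
    and j: "\<And>b. b < n \<Longrightarrow> \<eta> b \<noteq> j" and X: "n = 0 \<or> X = UNIV"
  shows "koszul_vanish \<rho> X 0 j \<epsilon> (range (lin n D))"
  unfolding koszul_vanish_def
proof (intro allI impI)
  fix z :: "nat \<Rightarrow> 'x set \<Rightarrow> ('x, 'k) polyn"
  assume z: "\<forall>T\<subseteq>X. card T = 0 \<longrightarrow> (\<lambda>a. z a T) \<in> range (lin n D) \<and>
        (\<forall>a. \<forall>t\<in>Poly_Mapping.keys (z a T). mon_deg t + \<epsilon> a + 0 = j)"
  then obtain f where f: "(\<lambda>a. z a {}) = lin n D f" by force
  define w where "w b = restr (\<lambda>t. mon_deg t + \<eta> b + 0 = j) (f b)" for b
  have wz: "lin n D w a = z a {}" for a
  proof -
    have "lin n D w a = restr (\<lambda>t. mon_deg t + \<epsilon> a + 0 = j) (lin n D f a)"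
      unfolding w_def by (rule lin_restr) (rule hom)
    also have "lin n D f a = z a {}" using fun_cong[OF f, of a] by simp
    also have "restr (\<lambda>t. mon_deg t + \<epsilon> a + 0 = j) (z a {}) = z a {}"
      by (rule restr_eq_self) (use z in simp)
    finally show ?thesis .
  qed
  have "\<exists>g. w b = (\<Sum>x\<in>UNIV. var x * g x)" if "b < n" for b
  proof -
    have "Poly_Mapping.lookup (w b) 0 = 0" using j[OF that] by (simp add: w_def lookup_restr)
    from var_decomposition[OF this] show ?thesis by blast
  qed
  then obtain g where g: "\<And>b. b < n \<Longrightarrow> w b = (\<Sum>x\<in>UNIV. var x * g b x)" by metis
  have sg: "ksgn \<rho> x {} = (1::'k)" for x by (simp add: ksgn_def)
  show "\<exists>v. (\<forall>T\<subseteq>X. card T = Suc 0 \<longrightarrow> (\<lambda>a. v a T) \<in> range (lin n D)) \<and>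
        (\<forall>a. \<forall>T\<subseteq>X. card T = 0 \<longrightarrow> kdiff \<rho> X (v a) T = z a T)"
  proof (intro exI conjI allI impI)
    fix a T assume "T \<subseteq> X" "card (T :: 'x set) = 0"
    then have T: "T = {}" by simp
    have "kdiff \<rho> X (\<lambda>T. lin n D (\<lambda>b. g b (the_elem T)) a) {} = lin n D (\<lambda>b. \<Sum>x\<in>X. var x * g b x) a"
      unfolding kdiff_lin by (simp add: kdiff_def sg var_def)
    also have "\<dots> = lin n D w a"
      unfolding lin_def using X by (intro sum.cong) (auto simp: g)
    finally show "kdiff \<rho> X (\<lambda>T. lin n D (\<lambda>b. g b (the_elem T)) a) T = z a T"
      using wz T by simp
  qed auto
qed

definition mat_fun :: "'a::comm_ring_1 mat \<Rightarrow> nat \<Rightarrow> nat \<Rightarrow> 'a" where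
  "mat_fun A a b = (if a < dim_row A \<and> b < dim_col A then A $$ (a, b) else 0)"

lemma lin_mat_fun:
  "lin (dim_col A) (mat_fun A) f a = (if a < dim_row A then (A *\<^sub>v vec (dim_col A) f) $ a else 0)"
  by (auto simp: lin_def mat_fun_def scalar_prod_def lessThan_atLeast0 intro!: sum.cong)

text \<open>If position \<open>i\<close> had no generator of degree \<open>j\<close>, the image of
  \<open>d i\<close> would have no Koszul homology in homological degree 0 and internal degree
  \<open>j\<close>. Each step towards the ideal raises the homological degree by one, and at
  \<open>d 0\<close> the vanishing contradicts the given cycle. For a proper subset \<open>X\<close>
  the start of this induction works only if position \<open>i\<close> is empty.\<close>

lemma graded_free_resolution_koszul:
  fixes J :: "('x::finite, 'k::field) polyn set"
  assumes res: "graded_free_resolution J degs d" and \<rho>: "inj \<rho>"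
    and zJ: "\<And>T. T \<subseteq> X \<Longrightarrow> card T = i \<Longrightarrow> z T \<in> J"
    and zhom: "\<And>T t. T \<subseteq> X \<Longrightarrow> card T = i \<Longrightarrow> t \<in> Poly_Mapping.keys (z T) \<Longrightarrow> mon_deg t + i = j"
    and cyc: "\<And>T. T \<subseteq> X \<Longrightarrow> card T + 1 = i \<Longrightarrow> kdiff \<rho> X z T = 0"
    and nb: "\<And>v. \<lbrakk>\<And>T. T \<subseteq> X \<Longrightarrow> card T = Suc i \<Longrightarrow> v T \<in> J;
               \<And>T. T \<subseteq> X \<Longrightarrow> card T = i \<Longrightarrow> kdiff \<rho> X v T = z T\<rbrakk> \<Longrightarrow> False"
  shows "degs i \<noteq> [] \<and> (X = UNIV \<longrightarrow> j \<in> set (degs i))"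
proof (rule ccontr)
  assume neg: "\<not> ?thesis"
  define n where "n q = length (degs q)" for q
  \<comment> \<open>Rank and degrees of the target of \<open>d q\<close>; for \<open>q = 0\<close>
    this is the ring itself, with one basis element in degree 0.\<close>
  define r where "r q = (case q of 0 \<Rightarrow> 1 | Suc q \<Rightarrow> n q)" for q
  define \<epsilon> where "\<epsilon> q = (case q of 0 \<Rightarrow> (\<lambda>_. 0) | Suc q \<Rightarrow> (!) (degs q))" for q
  define D where "D q = mat_fun (d q)" for q
  have dim: "dim_row (d q) = r q" "dim_col (d q) = n q" for q
    using res unfolding graded_free_resolution_def r_def n_def by (cases q; auto)+
  have lin: "lin (n q) (D q) f a = (if a < r q then (d q *\<^sub>v vec (n q) f) $ a else 0)" for q f a
    using lin_mat_fun[of "d q"] by (simp add: D_def dim)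
  have hom: "mon_deg t + \<epsilon> q a = \<epsilon> (Suc q) b" if "b < n q" "t \<in> Poly_Mapping.keys (D q a b)" for q a b t
  proof -
    have a: "a < r q" "t \<in> Poly_Mapping.keys (d q $$ (a, b))"
      using that by (auto simp: D_def mat_fun_def dim split: if_splits)
    then show ?thesis using res that(1) unfolding graded_free_resolution_def
      by (cases q) (auto simp: r_def \<epsilon>_def n_def)
  qed
  \<comment> \<open>Exactness, put into the form in which the kernel of one stage is the module of
    the next.\<close>
  have ker: "{f. (\<forall>b\<ge>n q. f b = 0) \<and> lin (n q) (D q) f = (\<lambda>_. 0)} = range (lin (n (Suc q)) (D (Suc q)))" for q
  proof -
    have rq: "r (Suc q) = n q" by (simp add: r_def)
    have k: "mat_kernel (d q) = (\<lambda>v. d (Suc q) *\<^sub>v v) ` carrier_vec (n (Suc q))"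
      using res by (simp add: graded_free_resolution_def n_def)
    have "vec (n q) f \<in> mat_kernel (d q) \<longleftrightarrow> lin (n q) (D q) f = (\<lambda>_. 0)" for f
    proof -
      have "vec (n q) f \<in> mat_kernel (d q) \<longleftrightarrow> (\<forall>a<r q. (d q *\<^sub>v vec (n q) f) $ a = 0)"
        unfolding mat_kernel_def dim by (auto simp: vec_eq_iff dim)
      then show ?thesis by (auto simp: fun_eq_iff lin)
    qed
    moreover have "vec (n q) f \<in> mat_kernel (d q) \<longleftrightarrow>
        (\<exists>g. \<forall>b<n q. f b = lin (n (Suc q)) (D (Suc q)) g b)" for f
    proof
      assume "vec (n q) f \<in> mat_kernel (d q)"
      then obtain v where v: "v \<in> carrier_vec (n (Suc q))" "vec (n q) f = d (Suc q) *\<^sub>v v"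
        unfolding k by auto
      then have v': "v = vec (n (Suc q)) (($) v)" by auto
      have "f b = lin (n (Suc q)) (D (Suc q)) (($) v) b" if "b < n q" for b
      proof -
        have "f b = (vec (n q) f) $ b" using that by simp
        also have "\<dots> = (d (Suc q) *\<^sub>v vec (n (Suc q)) (($) v)) $ b" using v(2) v' by simp
        finally show ?thesis using that by (simp add: lin rq)
      qed
      then show "\<exists>g. \<forall>b<n q. f b = lin (n (Suc q)) (D (Suc q)) g b" by blast
    next
      assume "\<exists>g. \<forall>b<n q. f b = lin (n (Suc q)) (D (Suc q)) g b"
      then obtain g where g: "\<And>b. b < n q \<Longrightarrow> f b = lin (n (Suc q)) (D (Suc q)) g b" by blast
      have "vec (n q) f = d (Suc q) *\<^sub>v vec (n (Suc q)) g"
        by (rule eq_vecI) (auto simp: dim rq g lin)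
      then show "vec (n q) f \<in> mat_kernel (d q)" unfolding k by auto
    qed
    ultimately have iff: "lin (n q) (D q) f = (\<lambda>_. 0) \<longleftrightarrow> (\<exists>g. \<forall>b<n q. f b = lin (n (Suc q)) (D (Suc q)) g b)" for f
      by blast
    have big: "lin (n (Suc q)) (D (Suc q)) g b = 0" if "b \<ge> n q" for g b
      using that by (simp add: lin rq)
    show ?thesis
    proof (intro equalityI subsetI)
      fix f assume "f \<in> {f. (\<forall>b\<ge>n q. f b = 0) \<and> lin (n q) (D q) f = (\<lambda>_. 0)}"
      then obtain g where "\<forall>b<n q. f b = lin (n (Suc q)) (D (Suc q)) g b" "\<forall>b\<ge>n q. f b = 0"
        using iff by auto
      then have "f = lin (n (Suc q)) (D (Suc q)) g" using big by (metis ext not_le)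
      then show "f \<in> range (lin (n (Suc q)) (D (Suc q)))" by simp
    next
      fix f assume "f \<in> range (lin (n (Suc q)) (D (Suc q)))"
      then show "f \<in> {f. (\<forall>b\<ge>n q. f b = 0) \<and> lin (n q) (D q) f = (\<lambda>_. 0)}"
        using iff[of f] big by auto
    qed
  qed
  \<comment> \<open>Homological degree \<open>p\<close> is paired with position
    \<open>i - p\<close>, so the induction runs from position \<open>i\<close> down to the
    augmentation.\<close>
  have "koszul_vanish \<rho> X p j (\<epsilon> (i - p)) (range (lin (n (i - p)) (D (i - p))))" if "p \<le> i" for p
    using that
  proof (induction p)
    case 0
    show ?case
      by (simp, rule koszul_vanish_0, rule hom) (use neg in \<open>auto simp: \<epsilon>_def n_def\<close>)
  next
    case (Suc p)
    then have e: "i - p = Suc (i - Suc p)" by simp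
    show ?case
      by (rule koszul_vanish_step[OF \<rho>], rule hom) (use Suc in \<open>simp_all add: ker e\<close>)
  qed
  from this[of i] have van: "koszul_vanish \<rho> X i j (\<lambda>_. 0) (range (lin (n 0) (D 0)))"
    by (simp add: \<epsilon>_def)
  have M0: "f \<in> range (lin (n 0) (D 0)) \<longleftrightarrow> f 0 \<in> J \<and> (\<forall>a>0. f a = 0)" for f
  proof -
    have J: "J = (\<lambda>v. (d 0 *\<^sub>v v) $ 0) ` carrier_vec (n 0)"
      using res by (simp add: graded_free_resolution_def n_def)
    have r0: "r 0 = 1" by (simp add: r_def)
    show ?thesis
    proof
      assume "f \<in> range (lin (n 0) (D 0))"
      then obtain g where "f = lin (n 0) (D 0) g" by auto
      then show "f 0 \<in> J \<and> (\<forall>a>0. f a = 0)" by (auto simp: J lin r0)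
    next
      assume f: "f 0 \<in> J \<and> (\<forall>a>0. f a = 0)"
      then obtain v where v: "v \<in> carrier_vec (n 0)" "f 0 = (d 0 *\<^sub>v v) $ 0" unfolding J by auto
      have "v = vec (n 0) (($) v)" using v by auto
      then have "f = lin (n 0) (D 0) (($) v)" using v f by (auto simp: fun_eq_iff lin r0)
      then show "f \<in> range (lin (n 0) (D 0))" by simp
    qed
  qed
  obtain v where v: "\<And>T. T \<subseteq> X \<Longrightarrow> card T = Suc i \<Longrightarrow> (\<lambda>a. v a T) \<in> range (lin (n 0) (D 0))"
     "\<And>a T. T \<subseteq> X \<Longrightarrow> card T = i \<Longrightarrow> kdiff \<rho> X (v a) T = (if a = 0 then z T else 0)"
  proof -
    define zz where "zz a T = (if a = 0 then z T else 0)" for a :: nat and T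
    have zz1: "\<forall>T\<subseteq>X. card T = i \<longrightarrow> (\<lambda>a. zz a T) \<in> range (lin (n 0) (D 0)) \<and>
        (\<forall>a. \<forall>t\<in>Poly_Mapping.keys (zz a T). mon_deg t + 0 + i = j)"
    proof (intro allI impI conjI ballI)
      fix T assume T: "T \<subseteq> X" "card T = i"
      show "(\<lambda>a. zz a T) \<in> range (lin (n 0) (D 0))"
        unfolding M0 using zJ[OF T] by (simp add: zz_def)
      fix a t assume "t \<in> Poly_Mapping.keys (zz a T)"
      then show "mon_deg t + 0 + i = j"
        using zhom[OF T, of t] by (cases "a = 0") (simp_all add: zz_def)
    qed
    have zz2: "\<forall>a. \<forall>T\<subseteq>X. card T + 1 = i \<longrightarrow> kdiff \<rho> X (zz a) T = 0"
    proof (intro allI impI)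
      fix a T assume T: "T \<subseteq> X" "card T + 1 = i"
      show "kdiff \<rho> X (zz a) T = 0"
        using cyc[OF T] by (cases "a = 0") (simp_all add: zz_def kdiff_def)
    qed
    from van[unfolded koszul_vanish_def, THEN spec, of zz, THEN mp, THEN mp, OF zz1 zz2]
    obtain v where v: "\<forall>T\<subseteq>X. card T = Suc i \<longrightarrow> (\<lambda>a. v a T) \<in> range (lin (n 0) (D 0))"
      "\<forall>a. \<forall>T\<subseteq>X. card T = i \<longrightarrow> kdiff \<rho> X (v a) T = zz a T"
      by (elim exE conjE)
    show thesis
    proof (rule that)
      show "(\<lambda>a. v a T) \<in> range (lin (n 0) (D 0))" if "T \<subseteq> X" "card T = Suc i" for T
        using v(1) that by blast
      show "kdiff \<rho> X (v a) T = (if a = 0 then z T else 0)" if "T \<subseteq> X" "card T = i" for a T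
        using v(2) that unfolding zz_def by blast
    qed
  qed
  show False
  proof (rule nb[of "v 0"])
    fix T assume T: "T \<subseteq> X" "card T = Suc i"
    then show "v 0 T \<in> J" using v(1)[OF T] unfolding M0 by blast
  next
    fix T assume T: "T \<subseteq> X" "card T = i"
    then show "kdiff \<rho> X (v 0) T = z T" using v(2)[OF T, of 0] by simp
  qed
qed

section \<open>Existence of minimal graded free resolutions\<close>

text \<open>A monotone subsequence increases, or it decreases and is constant from the place where
  it attains its minimum.\<close>

lemma nat_seq_mono_subseq:
  fixes s :: "nat \<Rightarrow> nat"
  shows "\<exists>h::nat \<Rightarrow> nat. strict_mono h \<and> (\<forall>i j. i \<le> j \<longrightarrow> s (h i) \<le> s (h j))"
proof -
  obtain h where h: "strict_mono h" "monoseq (\<lambda>n. s (h n))" using seq_monosub by blast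
  show ?thesis
  proof (cases "\<forall>m. \<forall>n\<ge>m. s (h m) \<le> s (h n)")
    case True
    show ?thesis by (rule exI[of _ h]) (use True h(1) in simp)
  next
    case False
    then have dec: "s (h n) \<le> s (h m)" if "m \<le> n" for m n
      using h(2) that unfolding monoseq_def by blast
    define N where "N = (LEAST v. v \<in> range (\<lambda>n. s (h n)))"
    have "N \<in> range (\<lambda>n. s (h n))" unfolding N_def by (rule LeastI_ex) blast
    then obtain m where m: "N = s (h m)" by auto
    have N: "N \<le> s (h n)" for n unfolding N_def by (rule Least_le) blast
    show ?thesis
    proof (intro exI[of _ "\<lambda>i. h (i + m)"] conjI allI impI)
      show "strict_mono (\<lambda>i. h (i + m))" using h(1) by (simp add: strict_mono_def)
      have "s (h (i + m)) = N" for i using dec[of m "i + m"] N[of "i + m"] m by simp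
      then show "s (h (i + m)) \<le> s (h (j + m))" for i j by simp
    qed
  qed
qed

text \<open>The sequence is thinned out once for every variable; monotonicity already achieved
  survives passing to a subsequence.\<close>

lemma dickson_sequence:
  fixes f :: "nat \<Rightarrow> 'x \<Rightarrow> nat"
  assumes "finite X"
  shows "\<exists>g::nat \<Rightarrow> nat. strict_mono g \<and> (\<forall>x\<in>X. \<forall>i j. i \<le> j \<longrightarrow> f (g i) x \<le> f (g j) x)"
  using assms
proof (induction X rule: finite_induct)
  case empty
  have "strict_mono (\<lambda>n::nat. n)" by (simp add: strict_mono_def)
  then show ?case by blast
next
  case (insert x X)
  from insert.IH obtain g :: "nat \<Rightarrow> nat" where
    g': "strict_mono g \<and> (\<forall>x\<in>X. \<forall>i j. i \<le> j \<longrightarrow> f (g i) x \<le> f (g j) x)" ..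
  note g = conjunct1[OF g'] conjunct2[OF g']
  from nat_seq_mono_subseq[of "\<lambda>n. f (g n) x"] obtain h :: "nat \<Rightarrow> nat" where
    h': "strict_mono h \<and> (\<forall>i j. i \<le> j \<longrightarrow> f (g (h i)) x \<le> f (g (h j)) x)" ..
  note h = conjunct1[OF h'] conjunct2[OF h', rule_format]
  have "strict_mono (g \<circ> h)" using g(1) h(1) by (rule strict_mono_o)
  moreover have "f (g (h i)) y \<le> f (g (h j)) y" if "y \<in> insert x X" "i \<le> j" for y i j
  proof (cases "y = x")
    case True
    then show ?thesis using h(2)[OF that(2)] by simp
  next
    case False
    then have "y \<in> X" using that(1) by simp
    with g(2) strict_mono_leD[OF h(1) that(2)] show ?thesis by blast
  qed
  ultimately have "strict_mono (g \<circ> h) \<and> (\<forall>y\<in>insert x X. \<forall>i j. i \<le> j \<longrightarrow> f ((g \<circ> h) i) y \<le> f ((g \<circ> h) j) y)"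
    unfolding comp_def by blast
  then show ?case by (rule exI[of _ "g \<circ> h"])
qed

text \<open>The minimal elements are pairwise incomparable, whereas an infinite sequence of
  monomials contains two comparable ones. Descent on the degree puts every element above a minimal
  one.\<close>

lemma dickson:
  fixes L :: "('x::finite \<Rightarrow>\<^sub>0 nat) set"
  obtains L0 where "L0 \<subseteq> L" "finite L0" "\<And>s. s \<in> L \<Longrightarrow> \<exists>l\<in>L0. mon_le l s"
proof
  let ?L = "{l \<in> L. \<forall>m\<in>L. mon_le m l \<longrightarrow> m = l}"
  show "?L \<subseteq> L" by blast
  show "finite ?L"
  proof (rule ccontr)
    assume "infinite ?L"
    from infinite_countable_subset[OF this]
    obtain f :: "nat \<Rightarrow> _" where f: "inj f" "range f \<subseteq> ?L" by blast
    from dickson_sequence[OF finite[of UNIV], of "\<lambda>n. Poly_Mapping.lookup (f n)"]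
    obtain g :: "nat \<Rightarrow> nat" where g': "strict_mono g \<and> (\<forall>x\<in>UNIV. \<forall>i j. i \<le> j \<longrightarrow>
      Poly_Mapping.lookup (f (g i)) x \<le> Poly_Mapping.lookup (f (g j)) x)" ..
    note g = conjunct1[OF g'] conjunct2[OF g']
    have "Poly_Mapping.lookup (f (g 0)) x \<le> Poly_Mapping.lookup (f (g 1)) x" for x
      using g(2)[rule_format, of x 0 1] by simp
    then have "mon_le (f (g 0)) (f (g 1))" unfolding mon_le_def by blast
    moreover have "f (g 0) \<in> ?L" "f (g 1) \<in> ?L" using f(2) by blast+
    ultimately have "f (g 0) = f (g 1)" by blast
    then have "g 0 = g 1" using f(1) by (auto dest: injD)
    then show False using g(1) by (metis strict_mono_eq zero_neq_one)
  qed
  show "\<exists>l\<in>?L. mon_le l s" if "s \<in> L" for s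
    using that
  proof (induction "mon_deg s" arbitrary: s rule: less_induct)
    case less
    show ?case
    proof (cases "s \<in> ?L")
      case True
      then show ?thesis by (auto simp: mon_le_def)
    next
      case False
      then obtain m where m: "m \<in> L" "mon_le m s" "m \<noteq> s" using less.prems by blast
      have "s = m + (s - m)" using mon_le_add_diff[OF m(2)] by simp
      then have "mon_deg s = mon_deg m + mon_deg (s - m)" "s - m \<noteq> 0"
        using m(3) mon_deg_add[of m "s - m"] by auto
      then have "mon_deg m < mon_deg s" by (metis gr0I less_add_same_cancel1 mon_deg_eq_0_iff)
      from less.hyps[OF this m(1)] show ?thesis using m(2) mon_le_trans by blast
    qed
  qed
qed

section \<open>Multigraded submodules of free modules\<close>

lemma restr_mult_homog:
  fixes p f :: "('x, 'k::comm_ring_1) polyn"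
  assumes "\<And>s. s \<in> Poly_Mapping.keys p \<Longrightarrow> s + u = v"
  shows "p * restr (\<lambda>s. s + v = t) f = restr (\<lambda>s. s + u = t) (p * f)"
proof (rule restr_mult)
  fix s x assume "s \<in> Poly_Mapping.keys p"
  then have "s + x + u = x + v" using assms by (metis add.assoc add.commute)
  then show "s + x + u = t \<longleftrightarrow> x + v = t" by simp
qed

definition fscale :: "'a::comm_ring_1 \<Rightarrow> (nat \<Rightarrow> 'a) \<Rightarrow> nat \<Rightarrow> 'a" where
  "fscale s f = (\<lambda>a. s * f a)"

lemma fscale_apply [simp]: "fscale s f a = s * f a"
  by (simp add: fscale_def)

interpretation fmod: Modules.module fscale
  by standard (auto simp: fun_eq_iff algebra_simps)

lemma sum_fun_apply: "(\<Sum>i\<in>A. f i) x = (\<Sum>i\<in>A. f i x)"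
  by (induction A rule: infinite_finite_induct) auto

definition mcomp :: "(nat \<Rightarrow> 'x \<Rightarrow>\<^sub>0 nat) \<Rightarrow> ('x \<Rightarrow>\<^sub>0 nat) \<Rightarrow> (nat \<Rightarrow> ('x, 'k::comm_ring_1) polyn) \<Rightarrow> nat \<Rightarrow> ('x, 'k) polyn" where
  "mcomp e t f = (\<lambda>a. restr (\<lambda>s. s + e a = t) (f a))"

definition homog :: "(nat \<Rightarrow> 'x \<Rightarrow>\<^sub>0 nat) \<Rightarrow> ('x \<Rightarrow>\<^sub>0 nat) \<Rightarrow> (nat \<Rightarrow> ('x, 'k::comm_ring_1) polyn) \<Rightarrow> bool" where
  "homog e t f \<longleftrightarrow> (\<forall>a. \<forall>s\<in>Poly_Mapping.keys (f a). s + e a = t)"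

text \<open>The fine grading matters here: a coordinate of a homogeneous vector can involve only one
  exponent, so it is a scalar times a monomial.\<close>

definition mgraded :: "nat \<Rightarrow> (nat \<Rightarrow> 'x \<Rightarrow>\<^sub>0 nat) \<Rightarrow> (nat \<Rightarrow> ('x, 'k::comm_ring_1) polyn) set \<Rightarrow> bool" where
  "mgraded r e M \<longleftrightarrow> fmod.subspace M \<and> (\<forall>f\<in>M. (\<forall>a\<ge>r. f a = 0) \<and> (\<forall>t. mcomp e t f \<in> M))"

lemma homog_mcomp: "homog e t (mcomp e t f)"
  by (simp add: homog_def mcomp_def keys_restr)

lemma mcomp_sum:
  assumes "\<And>a. a \<ge> r \<Longrightarrow> f a = 0"
  shows "f = (\<Sum>t\<in>(\<Union>a<r. (\<lambda>s. s + e a) ` Poly_Mapping.keys (f a)). mcomp e t f)" (is "f = sum _ ?T")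
proof (rule ext, rule poly_mapping_eqI)
  fix a s
  have fin: "finite ?T" by auto
  show "Poly_Mapping.lookup (f a) s = Poly_Mapping.lookup ((\<Sum>t\<in>?T. mcomp e t f) a) s"
  proof (cases "s \<in> Poly_Mapping.keys (f a)")
    case True
    then have "a < r" using assms[of a] by (cases "a < r") auto
    then have "s + e a \<in> ?T" using True by auto
    moreover have "Poly_Mapping.lookup ((\<Sum>t\<in>?T. mcomp e t f) a) s
        = (\<Sum>t\<in>?T. if s + e a = t then Poly_Mapping.lookup (f a) s else 0)"
      unfolding sum_fun_apply lookup_sum mcomp_def lookup_restr ..
    ultimately show ?thesis using fin by (simp add: sum.delta')
  next
    case False
    then have z: "Poly_Mapping.lookup (f a) s = 0" by (simp add: in_keys_iff)
    show ?thesis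
      unfolding sum_fun_apply lookup_sum mcomp_def lookup_restr z by simp
  qed
qed

text \<open>Induction on the rank. The last coordinates of homogeneous elements are terms; finitely
  many of the occurring monomials divide all others, and subtracting a multiple of the corresponding
  element clears the last coordinate. What remains lies in the submodule of smaller rank.\<close>

lemma mgraded_finitely_generated:
  fixes M :: "(nat \<Rightarrow> ('x::finite, 'k::field) polyn) set"
  assumes "mgraded r e M"
  shows "\<exists>B. finite B \<and> B \<subseteq> M \<and> (\<forall>h\<in>B. \<exists>t. homog e t h) \<and> M \<subseteq> fmod.span B"
  using assms
proof (induction r arbitrary: M)
  case 0
  have "f = 0" if "f \<in> M" for f
  proof
    fix a
    show "f a = 0 a" using 0 that unfolding mgraded_def zero_fun_apply by blast
  qed
  then have "M \<subseteq> fmod.span {}" by auto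
  then show ?case by blast
next
  case (Suc r)
  have sub: "fmod.subspace M" and comp: "\<And>f t. f \<in> M \<Longrightarrow> mcomp e t f \<in> M"
    and supp: "\<And>f a. f \<in> M \<Longrightarrow> a \<ge> Suc r \<Longrightarrow> f a = 0"
    using Suc.prems unfolding mgraded_def by blast+
  let ?M = "{f \<in> M. f r = 0}"
  have "mgraded r e ?M"
    unfolding mgraded_def
  proof (intro conjI ballI allI impI)
    show "fmod.subspace ?M" using sub unfolding fmod.subspace_def by auto
    fix f assume f: "f \<in> ?M"
    show "f a = 0" if "a \<ge> r" for a using supp[of f a] f that by (cases "a = r") auto
    show "mcomp e t f \<in> ?M" for t using comp[of f t] f by (auto simp: mcomp_def)
  qed
  from Suc.IH[OF this] obtain B where B: "finite B" "B \<subseteq> ?M" "\<And>h. h \<in> B \<Longrightarrow> \<exists>t. homog e t h"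
    "?M \<subseteq> fmod.span B" by blast
  define L where "L = {s. \<exists>f\<in>M. homog e (s + e r) f \<and> f r = Poly_Mapping.single s 1}"
  obtain L0 where L0: "L0 \<subseteq> L" "finite L0" "\<And>s. s \<in> L \<Longrightarrow> \<exists>l\<in>L0. mon_le l s"
    using dickson by blast
  have "\<forall>s\<in>L0. \<exists>f\<in>M. homog e (s + e r) f \<and> f r = Poly_Mapping.single s 1"
    using L0(1) by (auto simp: L_def)
  then obtain F where F: "\<And>s. s \<in> L0 \<Longrightarrow> F s \<in> M \<and> homog e (s + e r) (F s) \<and> F s r = Poly_Mapping.single s 1"
    by metis
  let ?B = "B \<union> F ` L0"
  have hom: "h \<in> fmod.span ?B" if h: "h \<in> M" "homog e t h" for h t
  proof (cases "h r = 0")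
    case True
    then have "h \<in> fmod.span B" using h B(4) by blast
    then show ?thesis using fmod.span_mono[of B ?B] by blast
  next
    case False
    then obtain s where s: "s \<in> Poly_Mapping.keys (h r)" by fastforce
    define c where "c = Poly_Mapping.lookup (h r) s"
    have c: "c \<noteq> 0" using s by (simp add: c_def in_keys_iff)
    have st: "s + e r = t" using h(2) s by (auto simp: homog_def)
    have "Poly_Mapping.keys (h r) \<subseteq> {s}"
    proof
      fix s' assume "s' \<in> Poly_Mapping.keys (h r)"
      then have "s' + e r = s + e r" using h(2) st by (simp add: homog_def)
      then show "s' \<in> {s}" by simp
    qed
    then have hr: "h r = Poly_Mapping.single s c"
      using poly_mapping_decomp[of "{s}" "h r"] by (simp add: c_def)
    let ?g = "fscale (Poly_Mapping.single 0 (inverse c)) h"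
    have "?g \<in> M" using fmod.subspace_scale[OF sub h(1)] .
    moreover have "?g r = Poly_Mapping.single s 1" using c by (simp add: hr mult_single)
    moreover have "homog e (s + e r) ?g"
      using h(2) st unfolding homog_def by (auto simp: in_keys_iff lookup_single_mult mon_le_def)
    ultimately have "s \<in> L" unfolding L_def by blast
    then obtain l where l: "l \<in> L0" "mon_le l s" using L0(3) by blast
    let ?d = "fscale (Poly_Mapping.single (s - l) c) (F l)"
    have "h - ?d \<in> M" using F[OF l(1)] by (intro fmod.subspace_diff[OF sub] fmod.subspace_scale[OF sub] h) auto
    moreover have "(h - ?d) r = 0"
      using F[OF l(1)] mon_le_add_diff[OF l(2)] by (simp add: hr mult_single add.commute)
    ultimately have "h - ?d \<in> fmod.span B" using B(4) by blast
    then have "h - ?d \<in> fmod.span ?B" using fmod.span_mono[of B ?B] by blast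
    moreover have "?d \<in> fmod.span ?B" using l(1) by (intro fmod.span_scale fmod.span_base) auto
    ultimately have "h - ?d + ?d \<in> fmod.span ?B" by (rule fmod.span_add)
    then show ?thesis by simp
  qed
  have "f \<in> fmod.span ?B" if f: "f \<in> M" for f
  proof -
    have "f = (\<Sum>t\<in>(\<Union>a<Suc r. (\<lambda>s. s + e a) ` Poly_Mapping.keys (f a)). mcomp e t f)"
      by (rule mcomp_sum) (use supp[OF f] in simp)
    also have "\<dots> \<in> fmod.span ?B"
      by (intro fmod.span_sum hom[OF comp[OF f] homog_mcomp])
    finally show ?thesis .
  qed
  then have "M \<subseteq> fmod.span ?B" by blast
  moreover have "finite ?B" using B(1) L0(2) by simp
  moreover have "?B \<subseteq> M" using B(2) F by blast
  moreover have "\<exists>t. homog e t h" if "h \<in> ?B" for h using that B(3) F by blast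
  ultimately show ?case by meson
qed

text \<open>A generating family of smallest cardinality has all its relations in \<open>\<mm>F\<close>: a relation with an
  invertible constant coefficient makes one of the generators superfluous.\<close>

lemma mgraded_minimal_generators:
  fixes M :: "(nat \<Rightarrow> ('x::finite, 'k::field) polyn) set"
  assumes "mgraded r e M"
  shows "\<exists>B \<tau>. finite B \<and> B \<subseteq> M \<and> (\<forall>h\<in>B. homog e (\<tau> h) h) \<and> M \<subseteq> fmod.span B \<and>
    (\<forall>c. (\<Sum>h\<in>B. fscale (c h) h) = 0 \<longrightarrow> (\<forall>h\<in>B. Poly_Mapping.lookup (c h) 0 = 0))"
proof -
  define P where "P B \<longleftrightarrow> finite B \<and> B \<subseteq> M \<and> (\<forall>h\<in>B. \<exists>t. homog e t h) \<and> M \<subseteq> fmod.span B" for B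
  obtain B0 where "P B0" using mgraded_finitely_generated[OF assms] unfolding P_def by blast
  from ex_has_least_nat[of P, OF this, of card]
  obtain B where PB: "P B" and least: "\<And>B'. P B' \<Longrightarrow> card B \<le> card B'" by blast
  have B: "finite B" "B \<subseteq> M" "\<forall>h\<in>B. \<exists>t. homog e t h" "M \<subseteq> fmod.span B"
    using PB unfolding P_def by blast+
  from bchoice[OF B(3)] obtain \<tau> where \<tau>: "\<And>h. h \<in> B \<Longrightarrow> homog e (\<tau> h) h" by blast
  have "Poly_Mapping.lookup (c h0) 0 = 0" if rel: "(\<Sum>h\<in>B. fscale (c h) h) = 0" and h0: "h0 \<in> B" for c h0
  proof (rule ccontr)
    assume nz: "Poly_Mapping.lookup (c h0) 0 \<noteq> 0"
    define c0 where "c0 = Poly_Mapping.lookup (c h0) 0"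
    \<comment> \<open>Cutting the relation to the multidegree of \<open>h0\<close> leaves the
      constant term as the only part of the coefficient of \<open>h0\<close>; it is a unit, and
      \<open>h0\<close> can be solved for.\<close>
    let ?c = "\<lambda>h. restr (\<lambda>s. s + \<tau> h = \<tau> h0) (c h)"
    have "(\<Sum>h\<in>B. fscale (?c h) h) = 0"
    proof
      fix a
      have "(\<Sum>h\<in>B. fscale (?c h) h) a = (\<Sum>h\<in>B. restr (\<lambda>s. s + e a = \<tau> h0) (c h * h a))"
        unfolding sum_fun_apply fscale_apply
      proof (rule sum.cong)
        fix h assume h: "h \<in> B"
        have "h a * restr (\<lambda>s. s + \<tau> h = \<tau> h0) (c h) = restr (\<lambda>s. s + e a = \<tau> h0) (h a * c h)"
          by (rule restr_mult_homog) (use \<tau>[OF h] in \<open>simp add: homog_def\<close>)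
        then show "?c h * h a = restr (\<lambda>s. s + e a = \<tau> h0) (c h * h a)" by (simp add: mult.commute)
      qed simp
      also have "\<dots> = restr (\<lambda>s. s + e a = \<tau> h0) ((\<Sum>h\<in>B. fscale (c h) h) a)"
        by (simp add: restr_sum sum_fun_apply)
      finally show "(\<Sum>h\<in>B. fscale (?c h) h) a = 0 a" by (simp add: rel)
    qed
    moreover have "?c h0 = Poly_Mapping.single 0 c0"
      by (rule poly_mapping_eqI) (auto simp: lookup_restr lookup_single c0_def)
    ultimately have e: "fscale (Poly_Mapping.single 0 c0) h0 + (\<Sum>h\<in>B - {h0}. fscale (?c h) h) = 0"
      using B h0 by (subst (asm) sum.remove[of _ h0]) auto
    let ?S = "fmod.span (B - {h0})"
    have "(\<Sum>h\<in>B - {h0}. fscale (?c h) h) \<in> ?S"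
      by (intro fmod.span_sum fmod.span_scale fmod.span_base) auto
    then have "- (\<Sum>h\<in>B - {h0}. fscale (?c h) h) \<in> ?S" by (rule fmod.span_neg)
    moreover have "fscale (Poly_Mapping.single 0 c0) h0 = - (\<Sum>h\<in>B - {h0}. fscale (?c h) h)"
      using e by (simp only: eq_neg_iff_add_eq_0)
    ultimately have "fscale (Poly_Mapping.single 0 c0) h0 \<in> ?S" by (simp only:)
    then have "fscale (Poly_Mapping.single 0 (inverse c0)) (fscale (Poly_Mapping.single 0 c0) h0) \<in> ?S"
      by (rule fmod.span_scale)
    then have "h0 \<in> ?S" using nz by (simp add: mult_single c0_def[symmetric])
    then have "h \<in> ?S" if "h \<in> B" for h
      using that fmod.span_base[of h "B - {h0}"] by (cases "h = h0") auto
    then have "B \<subseteq> ?S" by (rule subsetI)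
    then have "fmod.span B \<subseteq> ?S" by (simp add: fmod.span_minimal)
    with B(4) have "M \<subseteq> ?S" by (rule order_trans)
    then have "P (B - {h0})" using B(1,2,3) unfolding P_def by auto
    from least[OF this] show False using card_Diff1_less[OF B(1) h0] by simp
  qed
  then have "\<forall>c. (\<Sum>h\<in>B. fscale (c h) h) = 0 \<longrightarrow> (\<forall>h\<in>B. Poly_Mapping.lookup (c h) 0 = 0)"
    by (intro allI impI ballI)
  moreover have "\<forall>h\<in>B. homog e (\<tau> h) h" using \<tau> by (intro ballI)
  ultimately show ?thesis using B(1,2,4) by (intro exI conjI)
qed

section \<open>Iterated minimal covers\<close>

text \<open>One stage of a minimal multigraded resolution. The clause on relations is minimality,
  stated for the kernel of \<open>D\<close> because the columns of the next differential lie
  there.\<close>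

definition resolution_map ::
    "nat \<Rightarrow> (nat \<Rightarrow> 'x \<Rightarrow>\<^sub>0 nat) \<Rightarrow> (nat \<Rightarrow> ('x, 'k::field) polyn) set \<Rightarrow> nat \<Rightarrow> (nat \<Rightarrow> 'x \<Rightarrow>\<^sub>0 nat)
     \<Rightarrow> (nat \<Rightarrow> nat \<Rightarrow> ('x, 'k) polyn) \<Rightarrow> bool" where
  "resolution_map r e M n E D \<longleftrightarrow> (\<forall>b<n. homog e (E b) (\<lambda>a. D a b)) \<and> M = range (lin n D) \<and>
     (\<forall>f. lin n D f = 0 \<longrightarrow> (\<forall>b<n. Poly_Mapping.lookup (f b) 0 = 0)) \<and>
     (\<forall>a\<ge>r. \<forall>b<n. D a b = 0)"

definition kernel_module :: "nat \<Rightarrow> (nat \<Rightarrow> nat \<Rightarrow> ('x, 'k::field) polyn) \<Rightarrow> (nat \<Rightarrow> ('x, 'k) polyn) set" where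
  "kernel_module n D = {f. (\<forall>b\<ge>n. f b = 0) \<and> lin n D f = 0}"

text \<open>The kernel is shown to be multigraded for the degrees \<open>E\<close> of the new
  generators, so that the construction can be repeated on it.\<close>

lemma resolution_map_ex:
  fixes M :: "(nat \<Rightarrow> ('x::finite, 'k::field) polyn) set"
  assumes M: "mgraded r e M"
  shows "\<exists>n E D. resolution_map r e M n E D \<and> mgraded n E (kernel_module n D)"
proof -
  from mgraded_minimal_generators[OF M] obtain B \<tau> where
    B': "finite B \<and> B \<subseteq> M \<and> (\<forall>h\<in>B. homog e (\<tau> h) h) \<and> M \<subseteq> fmod.span B \<and>
    (\<forall>c. (\<Sum>h\<in>B. fscale (c h) h) = 0 \<longrightarrow> (\<forall>h\<in>B. Poly_Mapping.lookup (c h) 0 = 0))"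
    by (elim exE)
  note B = B'[THEN conjunct1] B'[THEN conjunct2, THEN conjunct1]
    B'[THEN conjunct2, THEN conjunct2, THEN conjunct1]
    B'[THEN conjunct2, THEN conjunct2, THEN conjunct2, THEN conjunct1]
    B'[THEN conjunct2, THEN conjunct2, THEN conjunct2, THEN conjunct2]
  define n where "n = card B"
  obtain \<beta> where \<beta>: "bij_betw \<beta> {..<n} B"
    using ex_bij_betw_nat_finite[OF B(1)] by (auto simp: n_def lessThan_atLeast0)
  define D where "D a b = \<beta> b a" for a b
  define E where "E b = \<tau> (\<beta> b)" for b
  define inv\<beta> where "inv\<beta> = inv_into {..<n} \<beta>"
  have inv: "inv\<beta> (\<beta> b) = b" if "b < n" for b
    unfolding inv\<beta>_def using \<beta> that by (auto simp: bij_betw_def)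
  have \<beta>B: "\<beta> b \<in> B" if "b < n" for b using \<beta> that by (auto simp: bij_betw_def)
  have lin: "lin n D f = (\<Sum>h\<in>B. fscale (f (inv\<beta> h)) h)" for f
  proof
    fix a
    have "lin n D f a = (\<Sum>b<n. f (inv\<beta> (\<beta> b)) * \<beta> b a)"
      unfolding lin_def D_def by (rule sum.cong) (auto simp: inv mult.commute)
    also have "\<dots> = (\<Sum>h\<in>B. f (inv\<beta> h) * h a)"
      by (rule sum.reindex_bij_betw[OF \<beta>])
    finally show "lin n D f a = (\<Sum>h\<in>B. fscale (f (inv\<beta> h)) h) a" by (simp add: sum_fun_apply)
  qed
  have sub: "fmod.subspace M" using M by (simp add: mgraded_def)
  have hom: "homog e (E b) (\<lambda>a. D a b)" if "b < n" for b
    using B(3) \<beta>B[OF that] by (simp add: E_def D_def)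
  have "resolution_map r e M n E D"
    unfolding resolution_map_def
  proof (intro conjI allI impI)
    show "homog e (E b) (\<lambda>a. D a b)" if "b < n" for b by (rule hom[OF that])
    show "M = range (lin n D)"
    proof
      show "range (lin n D) \<subseteq> M"
        unfolding lin image_subset_iff using B(2) by (auto simp del: fscale_apply intro!: fmod.subspace_sum[OF sub] fmod.subspace_scale[OF sub])
      show "M \<subseteq> range (lin n D)"
      proof
        fix f assume "f \<in> M"
        then obtain u where "f = (\<Sum>h\<in>B. fscale (u h) h)"
          using B(4) unfolding fmod.span_finite[OF B(1)] by blast
        also have "\<dots> = lin n D (\<lambda>b. u (\<beta> b))"
          unfolding lin using \<beta> by (intro sum.cong)
            (auto simp: inv\<beta>_def bij_betw_def f_inv_into_f)
        finally show "f \<in> range (lin n D)" by simp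
      qed
    qed
    show "Poly_Mapping.lookup (f b) 0 = 0" if "lin n D f = 0" "b < n" for f b
      using B(5)[rule_format, OF that(1)[unfolded lin] \<beta>B[OF that(2)]] inv[OF that(2)] by simp
    show "D a b = 0" if "a \<ge> r" "b < n" for a b
      using M B(2) \<beta>B[OF that(2)] that(1) by (auto simp: mgraded_def D_def)
  qed
  moreover have "mgraded n E (kernel_module n D)"
    unfolding mgraded_def
  proof (intro conjI ballI allI impI)
    show "fmod.subspace (kernel_module n D)"
      unfolding fmod.subspace_def kernel_module_def
      by (auto simp: lin_def fun_eq_iff distrib_left sum.distrib mult.left_commute sum_distrib_left[symmetric])
    fix f assume f: "f \<in> kernel_module n D"
    show "f a = 0" if "a \<ge> n" for a using f that by (simp add: kernel_module_def)
    fix t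
    have "lin n D (mcomp E t f) a = 0" for a
    proof -
      have "lin n D (mcomp E t f) a = (\<Sum>b<n. restr (\<lambda>s. s + e a = t) (D a b * f b))"
        unfolding lin_def mcomp_def
      proof (rule sum.cong)
        fix b assume "b \<in> {..<n}"
        then have "homog e (E b) (\<lambda>a. D a b)" using hom by simp
        then show "D a b * restr (\<lambda>s. s + E b = t) (f b) = restr (\<lambda>s. s + e a = t) (D a b * f b)"
          by (intro restr_mult_homog) (simp add: homog_def)
      qed simp
      also have "\<dots> = restr (\<lambda>s. s + e a = t) (lin n D f a)" by (simp add: lin_def restr_sum)
      also have "\<dots> = 0" using f by (simp add: kernel_module_def)
      finally show ?thesis .
    qed
    then show "mcomp E t f \<in> kernel_module n D" using f
      by (auto simp: kernel_module_def fun_eq_iff mcomp_def)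
  qed
  ultimately show ?thesis by (intro exI conjI)
qed

section \<open>Resolutions and Betti numbers of monomial ideals\<close>

definition monomial_ideal :: "('x, 'k::comm_ring_1) polyn set \<Rightarrow> bool" where
  "monomial_ideal J \<longleftrightarrow> 0 \<in> J \<and> (\<forall>f\<in>J. \<forall>g\<in>J. f + g \<in> J) \<and> (\<forall>s. \<forall>f\<in>J. s * f \<in> J) \<and>
     (\<forall>f\<in>J. \<forall>t\<in>Poly_Mapping.keys f. Poly_Mapping.single t 1 \<in> J)"

lemma monomial_ideal_sum:
  assumes "monomial_ideal J" "\<And>i. i \<in> A \<Longrightarrow> f i \<in> J"
  shows "(\<Sum>i\<in>A. f i) \<in> J"
  using assms(2)
  by (induction A rule: infinite_finite_induct) (use assms(1) in \<open>auto simp: monomial_ideal_def\<close>)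

lemma monomial_ideal_single:
  fixes c :: "'k::comm_ring_1"
  assumes "monomial_ideal J" "Poly_Mapping.single s 1 \<in> J"
  shows "Poly_Mapping.single (u + s) c \<in> J"
proof -
  have "Poly_Mapping.single u c * Poly_Mapping.single s 1 \<in> J"
    using assms by (simp add: monomial_ideal_def del: mult_single)
  then show ?thesis by (simp add: mult_single)
qed

lemma monomial_ideal_restr:
  fixes f :: "('x, 'k::comm_ring_1) polyn"
  assumes J: "monomial_ideal J" and f: "f \<in> J"
  shows "restr P f \<in> J"
  unfolding restr_def
proof (rule monomial_ideal_sum[OF J])
  fix t assume "t \<in> {t \<in> Poly_Mapping.keys f. P t}"
  then have "Poly_Mapping.single t (1::'k) \<in> J" using J f by (simp add: monomial_ideal_def)
  from monomial_ideal_single[OF J this, of 0]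
  show "Poly_Mapping.single t (Poly_Mapping.lookup f t) \<in> J" by simp
qed

lemma mgraded_monomial_ideal:
  assumes J: "monomial_ideal J"
  shows "mgraded 1 (\<lambda>_. 0) {f. f 0 \<in> J \<and> (\<forall>a\<ge>1. f a = 0)}"
  unfolding mgraded_def
proof (intro conjI ballI allI impI)
  show "fmod.subspace {f. f 0 \<in> J \<and> (\<forall>a\<ge>1. f a = 0)}"
    using J by (auto simp: fmod.subspace_def monomial_ideal_def)
  fix f :: "nat \<Rightarrow> _" assume f: "f \<in> {f. f 0 \<in> J \<and> (\<forall>a\<ge>1. f a = 0)}"
  show "f a = 0" if "a \<ge> 1" for a using that f by simp
  show "mcomp (\<lambda>_. 0) t f \<in> {f. f 0 \<in> J \<and> (\<forall>a\<ge>1. f a = 0)}" for t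
    using f by (simp add: mcomp_def monomial_ideal_restr[OF J])
qed

lemma module_times: "Modules.module ((*) :: 'a::comm_ring_1 \<Rightarrow> 'a \<Rightarrow> 'a)"
  by standard (auto simp: algebra_simps)

lemma in_var_ideal_UNIV:
  fixes f :: "('x::finite, 'k::comm_ring_1) polyn"
  assumes "Poly_Mapping.lookup f 0 = 0"
  shows "f \<in> var_ideal UNIV"
proof -
  obtain g where g: "f = (\<Sum>x\<in>UNIV. var x * g x)" using var_decomposition[OF assms] .
  have "g x * var x \<in> var_ideal UNIV" for x
    unfolding var_ideal_def ideal_gen_def
    by (intro module.span_scale[OF module_times] module.span_base[OF module_times]) simp
  then have "(\<Sum>x\<in>UNIV. g x * var x) \<in> var_ideal UNIV"
    unfolding var_ideal_def ideal_gen_def by (intro module.span_sum[OF module_times])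
  then show ?thesis by (simp add: g mult.commute)
qed

lemma lin_vec:
  assumes "v \<in> carrier_vec n" "a < r"
  shows "(mat r n (\<lambda>(a, b). D a b) *\<^sub>v v) $ a = lin n D (($) v) a"
  using assms by (auto simp: lin_def scalar_prod_def lessThan_atLeast0 intro!: sum.cong)

lemma lin_cong: "(\<And>b. b < n \<Longrightarrow> f b = g b) \<Longrightarrow> lin n D f = lin n D g"
  unfolding lin_def by (intro ext sum.cong) auto

theorem minimal_graded_free_resolution_ex:
  fixes J :: "('x::finite, 'k::field) polyn set"
  assumes J: "monomial_ideal J"
  shows "\<exists>degs d. minimal_graded_free_resolution J degs d"
proof -
  define M0 where "M0 = {f :: nat \<Rightarrow> ('x, 'k) polyn. f 0 \<in> J \<and> (\<forall>a\<ge>1. f a = 0)}"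
  \<comment> \<open>\<open>P\<close> ties stage 0 to the ideal, and \<open>Q\<close> ties each later
    stage to the preceding kernel.\<close>
  define P where "P q x = (case x of (n, E, D) \<Rightarrow> mgraded n E (kernel_module n D) \<and>
     (q = 0 \<longrightarrow> resolution_map 1 (\<lambda>_. 0) M0 n E D))"
    for q :: nat and x :: "nat \<times> (nat \<Rightarrow> 'x \<Rightarrow>\<^sub>0 nat) \<times> (nat \<Rightarrow> nat \<Rightarrow> ('x, 'k) polyn)"
  define Q where "Q x y = (case x of (n, E, D) \<Rightarrow> case y of (n', E', D') \<Rightarrow>
     resolution_map n E (kernel_module n D) n' E' D')"
    for x y :: "nat \<times> (nat \<Rightarrow> 'x \<Rightarrow>\<^sub>0 nat) \<times> (nat \<Rightarrow> nat \<Rightarrow> ('x, 'k) polyn)"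
  have "\<exists>x. P 0 x"
    using resolution_map_ex[OF mgraded_monomial_ideal[OF J]] by (auto simp: P_def M0_def)
  moreover have "\<exists>y. P (Suc q) y \<and> Q x y" if "P q x" for q x
  proof -
    obtain n E D where x: "x = (n, E, D)" by (metis surj_pair)
    then have "mgraded n E (kernel_module n D)" using that by (simp add: P_def)
    from resolution_map_ex[OF this] show ?thesis by (auto simp: P_def Q_def x)
  qed
  ultimately have "\<exists>\<sigma>. \<forall>q. P q (\<sigma> q) \<and> Q (\<sigma> q) (\<sigma> (Suc q))" by (rule dependent_nat_choice)
  then obtain \<sigma> where \<sigma>: "\<And>q. P q (\<sigma> q)" "\<And>q. Q (\<sigma> q) (\<sigma> (Suc q))" by auto
  define n where "n q = fst (\<sigma> q)" for q
  define E where "E q = fst (snd (\<sigma> q))" for q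
  define D where "D q = snd (snd (\<sigma> q))" for q
  have map0: "resolution_map 1 (\<lambda>_. 0) M0 (n 0) (E 0) (D 0)"
    using \<sigma>(1)[of 0] by (simp add: P_def n_def E_def D_def case_prod_unfold)
  have mapS: "resolution_map (n q) (E q) (kernel_module (n q) (D q)) (n (Suc q)) (E (Suc q)) (D (Suc q))" for q
    using \<sigma>(2)[of q] by (simp add: Q_def n_def E_def D_def case_prod_unfold)
  define r where "r q = (case q of 0 \<Rightarrow> 1 | Suc q \<Rightarrow> n q)" for q
  \<comment> \<open>The multidegrees are collapsed to total degrees only at this point.\<close>
  define degs where "degs q = map (\<lambda>b. mon_deg (E q b)) [0..<n q]" for q
  define d where "d q = mat (r q) (n q) (\<lambda>(a, b). D q a b)" for q
  have len: "length (degs q) = n q" for q by (simp add: degs_def)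
  have nth: "degs q ! b = mon_deg (E q b)" if "b < n q" for q b using that by (simp add: degs_def)
  have lind: "(d q *\<^sub>v v) $ a = lin (n q) (D q) (($) v) a" if "v \<in> carrier_vec (n q)" "a < r q" for q v a
    unfolding d_def using that by (rule lin_vec)
  have lin0: "lin (n q) (D q) f a = 0" if "a \<ge> r q" for q f a
  proof -
    have "D q a b = 0" if "b < n q" for b
      using map0 mapS \<open>a \<ge> r q\<close> that by (cases q) (auto simp: r_def resolution_map_def)
    then show ?thesis by (simp add: lin_def)
  qed
  have "graded_free_resolution J degs d"
    unfolding graded_free_resolution_def len
  proof (intro conjI allI impI ballI)
    show "d 0 \<in> carrier_mat 1 (n 0)" by (simp add: d_def r_def)
    show "d (Suc i) \<in> carrier_mat (n i) (n (Suc i))" for i by (simp add: d_def r_def)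
    show "mon_deg t = degs 0 ! b" if "b < n 0" "t \<in> Poly_Mapping.keys (d 0 $$ (0, b))" for b t
      using map0 that by (auto simp: nth d_def r_def resolution_map_def homog_def)
    show "mon_deg t + degs i ! a = degs (Suc i) ! b" if "a < n i" "b < n (Suc i)"
      "t \<in> Poly_Mapping.keys (d (Suc i) $$ (a, b))" for i a b t
    proof -
      have "t + E i a = E (Suc i) b"
        using mapS[of i] that by (auto simp: d_def r_def resolution_map_def homog_def)
      then show ?thesis using that by (simp add: nth flip: mon_deg_add)
    qed
    have M0: "M0 = range (lin (n 0) (D 0))" using map0 by (simp add: resolution_map_def)
    show "(\<lambda>v. (d 0 *\<^sub>v v) $ 0) ` carrier_vec (n 0) = J"
    proof
      show "(\<lambda>v. (d 0 *\<^sub>v v) $ 0) ` carrier_vec (n 0) \<subseteq> J"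
      proof
        fix y assume "y \<in> (\<lambda>v. (d 0 *\<^sub>v v) $ 0) ` carrier_vec (n 0)"
        then obtain v where "v \<in> carrier_vec (n 0)" "y = (d 0 *\<^sub>v v) $ 0" by blast
        then have "y = lin (n 0) (D 0) (($) v) 0" by (simp add: lind r_def)
        moreover have "lin (n 0) (D 0) (($) v) \<in> M0" unfolding M0 by simp
        ultimately show "y \<in> J" by (simp add: M0_def)
      qed
      show "J \<subseteq> (\<lambda>v. (d 0 *\<^sub>v v) $ 0) ` carrier_vec (n 0)"
      proof
        fix y assume "y \<in> J"
        then have "(\<lambda>a. if a = 0 then y else 0) \<in> M0" by (simp add: M0_def)
        then obtain f where f: "(\<lambda>a. if a = 0 then y else 0) = lin (n 0) (D 0) f" unfolding M0 by blast
        have "y = lin (n 0) (D 0) f 0" using fun_cong[OF f, of 0] by simp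
        also have "lin (n 0) (D 0) f = lin (n 0) (D 0) (($) (vec (n 0) f))" by (rule lin_cong) simp
        also have "\<dots> 0 = (d 0 *\<^sub>v vec (n 0) f) $ 0" by (simp add: lind r_def)
        finally show "y \<in> (\<lambda>v. (d 0 *\<^sub>v v) $ 0) ` carrier_vec (n 0)" by (intro image_eqI) auto
      qed
    qed
    fix i
    have K: "kernel_module (n i) (D i) = range (lin (n (Suc i)) (D (Suc i)))"
      using mapS[of i] by (simp add: resolution_map_def)
    have rS: "r (Suc i) = n i" by (simp add: r_def)
    have ker: "v \<in> mat_kernel (d i) \<longleftrightarrow> v \<in> carrier_vec (n i) \<and> lin (n i) (D i) (($) v) = 0" for v
    proof -
      have "v \<in> mat_kernel (d i) \<longleftrightarrow> v \<in> carrier_vec (n i) \<and> (\<forall>a<r i. (d i *\<^sub>v v) $ a = 0)"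
        unfolding mat_kernel_def by (auto simp: d_def vec_eq_iff)
      moreover have "(\<forall>a<r i. (d i *\<^sub>v v) $ a = 0) \<longleftrightarrow> lin (n i) (D i) (($) v) = 0"
        if "v \<in> carrier_vec (n i)"
      proof -
        have "lin (n i) (D i) (($) v) a = (if a < r i then (d i *\<^sub>v v) $ a else 0)" for a
          using lind[OF that, of a] lin0[of i a] by simp
        then show ?thesis unfolding fun_eq_iff zero_fun_apply by auto
      qed
      ultimately show ?thesis by blast
    qed
    show "mat_kernel (d i) = (\<lambda>v. d (Suc i) *\<^sub>v v) ` carrier_vec (n (Suc i))"
    proof (intro equalityI subsetI)
      fix v assume "v \<in> mat_kernel (d i)"
      then have v: "v \<in> carrier_vec (n i)" "lin (n i) (D i) (($) v) = 0" using ker by auto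
      let ?f = "\<lambda>b. if b < n i then v $ b else 0"
      have "lin (n i) (D i) ?f = lin (n i) (D i) (($) v)" by (rule lin_cong) simp
      then have "?f \<in> kernel_module (n i) (D i)" using v(2) by (simp add: kernel_module_def)
      then obtain g where g: "?f = lin (n (Suc i)) (D (Suc i)) g" unfolding K by blast
      have "v = d (Suc i) *\<^sub>v vec (n (Suc i)) g"
      proof (rule eq_vecI)
        show "dim_vec v = dim_vec (d (Suc i) *\<^sub>v vec (n (Suc i)) g)" using v(1) by (simp add: d_def rS)
        fix b assume "b < dim_vec (d (Suc i) *\<^sub>v vec (n (Suc i)) g)"
        then have b: "b < n i" by (simp add: d_def rS)
        have "v $ b = lin (n (Suc i)) (D (Suc i)) g b" using fun_cong[OF g, of b] b by simp
        also have "lin (n (Suc i)) (D (Suc i)) g = lin (n (Suc i)) (D (Suc i)) (($) (vec (n (Suc i)) g))"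
          by (rule lin_cong) simp
        also have "\<dots> b = (d (Suc i) *\<^sub>v vec (n (Suc i)) g) $ b" using b by (simp add: lind rS)
        finally show "v $ b = (d (Suc i) *\<^sub>v vec (n (Suc i)) g) $ b" .
      qed
      then show "v \<in> (\<lambda>v. d (Suc i) *\<^sub>v v) ` carrier_vec (n (Suc i))" by (intro image_eqI) auto
    next
      fix v assume "v \<in> (\<lambda>v. d (Suc i) *\<^sub>v v) ` carrier_vec (n (Suc i))"
      then obtain w where w: "w \<in> carrier_vec (n (Suc i))" "v = d (Suc i) *\<^sub>v w" by blast
      have vc: "v \<in> carrier_vec (n i)" unfolding w(2)
        by (rule mult_mat_vec_carrier[OF _ w(1)]) (simp add: d_def rS)
      have "lin (n i) (D i) (($) v) = lin (n i) (D i) (lin (n (Suc i)) (D (Suc i)) (($) w))"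
        by (rule lin_cong) (simp add: w(2) lind[OF w(1)] rS)
      moreover have "lin (n (Suc i)) (D (Suc i)) (($) w) \<in> kernel_module (n i) (D i)" unfolding K by simp
      ultimately show "v \<in> mat_kernel (d i)" using vc by (simp add: ker kernel_module_def)
    qed
  qed
  moreover have "d (Suc i) $$ (a, b) \<in> var_ideal UNIV" if "a < n i" "b < n (Suc i)" for i a b
  proof -
    \<comment> \<open>A unit vector shows that each column of the differential is a relation at the
      previous stage, so minimality there removes its constant terms.\<close>
    have "lin (n (Suc i)) (D (Suc i)) (\<lambda>b'. if b' = b then 1 else 0) = (\<lambda>a. D (Suc i) a b)"
      using that by (intro ext) (simp add: lin_def if_distrib sum.delta cong: if_cong)
    then have "(\<lambda>a. D (Suc i) a b) \<in> range (lin (n (Suc i)) (D (Suc i)))" by (metis rangeI)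
    then have "(\<lambda>a. D (Suc i) a b) \<in> kernel_module (n i) (D i)"
      using mapS[of i] by (simp add: resolution_map_def)
    then have z: "lin (n i) (D i) (\<lambda>a. D (Suc i) a b) = 0" by (simp add: kernel_module_def)
    have "\<forall>f. lin (n i) (D i) f = 0 \<longrightarrow> (\<forall>b<n i. Poly_Mapping.lookup (f b) 0 = 0)"
      using map0 mapS by (cases i) (auto simp: resolution_map_def)
    from this[rule_format, OF z that(1)] have "D (Suc i) a b \<in> var_ideal UNIV"
      by (rule in_var_ideal_UNIV)
    then show ?thesis using that by (simp add: d_def r_def)
  qed
  ultimately have "minimal_graded_free_resolution J degs d"
    unfolding minimal_graded_free_resolution_def len by blast
  then show ?thesis by blast
qed

text \<open>This removes the choice from \<open>graded_betti\<close>: its values count generators of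
  an actual resolution, to which the Koszul criterion applies.\<close>

lemma graded_betti_resolution:
  fixes J :: "('x::finite, 'k::field) polyn set"
  assumes "monomial_ideal J"
  shows "\<exists>degs d. graded_free_resolution J degs d \<and> (\<forall>i j. graded_betti J i j = count_list (degs i) j)"
proof -
  let ?x = "SOME (degs, d). minimal_graded_free_resolution J degs d"
  have "\<exists>x. case x of (degs, d) \<Rightarrow> minimal_graded_free_resolution J degs d"
    using minimal_graded_free_resolution_ex[OF assms] by auto
  from someI_ex[OF this] have "minimal_graded_free_resolution J (fst ?x) (snd ?x)"
    by (simp add: case_prod_unfold)
  then have "graded_free_resolution J (fst ?x) (snd ?x)" by (simp add: minimal_graded_free_resolution_def)
  then show ?thesis unfolding graded_betti_def by blast
qed

section \<open>Powers and symbolic powers of the weak homomorphism ideal\<close>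

lemma ideal_gen_base: "b \<in> B \<Longrightarrow> b \<in> ideal_gen B"
  unfolding ideal_gen_def by (rule module.span_base[OF module_times])

lemma subspace_ideal_gen: "module.subspace (*) (ideal_gen B)"
  unfolding ideal_gen_def by (rule module.subspace_span[OF module_times])

lemma ideal_gen_minimal: "B \<subseteq> J \<Longrightarrow> module.subspace (*) J \<Longrightarrow> ideal_gen B \<subseteq> J"
  unfolding ideal_gen_def by (rule module.span_minimal[OF module_times])

lemma ideal_gen_mono: "A \<subseteq> B \<Longrightarrow> ideal_gen A \<subseteq> ideal_gen B"
  unfolding ideal_gen_def by (rule module.span_mono[OF module_times])

lemma subspace_times_iff:
  "module.subspace (*) J \<longleftrightarrow> 0 \<in> J \<and> (\<forall>f\<in>J. \<forall>g\<in>J. f + g \<in> J) \<and> (\<forall>s. \<forall>f\<in>J. s * f \<in> J)"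
  by (auto simp: module.subspace_def[OF module_times])

text \<open>The members all of whose monomials lie in the ideal form an ideal again, and it contains
  the generators.\<close>

lemma monomial_ideal_gen:
  fixes B :: "('x, 'k::comm_ring_1) polyn set"
  assumes B: "\<And>b t. b \<in> B \<Longrightarrow> t \<in> Poly_Mapping.keys b \<Longrightarrow> Poly_Mapping.single t 1 \<in> ideal_gen B"
  shows "monomial_ideal (ideal_gen B)"
proof -
  let ?I = "ideal_gen B"
  let ?K = "{f \<in> ?I. \<forall>t\<in>Poly_Mapping.keys f. Poly_Mapping.single t 1 \<in> ?I}"
  have I: "0 \<in> ?I" "\<And>f g. f \<in> ?I \<Longrightarrow> g \<in> ?I \<Longrightarrow> f + g \<in> ?I" "\<And>s f. f \<in> ?I \<Longrightarrow> s * f \<in> ?I"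
    using subspace_ideal_gen[of B] unfolding subspace_times_iff by blast+
  have "module.subspace (*) ?K"
    unfolding subspace_times_iff
  proof (intro conjI ballI allI)
    show "0 \<in> ?K" using I by simp
    show "f + g \<in> ?K" if "f \<in> ?K" "g \<in> ?K" for f g
      using that keys_add[of f g] I(2) by auto
    show "s * f \<in> ?K" if f: "f \<in> ?K" for s f
    proof (intro CollectI conjI ballI)
      show "s * f \<in> ?I" using f I(3) by simp
      fix t assume "t \<in> Poly_Mapping.keys (s * f)"
      then obtain u v where t: "t = u + v" "v \<in> Poly_Mapping.keys f" using keys_mult[of s f] by blast
      have "Poly_Mapping.single u 1 * Poly_Mapping.single v (1::'k) \<in> ?I" using f t(2) by (intro I(3)) blast
      then show "Poly_Mapping.single t 1 \<in> ?I" by (simp add: mult_single t)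
    qed
  qed
  moreover have "B \<subseteq> ?K" using B ideal_gen_base by blast
  ultimately have "?I \<subseteq> ?K" by (intro ideal_gen_minimal)
  then show ?thesis unfolding monomial_ideal_def using I by blast
qed

lemma monomial_ideal_mult:
  fixes I J :: "('x, 'k::comm_ring_1) polyn set"
  assumes I: "monomial_ideal I" and J: "monomial_ideal J"
  shows "monomial_ideal (ideal_mult I J)"
  unfolding ideal_mult_def
proof (rule monomial_ideal_gen)
  fix b t assume "b \<in> {a * b |a b. a \<in> I \<and> b \<in> J}" and t: "t \<in> Poly_Mapping.keys b"
  then obtain f g where fg: "b = f * g" "f \<in> I" "g \<in> J" by blast
  obtain u v where uv: "t = u + v" "u \<in> Poly_Mapping.keys f" "v \<in> Poly_Mapping.keys g"
    using keys_mult[of f g] t fg(1) by blast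
  have e: "Poly_Mapping.single t (1::'k) = Poly_Mapping.single u 1 * Poly_Mapping.single v 1"
    by (simp add: mult_single uv)
  have uI: "Poly_Mapping.single u (1::'k) \<in> I" using I fg(2) uv(2) unfolding monomial_ideal_def by blast
  have vJ: "Poly_Mapping.single v (1::'k) \<in> J" using J fg(3) uv(3) unfolding monomial_ideal_def by blast
  show "Poly_Mapping.single t 1 \<in> ideal_gen {a * b |a b. a \<in> I \<and> b \<in> J}"
    unfolding e
    by (intro ideal_gen_base CollectI exI[of _ "Poly_Mapping.single u 1"] exI[of _ "Poly_Mapping.single v 1"]
        conjI refl uI vJ)
qed

lemma monomial_ideal_UNIV: "monomial_ideal UNIV"
  by (simp add: monomial_ideal_def)

lemma monomial_ideal_power: "monomial_ideal I \<Longrightarrow> monomial_ideal (ideal_power I k)"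
  by (induction k) (simp_all add: monomial_ideal_UNIV monomial_ideal_mult)

lemma monomial_ideal_INT:
  assumes "\<And>i. i \<in> A \<Longrightarrow> monomial_ideal (f i)"
  shows "monomial_ideal (\<Inter>i\<in>A. f i)"
  unfolding monomial_ideal_def
proof (intro conjI ballI allI INT_I)
  fix i assume i: "i \<in> A"
  note I = assms[OF i, unfolded monomial_ideal_def]
  show "0 \<in> f i" using I by simp
  show "g + h \<in> f i" if "g \<in> (\<Inter>i\<in>A. f i)" "h \<in> (\<Inter>i\<in>A. f i)" for g h
    using I that i by simp
  show "s * g \<in> f i" if "g \<in> (\<Inter>i\<in>A. f i)" for s g using I that i by simp
  show "Poly_Mapping.single t 1 \<in> f i" if "g \<in> (\<Inter>i\<in>A. f i)" "t \<in> Poly_Mapping.keys g" for g t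
  proof -
    have "g \<in> f i" using that(1) i by simp
    then show ?thesis using I that(2) by blast
  qed
qed

lemma ideal_mult_mono: "I \<subseteq> I' \<Longrightarrow> J \<subseteq> J' \<Longrightarrow> ideal_mult I J \<subseteq> ideal_mult I' J'"
  unfolding ideal_mult_def by (rule ideal_gen_mono) blast

lemma ideal_power_mono: "I \<subseteq> J \<Longrightarrow> ideal_power I k \<subseteq> ideal_power J k"
  by (induction k) (simp_all add: ideal_mult_mono)

lemma single_in_ideal_power_Suc:
  fixes I :: "('x, 'k::comm_ring_1) polyn set"
  assumes "Poly_Mapping.single s 1 \<in> I" "Poly_Mapping.single t 1 \<in> ideal_power I k"
  shows "Poly_Mapping.single (s + t) 1 \<in> ideal_power I (Suc k)"
proof -
  have "Poly_Mapping.single (s + t) (1::'k) = Poly_Mapping.single s 1 * Poly_Mapping.single t 1"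
    by (simp add: mult_single)
  also have "\<dots> \<in> ideal_power I (Suc k)"
    unfolding ideal_power.simps ideal_mult_def
    by (intro ideal_gen_base CollectI exI[of _ "Poly_Mapping.single s 1"] exI[of _ "Poly_Mapping.single t 1"]
        conjI refl assms)
  finally show ?thesis .
qed

lemma single_in_ideal_power:
  fixes I :: "('x, 'k::comm_ring_1) polyn set"
  assumes "Poly_Mapping.single s 1 \<in> I"
  shows "Poly_Mapping.single (\<Sum>l<k. s) 1 \<in> ideal_power I k"
proof (induction k)
  case (Suc k)
  then show ?case using single_in_ideal_power_Suc[OF assms Suc] by (simp add: add.commute)
qed simp

section \<open>Powers of monomial primes and degrees in their variables\<close>

definition part_deg :: "'x set \<Rightarrow> ('x::finite \<Rightarrow>\<^sub>0 nat) \<Rightarrow> nat" where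
  "part_deg P t = (\<Sum>x\<in>P. Poly_Mapping.lookup t x)"

lemma part_deg_add: "part_deg P (s + t) = part_deg P s + part_deg P t"
  by (simp add: part_deg_def lookup_add sum.distrib)

lemma subspace_part_deg:
  "module.subspace (*) {f :: ('x::finite, 'k::comm_ring_1) polyn. \<forall>t\<in>Poly_Mapping.keys f. k \<le> part_deg P t}"
  (is "module.subspace _ ?K")
  unfolding subspace_times_iff
proof (intro conjI ballI allI)
  show "0 \<in> ?K" by simp
  show "f + g \<in> ?K" if "f \<in> ?K" "g \<in> ?K" for f g using that keys_add[of f g] by blast
  show "s * f \<in> ?K" if f: "f \<in> ?K" for s f
  proof (intro CollectI ballI)
    fix t assume "t \<in> Poly_Mapping.keys (s * f)"
    then obtain u v where t: "t = u + v" "v \<in> Poly_Mapping.keys f" using keys_mult[of s f] by blast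
    then show "k \<le> part_deg P t" using f by (auto simp: part_deg_add trans_le_add2)
  qed
qed

lemma part_deg_var_ideal:
  fixes f :: "('x::finite, 'k::comm_ring_1) polyn"
  assumes "f \<in> var_ideal P" "t \<in> Poly_Mapping.keys f"
  shows "1 \<le> part_deg P t"
proof -
  have "var_ideal P \<subseteq> {f :: ('x, 'k) polyn. \<forall>t\<in>Poly_Mapping.keys f. 1 \<le> part_deg P t}"
    unfolding var_ideal_def
  proof (rule ideal_gen_minimal[OF _ subspace_part_deg])
    show "var ` P \<subseteq> {f :: ('x, 'k) polyn. \<forall>t\<in>Poly_Mapping.keys f. 1 \<le> part_deg P t}"
      by (auto simp: var_def part_deg_def lookup_single when_def sum.delta')
  qed
  then show ?thesis using assms by blast
qed

text \<open>The degree in the variables of \<open>P\<close> is additive over products of monomials.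
  This bound is the means by which monomials are later shown to lie outside an ideal.\<close>

lemma part_deg_var_ideal_power:
  fixes f :: "('x::finite, 'k::comm_ring_1) polyn"
  assumes "f \<in> ideal_power (var_ideal P) k" "t \<in> Poly_Mapping.keys f"
  shows "k \<le> part_deg P t"
proof -
  have "ideal_power (var_ideal P) k \<subseteq> {f :: ('x, 'k) polyn. \<forall>t\<in>Poly_Mapping.keys f. k \<le> part_deg P t}"
  proof (induction k)
    case (Suc k)
    show ?case
      unfolding ideal_power.simps ideal_mult_def
    proof (rule ideal_gen_minimal[OF _ subspace_part_deg], safe)
      fix f g :: "('x, 'k) polyn" and t
      assume f: "f \<in> var_ideal P" and g: "g \<in> ideal_power (var_ideal P) k" and t: "t \<in> Poly_Mapping.keys (f * g)"
      obtain u v where uv: "t = u + v" "u \<in> Poly_Mapping.keys f" "v \<in> Poly_Mapping.keys g"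
        using keys_mult[of f g] t by blast
      have "1 \<le> part_deg P u" "k \<le> part_deg P v"
        using part_deg_var_ideal[OF f uv(2)] Suc g uv(3) by auto
      then show "Suc k \<le> part_deg P t" by (simp add: uv(1) part_deg_add)
    qed
  qed simp
  then show ?thesis using assms by blast
qed

lemma single_in_var_ideal:
  assumes "x \<in> P" "x \<in> Poly_Mapping.keys t"
  shows "(Poly_Mapping.single t c :: ('x, 'k::comm_ring_1) polyn) \<in> var_ideal P"
proof -
  have "Poly_Mapping.single (t - Poly_Mapping.single x 1) c * (var x :: ('x, 'k) polyn) \<in> var_ideal P"
    using subspace_ideal_gen[of "var ` P"] ideal_gen_base[of "var x" "var ` P"] assms(1)
    unfolding var_ideal_def subspace_times_iff by blast
  moreover have "t - Poly_Mapping.single x 1 + Poly_Mapping.single x 1 = t"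
    using mon_le_add_diff[of "Poly_Mapping.single x 1" t] assms(2) by (simp add: add.commute)
  ultimately show ?thesis by (simp add: var_def mult_single)
qed

lemma monomial_ideal_var_ideal: "monomial_ideal (var_ideal P :: ('x, 'k::comm_ring_1) polyn set)"
  unfolding var_ideal_def
proof (rule monomial_ideal_gen)
  fix b :: "('x, 'k) polyn" and t assume "b \<in> var ` P" "t \<in> Poly_Mapping.keys b"
  then show "Poly_Mapping.single t 1 \<in> ideal_gen (var ` P)"
    by (auto simp: var_def split: if_splits intro!: ideal_gen_base)
qed

lemma var_ideal_mono: "A \<subseteq> B \<Longrightarrow> var_ideal A \<subseteq> var_ideal B"
  unfolding var_ideal_def by (rule ideal_gen_mono) blast

section \<open>Primary decomposition of the weak homomorphism ideal\<close>

definition hom_mon :: "('v::finite \<Rightarrow> 'w) \<Rightarrow> 'v \<times> 'w \<Rightarrow>\<^sub>0 nat" where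
  "hom_mon \<phi> = (\<Sum>i\<in>UNIV. Poly_Mapping.single (i, \<phi> i) 1)"

lemma lookup_hom_mon: "Poly_Mapping.lookup (hom_mon \<phi>) (v, w) = (if \<phi> v = w then 1 else 0)"
proof -
  have "Poly_Mapping.lookup (hom_mon \<phi>) (v, w) = (\<Sum>i\<in>UNIV. if i = v then (if \<phi> v = w then 1 else 0) else 0)"
    unfolding hom_mon_def lookup_sum by (rule sum.cong) (auto simp: lookup_single when_def)
  then show ?thesis by simp
qed

lemma prod_var_hom_mon: "(\<Prod>i\<in>UNIV. var (i, \<phi> i)) = Poly_Mapping.single (hom_mon \<phi>) 1"
proof -
  have "(\<Prod>i\<in>A. var (i, \<phi> i)) = Poly_Mapping.single (\<Sum>i\<in>A. Poly_Mapping.single (i, \<phi> i) 1) 1"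
    if "finite A" for A using that
    by (induction A rule: finite_induct) (simp_all add: var_def mult_single)
  then show ?thesis by (simp add: hom_mon_def)
qed

lemma weak_hom_ideal_alt:
  "weak_hom_ideal G H = ideal_gen ((\<lambda>\<phi>. Poly_Mapping.single (hom_mon \<phi>) 1) ` weak_homs G H)"
  unfolding weak_hom_ideal_def prod_var_hom_mon ..

lemma hom_mon_in_weak_hom_ideal:
  "\<phi> \<in> weak_homs G H \<Longrightarrow> Poly_Mapping.single (hom_mon \<phi>) 1 \<in> weak_hom_ideal G H"
  unfolding weak_hom_ideal_alt by (rule ideal_gen_base) blast

lemma monomial_ideal_weak_hom_ideal: "monomial_ideal (weak_hom_ideal G H)"
  unfolding weak_hom_ideal_alt
  by (rule monomial_ideal_gen) (auto split: if_splits intro!: ideal_gen_base)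

text \<open>Vertex covers of the hypergraph whose edges are the graphs of the weak
  homomorphisms.\<close>

definition covers :: "'v set set \<Rightarrow> 'w set set \<Rightarrow> ('v \<times> 'w) set \<Rightarrow> bool" where
  "covers G H P \<longleftrightarrow> (\<forall>\<phi>\<in>weak_homs G H. \<exists>v. (v, \<phi> v) \<in> P)"

lemma weak_hom_ideal_covers:
  assumes "covers G H P"
  shows "weak_hom_ideal G H \<subseteq> var_ideal P"
  unfolding weak_hom_ideal_alt
proof (rule ideal_gen_minimal)
  show "module.subspace (*) (var_ideal P)" unfolding var_ideal_def by (rule subspace_ideal_gen)
  show "(\<lambda>\<phi>. Poly_Mapping.single (hom_mon \<phi>) 1) ` weak_homs G H \<subseteq> var_ideal P"
  proof safe
    fix \<phi> assume "\<phi> \<in> weak_homs G H"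
    then obtain v where "(v, \<phi> v) \<in> P" using assms unfolding covers_def by blast
    then show "Poly_Mapping.single (hom_mon \<phi>) 1 \<in> var_ideal P"
      by (rule single_in_var_ideal) (simp add: in_keys_iff lookup_hom_mon)
  qed
qed

text \<open>If no generator divides a monomial, the complement of its support is a cover, and the
  monomial avoids the prime belonging to it.\<close>

lemma weak_hom_ideal_Inter:
  "weak_hom_ideal G H = (\<Inter>P\<in>{P. covers G H P}. var_ideal P :: ('v::finite \<times> 'w::finite, 'k::comm_ring_1) polyn set)"
proof (intro equalityI subsetI)
  fix f :: "('v \<times> 'w, 'k) polyn" assume "f \<in> weak_hom_ideal G H"
  then show "f \<in> (\<Inter>P\<in>{P. covers G H P}. var_ideal P)" using weak_hom_ideal_covers by blast
next
  fix f :: "('v \<times> 'w, 'k) polyn" assume f: "f \<in> (\<Inter>P\<in>{P. covers G H P}. var_ideal P)"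
  have I: "monomial_ideal (weak_hom_ideal G H :: ('v \<times> 'w, 'k) polyn set)"
    by (rule monomial_ideal_weak_hom_ideal)
  have "Poly_Mapping.single t (Poly_Mapping.lookup f t) \<in> weak_hom_ideal G H"
    if t: "t \<in> Poly_Mapping.keys f" for t
  proof -
    have "\<exists>\<phi>\<in>weak_homs G H. mon_le (hom_mon \<phi>) t"
    proof (rule ccontr)
      assume n: "\<not> ?thesis"
      let ?P = "- Poly_Mapping.keys t"
      have "covers G H ?P"
        unfolding covers_def
      proof
        fix \<phi> assume "\<phi> \<in> weak_homs G H"
        then obtain v w where "\<not> Poly_Mapping.lookup (hom_mon \<phi>) (v, w) \<le> Poly_Mapping.lookup t (v, w)"
          using n unfolding mon_le_def by auto
        then show "\<exists>v. (v, \<phi> v) \<in> ?P"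
          by (auto simp: lookup_hom_mon in_keys_iff split: if_splits intro!: exI[of _ v])
      qed
      then have "f \<in> var_ideal ?P" using f by blast
      then have "1 \<le> part_deg ?P t" using t by (rule part_deg_var_ideal)
      then show False by (simp add: part_deg_def in_keys_iff)
    qed
    then obtain \<phi> where \<phi>: "\<phi> \<in> weak_homs G H" "mon_le (hom_mon \<phi>) t" by blast
    have "Poly_Mapping.single (t - hom_mon \<phi> + hom_mon \<phi>) (Poly_Mapping.lookup f t) \<in> weak_hom_ideal G H"
      by (rule monomial_ideal_single[OF I hom_mon_in_weak_hom_ideal[OF \<phi>(1)]])
    then show ?thesis using mon_le_add_diff[OF \<phi>(2)] by (simp add: add.commute)
  qed
  then have "(\<Sum>t\<in>Poly_Mapping.keys f. Poly_Mapping.single t (Poly_Mapping.lookup f t)) \<in> weak_hom_ideal G H"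
    by (rule monomial_ideal_sum[OF I])
  then show "f \<in> weak_hom_ideal G H"
    using poly_mapping_decomp[of "Poly_Mapping.keys f" f] by simp
qed

text \<open>A family of smallest cardinality with this intersection cannot lose a member. Existence
  gives content to the choice in \<open>symbolic_power\<close>.\<close>

lemma irredundant_decomposition_ex:
  fixes I :: "('x, 'k::comm_ring_1) polyn set"
  assumes "finite \<C>" "I = (\<Inter>A\<in>\<C>. var_ideal A)"
  shows "\<exists>\<A>. irredundant_decomposition I \<A>"
proof -
  define P where "P \<A> \<longleftrightarrow> finite \<A> \<and> I = (\<Inter>A\<in>\<A>. var_ideal A)" for \<A>
  have "P \<C>" using assms by (simp add: P_def)
  from ex_has_least_nat[of P, OF this, of card] obtain \<A> where
    A: "P \<A> \<and> (\<forall>\<B>. P \<B> \<longrightarrow> card \<A> \<le> card \<B>)" ..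
  have irr: "I \<noteq> (\<Inter>B\<in>\<A> - {A}. var_ideal B)" if "A \<in> \<A>" for A
  proof
    assume "I = (\<Inter>B\<in>\<A> - {A}. var_ideal B)"
    moreover have fin: "finite \<A>" using A by (simp add: P_def)
    ultimately have "P (\<A> - {A})" by (simp add: P_def)
    then have "card \<A> \<le> card (\<A> - {A})" using A by blast
    then show False using card_Diff1_less[OF fin that] by simp
  qed
  from A have "P \<A>" ..
  then have "irredundant_decomposition I \<A>"
    unfolding irredundant_decomposition_def P_def using irr by (elim conjE) (intro conjI ballI)
  then show ?thesis by (rule exI)
qed

text \<open>Otherwise take from each member a variable outside \<open>P\<close>: their product lies
  in every component but not in \<open>var_ideal P\<close>.\<close>

lemma decomposition_member_subset:
  fixes \<A> :: "'x::finite set set"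
  assumes fin: "finite \<A>" and sub: "(\<Inter>A\<in>\<A>. var_ideal A :: ('x, 'k::field) polyn set) \<subseteq> var_ideal P"
  shows "\<exists>A\<in>\<A>. A \<subseteq> P"
proof (rule ccontr)
  assume "\<not> ?thesis"
  then have "\<forall>A\<in>\<A>. \<exists>x. x \<in> A \<and> x \<notin> P" by blast
  from bchoice[OF this] obtain x where "\<forall>A\<in>\<A>. x A \<in> A \<and> x A \<notin> P" ..
  then have x: "x A \<in> A" "x A \<notin> P" if "A \<in> \<A>" for A using that by auto
  define t where "t = (\<Sum>A\<in>\<A>. Poly_Mapping.single (x A) (1::nat))"
  have t: "Poly_Mapping.lookup t y = (\<Sum>A\<in>\<A>. if x A = y then 1 else 0)" for y
    unfolding t_def lookup_sum by (rule sum.cong) (simp_all add: lookup_single when_def)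
  have "Poly_Mapping.single t (1::'k) \<in> var_ideal A" if "A \<in> \<A>" for A
  proof (rule single_in_var_ideal)
    show "x A \<in> A" using x that by blast
    have "Poly_Mapping.lookup t (x A) \<noteq> 0" unfolding t using fin that by (auto simp: sum_eq_0_iff intro!: bexI[of _ A])
    then show "x A \<in> Poly_Mapping.keys t" by (simp add: in_keys_iff)
  qed
  then have "Poly_Mapping.single t (1::'k) \<in> var_ideal P" using sub by blast
  then have "1 \<le> part_deg P t" by (rule part_deg_var_ideal) simp
  moreover have "Poly_Mapping.lookup t y = 0" if "y \<in> P" for y
    unfolding t using x that by (intro sum.neutral) auto
  ultimately show False by (simp add: part_deg_def)
qed

text \<open>The only properties of the ideals \<open>I\<^sup>k\<close> and \<open>I\<^sup>(\<^sup>k\<^sup>)\<close> that matter: they are monomial ideals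
  lying between \<open>I\<^sup>k\<close> and all \<open>k\<close>-th powers of monomial primes containing \<open>I\<close>.\<close>

definition power_like ::
    "'v::finite set set \<Rightarrow> 'w::finite set set \<Rightarrow> nat \<Rightarrow> ('v \<times> 'w, 'k::field) polyn set \<Rightarrow> bool" where
  "power_like G H k J \<longleftrightarrow> monomial_ideal J \<and> ideal_power (weak_hom_ideal G H) k \<subseteq> J \<and>
     (\<forall>P. covers G H P \<longrightarrow> J \<subseteq> ideal_power (var_ideal P) k)"

lemma power_like_ideal_power: "power_like G H k (ideal_power (weak_hom_ideal G H) k)"
  unfolding power_like_def
  by (auto intro: monomial_ideal_power monomial_ideal_weak_hom_ideal
      dest: ideal_power_mono[OF weak_hom_ideal_covers, THEN subsetD])

text \<open>Whichever decomposition is chosen, each cover contains one of its members, so the power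
  of that component lies in the power of the prime of the cover.\<close>

lemma power_like_symbolic_power:
  "power_like G H k (symbolic_power (weak_hom_ideal G H :: ('v::finite \<times> 'w::finite, 'k::field) polyn set) k)"
proof -
  let ?I = "weak_hom_ideal G H :: ('v \<times> 'w, 'k) polyn set"
  define \<A> where "\<A> = (SOME \<A>. irredundant_decomposition ?I \<A>)"
  have "irredundant_decomposition ?I \<A>"
    unfolding \<A>_def
    by (rule someI_ex, rule irredundant_decomposition_ex[OF _ weak_hom_ideal_Inter]) simp
  then have \<A>: "finite \<A>" "?I = (\<Inter>A\<in>\<A>. var_ideal A)"
    unfolding irredundant_decomposition_def by blast+
  have s: "symbolic_power ?I k = (\<Inter>A\<in>\<A>. ideal_power (var_ideal A) k)"
    by (simp add: symbolic_power_def \<A>_def)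
  show ?thesis
    unfolding power_like_def s
  proof (intro conjI allI impI)
    show "monomial_ideal (\<Inter>A\<in>\<A>. ideal_power (var_ideal A :: ('v \<times> 'w, 'k) polyn set) k)"
      by (intro monomial_ideal_INT monomial_ideal_power monomial_ideal_var_ideal)
    show "ideal_power ?I k \<subseteq> (\<Inter>A\<in>\<A>. ideal_power (var_ideal A) k)"
      using \<A>(2) by (intro INT_greatest ideal_power_mono) blast
    fix P assume "covers G H P"
    then have "(\<Inter>A\<in>\<A>. var_ideal A :: ('v \<times> 'w, 'k) polyn set) \<subseteq> var_ideal P"
      using weak_hom_ideal_covers \<A>(2) by metis
    from decomposition_member_subset[OF \<A>(1) this] obtain A where A: "A \<in> \<A>" "A \<subseteq> P" by blast
    have "(\<Inter>A\<in>\<A>. ideal_power (var_ideal A) k) \<subseteq> ideal_power (var_ideal A :: ('v \<times> 'w, 'k) polyn set) k"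
      using A(1) by blast
    also have "\<dots> \<subseteq> ideal_power (var_ideal P) k"
      by (intro ideal_power_mono var_ideal_mono A(2))
    finally show "(\<Inter>A\<in>\<A>. ideal_power (var_ideal A :: ('v \<times> 'w, 'k) polyn set) k) \<subseteq> ideal_power (var_ideal P) k" .
  qed
qed

text \<open>The inequality says that \<open>u_\<phi> u_\<psi>^(k-1)\<close>, an element of the
  \<open>k\<close>-th power, divides the monomial. In the applications \<open>\<psi>\<close> is
  constant and only \<open>\<phi>\<close> varies.\<close>

lemma power_like_single:
  fixes J :: "('v::finite \<times> 'w::finite, 'k::field) polyn set"
  assumes J: "power_like G H k J" and k: "k \<ge> 1" and hom: "\<phi> \<in> weak_homs G H" "\<psi> \<in> weak_homs G H"
    and le: "\<And>v w. (if \<phi> v = w then 1 else 0) + (k - 1) * (if \<psi> v = w then 1 else 0) \<le> Poly_Mapping.lookup t (v, w)"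
  shows "Poly_Mapping.single t c \<in> J"
proof -
  let ?I = "weak_hom_ideal G H :: ('v \<times> 'w, 'k) polyn set"
  define s where "s = hom_mon \<phi> + (\<Sum>l<k - 1. hom_mon \<psi>)"
  have "Poly_Mapping.single s 1 \<in> ideal_power ?I (Suc (k - 1))"
    unfolding s_def
    by (intro single_in_ideal_power_Suc single_in_ideal_power hom_mon_in_weak_hom_ideal hom)
  then have "Poly_Mapping.single s 1 \<in> J" using J k unfolding power_like_def by auto
  moreover have "mon_le s t"
    unfolding mon_le_def
  proof
    fix x :: "'v \<times> 'w"
    obtain v w where x: "x = (v, w)" by (cases x)
    show "Poly_Mapping.lookup s x \<le> Poly_Mapping.lookup t x"
      using le[of v w] by (simp add: s_def x lookup_add lookup_sum lookup_hom_mon)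
  qed
  ultimately show ?thesis
    using monomial_ideal_single[of J s "t - s" c] mon_le_add_diff[of s t] J
    by (simp add: power_like_def add.commute)
qed

lemma power_like_part_deg:
  assumes "power_like G H k J" "f \<in> J" "t \<in> Poly_Mapping.keys f" "covers G H P"
  shows "k \<le> part_deg P t"
  using assms part_deg_var_ideal_power unfolding power_like_def by blast

section \<open>The projective dimension\<close>

definition mon_of :: "('x \<Rightarrow> nat) \<Rightarrow> 'x::finite \<Rightarrow>\<^sub>0 nat" where
  "mon_of F = Poly_Mapping.Abs_poly_mapping F"

lemma lookup_mon_of [simp]: "Poly_Mapping.lookup (mon_of F) = F"
  by (simp add: mon_of_def)

lemma mon_deg_mon_of: "mon_deg (mon_of F) = (\<Sum>x\<in>UNIV. F x)"
  by (simp add: mon_deg_UNIV)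

text \<open>The cycle is the Koszul boundary of \<open>f e\<^sub>X\<close> for a socle element \<open>f\<close> of \<open>S/J\<close> with respect to
  the variables in \<open>X\<close>.\<close>

lemma resolution_length:
  fixes J :: "('x::finite, 'k::field) polyn set"
  assumes res: "graded_free_resolution J degs d"
    and X: "X \<noteq> {}"
    and xJ: "\<And>x c. x \<in> X \<Longrightarrow> Poly_Mapping.single (Poly_Mapping.single x 1 + t) c \<in> J"
    and tJ: "\<And>f. f \<in> J \<Longrightarrow> t \<notin> Poly_Mapping.keys f"
  shows "degs (card X - 1) \<noteq> []"
proof -
  obtain \<rho> :: "'x \<Rightarrow> nat" where \<rho>: "inj \<rho>"
    using finite_imp_inj_to_nat_seg[of "UNIV :: 'x set"] by auto
  define e where "e T = (if T = X then Poly_Mapping.single t (1::'k) else 0)" for T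
  define z where "z = kdiff \<rho> X e"
  have cX: "card X \<ge> 1" using X by (simp add: Suc_le_eq card_gt_0_iff)
  have facet: "\<exists>x\<in>X. X - T = {x} \<and> insert x T = X" if "T \<subseteq> X" "card T = card X - 1" for T
  proof -
    have "card (X - T) = 1" using that cX by (simp add: card_Diff_subset)
    then obtain x where x: "X - T = {x}" by (auto simp: card_1_singleton_iff)
    then show ?thesis using that by (intro bexI[of _ x]) auto
  qed
  have zf: "z T = Poly_Mapping.single (Poly_Mapping.single x 1 + t) (ksgn \<rho> x T)"
    if "X - T = {x}" "insert x T = X" for x T
    unfolding z_def kdiff_def that(1) by (simp add: that(2) e_def mult_single)
  have "degs (card X - 1) \<noteq> [] \<and> (X = UNIV \<longrightarrow> mon_deg t + card X \<in> set (degs (card X - 1)))"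
  proof (rule graded_free_resolution_koszul[OF res \<rho>, of X _ z])
    fix T assume T: "T \<subseteq> X" "card T = card X - 1"
    from facet[OF this] obtain x where x: "x \<in> X" "X - T = {x}" "insert x T = X" by blast
    show "z T \<in> J" unfolding zf[OF x(2,3)] by (rule xJ[OF x(1)])
    show "mon_deg s + (card X - 1) = mon_deg t + card X" if "s \<in> Poly_Mapping.keys (z T)" for s
      using that cX unfolding zf[OF x(2,3)] by (auto simp: mon_deg_add split: if_splits)
  next
    fix T assume "T \<subseteq> X" "card T + 1 = card X - 1"
    show "kdiff \<rho> X z T = 0" unfolding z_def by (rule kdiff_kdiff[OF \<rho>])
  next
    fix v assume vJ: "\<And>T. T \<subseteq> X \<Longrightarrow> card T = Suc (card X - 1) \<Longrightarrow> v T \<in> J"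
      and vz: "\<And>T. T \<subseteq> X \<Longrightarrow> card T = card X - 1 \<Longrightarrow> kdiff \<rho> X v T = z T"
    obtain x where xX: "x \<in> X" using X by blast
    let ?T = "X - {x}"
    have T: "?T \<subseteq> X" "card ?T = card X - 1" using xX by auto
    have xT: "X - ?T = {x}" "insert x ?T = X" using xX by auto
    \<comment> \<open>In top degree a chain is the single polynomial \<open>v X\<close>, and one
      coefficient of its boundary already forces \<open>t\<close> to occur in it.\<close>
    have "Poly_Mapping.single (Poly_Mapping.single x 1) (ksgn \<rho> x ?T) * v X = z ?T"
      using vz[OF T] unfolding kdiff_def xT(1) by (simp add: insert_absorb[OF xX])
    then have "Poly_Mapping.lookup (Poly_Mapping.single (Poly_Mapping.single x 1) (ksgn \<rho> x ?T) * v X) (Poly_Mapping.single x 1 + t)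
      = ksgn \<rho> x ?T" unfolding zf[OF xT] by simp
    then have "ksgn \<rho> x ?T * Poly_Mapping.lookup (v X) t = ksgn \<rho> x ?T"
      unfolding lookup_single_mult by (simp add: mon_le_def lookup_add)
    then have "Poly_Mapping.lookup (v X) t \<noteq> 0" by (auto simp: ksgn_def)
    moreover have "v X \<in> J" using vJ[of X] cX by simp
    ultimately show False using tJ by (auto simp: in_keys_iff)
  qed
  then show ?thesis ..
qed

lemma const_in_weak_homs: "(\<lambda>_. w) \<in> weak_homs G H"
  by (simp add: weak_homs_def)

lemma proj_dim_power_like:
  fixes G :: "'v::finite set set" and H :: "'w::finite set set"
    and J :: "('v \<times> 'w, 'k::field) polyn set"
  assumes J: "power_like G H k J" and k: "k \<ge> 1"
  shows "proj_dim J \<ge> enat (CARD('w) - 1)"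
proof -
  have mon: "monomial_ideal J" using J by (simp add: power_like_def)
  from graded_betti_resolution[OF mon] obtain degs d where
    res: "graded_free_resolution J degs d" and betti: "\<And>i j. graded_betti J i j = count_list (degs i) j"
    by blast
  fix v0 :: 'v and w0 :: 'w
  define X where "X = {v0} \<times> (UNIV :: 'w set)"
  \<comment> \<open>In row \<open>v0\<close> the degree is \<open>k - 1\<close>, one too small for
    \<open>J\<close>. One more variable \<open>(v0, w)\<close> makes room for the constant map
    \<open>w\<close> once and the constant map \<open>w0\<close> another \<open>k - 1\<close>
    times.\<close>
  define t where "t = mon_of (\<lambda>(v, w). if v = v0 then (if w = w0 then k - 1 else 0) else k)"
  have cX: "card X = CARD('w)" by (simp add: X_def)
  have "degs (card X - 1) \<noteq> []"
  proof (rule resolution_length[OF res])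
    show "X \<noteq> {}" by (simp add: X_def)
    show "Poly_Mapping.single (Poly_Mapping.single x 1 + t) c \<in> J" if "x \<in> X" for x c
    proof -
      obtain w where x: "x = (v0, w)" using \<open>x \<in> X\<close> by (auto simp: X_def)
      show ?thesis
        by (rule power_like_single[OF J k const_in_weak_homs[of w] const_in_weak_homs[of w0]])
          (use k in \<open>auto simp: x t_def lookup_add lookup_single when_def\<close>)
    qed
    show "t \<notin> Poly_Mapping.keys f" if "f \<in> J" for f
    proof
      assume "t \<in> Poly_Mapping.keys f"
      moreover have "covers G H X" by (auto simp: covers_def X_def)
      ultimately have "k \<le> part_deg X t" by (rule power_like_part_deg[OF J \<open>f \<in> J\<close>])
      also have "part_deg X t = (\<Sum>w\<in>UNIV. if w = w0 then k - 1 else 0)"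
        unfolding part_deg_def X_def sum.cartesian_product[symmetric, of "\<lambda>v w. Poly_Mapping.lookup t (v, w)", simplified]
        by (simp add: t_def)
      also have "\<dots> = k - 1" by simp
      finally show False using k by simp
    qed
  qed
  then obtain j where "j \<in> set (degs (card X - 1))" by (meson last_in_set)
  then have "graded_betti J (card X - 1) j \<noteq> 0" by (simp add: betti count_list_0_iff)
  then show ?thesis unfolding proj_dim_def cX by (intro Sup_upper) blast
qed

section \<open>The regularity\<close>

text \<open>\<open>\<kappa>\<close> sends a vertex to its component and \<open>rep\<close> chooses a
  vertex in each. The order assumptions say that components, and columns within a component, are
  intervals for \<open>\<rho>\<close>. \<open>in_J\<close> comes from maps constant on components
  with values in \<open>A\<close>; \<open>not_in_J\<close> comes from covers that use one point of
  component \<open>b\<close> in each column of \<open>A\<close>.\<close>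

locale component_grid =
  fixes \<kappa> :: "'v::finite \<Rightarrow> 'b" and rep :: "'b \<Rightarrow> 'v" and A :: "'w::finite set" and j0 :: 'w
    and \<rho> :: "'v \<times> 'w \<Rightarrow> nat" and k :: nat and J :: "('v \<times> 'w, 'k::field) polyn set"
  assumes rep: "\<And>b. b \<in> range \<kappa> \<Longrightarrow> \<kappa> (rep b) = b"
    and j0: "j0 \<in> A" and k: "k \<ge> 1" and inj: "inj \<rho>"
    and order_component: "\<And>v v' j j' u. \<kappa> v = \<kappa> v' \<Longrightarrow> \<kappa> (fst u) \<noteq> \<kappa> v \<Longrightarrow> \<rho> u < \<rho> (v, j) \<longleftrightarrow> \<rho> u < \<rho> (v', j')"
    and order_block: "\<And>v v' j u. \<kappa> v = \<kappa> v' \<Longrightarrow> (\<kappa> (fst u), snd u) \<noteq> (\<kappa> v, j) \<Longrightarrow> \<rho> u < \<rho> (v, j) \<longleftrightarrow> \<rho> u < \<rho> (v', j)"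
    and in_J: "\<And>g t c. (\<And>b. b \<in> range \<kappa> \<Longrightarrow> g b \<in> A) \<Longrightarrow>
        (\<And>v w. (if g (\<kappa> v) = w then 1 else 0) + (k - 1) * (if j0 = w then 1 else 0) \<le> Poly_Mapping.lookup t (v, w)) \<Longrightarrow>
        Poly_Mapping.single t c \<in> J"
    and not_in_J: "\<And>f t b p. f \<in> J \<Longrightarrow> t \<in> Poly_Mapping.keys f \<Longrightarrow> (\<And>j. j \<in> A \<Longrightarrow> \<kappa> (p j) = b) \<Longrightarrow>
        (\<And>v w. w \<notin> A \<Longrightarrow> Poly_Mapping.lookup t (v, w) = 0) \<Longrightarrow>
        k \<le> (\<Sum>j\<in>A. Poly_Mapping.lookup t (p j, j))"
begin

definition wt :: "'v \<times> 'w \<Rightarrow> nat" where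
  "wt x = (if snd x = j0 then k else if snd x \<in> A then 1 else 0)"

text \<open>The monomial \<open>x\<^sup>a / \<Prod>T\<close>, where \<open>a\<close> is the exponent \<open>wt\<close>.\<close>

definition cofactor :: "('v \<times> 'w) set \<Rightarrow> 'v \<times> 'w \<Rightarrow>\<^sub>0 nat" where
  "cofactor T = mon_of (\<lambda>x. wt x - (if x \<in> T then 1 else 0))"

definition grid :: "('v \<times> 'w) set" where
  "grid = {(rep b, j) | b j. b \<in> range \<kappa> \<and> j \<in> A}"

text \<open>The simplices on which the Koszul cycle is supported: in every component exactly one point of the
  grid is missing. The cycle is the product over the components of the boundaries of full simplices.\<close>

definition cotransversal :: "('v \<times> 'w) set \<Rightarrow> bool" where
  "cotransversal T \<longleftrightarrow> T \<subseteq> grid \<and> (\<forall>b\<in>range \<kappa>. \<exists>!j. j \<in> A \<and> (rep b, j) \<notin> T)"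

definition rank :: "'v \<times> 'w \<Rightarrow> nat" where
  "rank y = card {u \<in> grid. \<rho> u < \<rho> y}"

text \<open>The face of an ordered simplex that omits its \<open>p\<close>-th vertex carries the
  sign \<open>(-1)^p\<close>, and these signs multiply over the components. Counting positions in
  the whole grid shifts all positions of one component equally, which alters only a global
  sign.\<close>

definition cycle_sgn :: "('v \<times> 'w) set \<Rightarrow> 'k" where
  "cycle_sgn T = (- 1) ^ (\<Sum>y\<in>grid - T. rank y)"

definition cycle :: "('v \<times> 'w) set \<Rightarrow> ('v \<times> 'w, 'k) polyn" where
  "cycle T = (if cotransversal T then Poly_Mapping.single (cofactor T) (cycle_sgn T) else 0)"

text \<open>The simplices supporting the cocycle that detects \<open>cycle\<close>.\<close>

definition block_section :: "('v \<times> 'w) set \<Rightarrow> bool" where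
  "block_section T \<longleftrightarrow> (\<forall>(v, j)\<in>T. j \<in> A - {j0}) \<and>
     (\<forall>b\<in>range \<kappa>. \<forall>j\<in>A - {j0}. \<exists>!v. \<kappa> v = b \<and> (v, j) \<in> T)"

definition corner :: "('v \<times> 'w) set" where
  "corner = {(rep b, j) | b j. b \<in> range \<kappa> \<and> j \<in> A - {j0}}"

text \<open>A facet of the boundary of the simplex on \<open>A\<close> has \<open>card A - 1\<close>
  vertices, and the join adds these numbers over the components.\<close>

definition hdeg :: nat where
  "hdeg = card (range \<kappa>) * (card A - 1)"

section \<open>The fundamental cycle\<close>

lemma rep_eq_iff: "b \<in> range \<kappa> \<Longrightarrow> b' \<in> range \<kappa> \<Longrightarrow> rep b = rep b' \<longleftrightarrow> b = b'"
  using rep by metis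

lemma grid_iff: "(v, j) \<in> grid \<longleftrightarrow> v = rep (\<kappa> v) \<and> j \<in> A"
  unfolding grid_def using rep by auto

lemma corner_iff: "(v, j) \<in> corner \<longleftrightarrow> v = rep (\<kappa> v) \<and> j \<in> A \<and> j \<noteq> j0"
  unfolding corner_def using rep by auto

lemma wt_pos: "snd x \<in> A \<Longrightarrow> wt x \<ge> 1"
  using k by (simp add: wt_def)

lemma cofactor_insert:
  assumes "x \<notin> T" "wt x \<ge> 1"
  shows "Poly_Mapping.single x 1 + cofactor (insert x T) = cofactor T"
  by (rule poly_mapping_eqI) (use assms in \<open>auto simp: cofactor_def lookup_add lookup_single when_def\<close>)

lemma cofactor_minus: "x \<notin> T \<Longrightarrow> cofactor T - Poly_Mapping.single x 1 = cofactor (insert x T)"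
  by (rule poly_mapping_eqI) (auto simp: cofactor_def lookup_minus lookup_single when_def)

lemma mon_deg_cofactor:
  assumes "\<And>x. x \<in> T \<Longrightarrow> wt x \<ge> 1"
  shows "mon_deg (cofactor T) + card T = (\<Sum>x\<in>UNIV. wt x)"
proof -
  have "(\<Sum>x\<in>UNIV. wt x) = (\<Sum>x\<in>UNIV. (wt x - (if x \<in> T then 1 else 0)) + (if x \<in> T then 1 else 0))"
    using assms by (intro sum.cong) auto
  also have "\<dots> = mon_deg (cofactor T) + (\<Sum>x\<in>UNIV. if x \<in> T then 1 else 0)"
    by (simp add: sum.distrib cofactor_def mon_deg_mon_of)
  also have "(\<Sum>x\<in>UNIV. if x \<in> T then 1 else 0) = card T" by (simp add: sum.If_cases)
  finally show ?thesis by simp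
qed

lemma sum_wt: "(\<Sum>x\<in>UNIV. wt x) = CARD('v) * (k + card A - 1)"
proof -
  have inner: "(\<Sum>w\<in>UNIV. wt (v, w)) = k + card A - 1" for v
  proof -
    have "(\<Sum>w\<in>UNIV. wt (v, w)) = (\<Sum>w\<in>A. wt (v, w))"
      by (rule sum.mono_neutral_right) (use j0 in \<open>auto simp: wt_def\<close>)
    also have "\<dots> = wt (v, j0) + (\<Sum>w\<in>A - {j0}. wt (v, w))"
      using j0 by (intro sum.remove) auto
    also have "(\<Sum>w\<in>A - {j0}. wt (v, w)) = (\<Sum>w\<in>A - {j0}. 1)"
      by (rule sum.cong) (auto simp: wt_def)
    also have "wt (v, j0) + (\<Sum>w\<in>A - {j0}. 1) = k + card A - 1"
      using j0 by (simp add: wt_def card_gt_0_iff Suc_leI)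
         (metis One_nat_def Suc_leI add_diff_assoc card_gt_0_iff empty_iff finite)
    finally show ?thesis .
  qed
  have "(\<Sum>x\<in>UNIV. wt x) = (\<Sum>v\<in>(UNIV :: 'v set). \<Sum>w\<in>(UNIV :: 'w set). wt (v, w))"
    unfolding UNIV_Times_UNIV[symmetric] sum.cartesian_product by simp
  then show ?thesis unfolding inner by simp
qed

lemma cotransversal_wt: "cotransversal T \<Longrightarrow> x \<in> T \<Longrightarrow> wt x \<ge> 1"
  unfolding cotransversal_def grid_def by (intro wt_pos) auto

text \<open>The points of the grid missing from \<open>T\<close> define a map \<open>g\<close> from
  components to \<open>A\<close>. Its graph avoids \<open>T\<close>, and removing \<open>T\<close>
  from the weight still leaves \<open>k - 1\<close> in column \<open>j0\<close>, so
  \<open>u_g u_j0^(k-1)\<close> divides the cofactor.\<close>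

lemma cycle_in_J: "cycle T \<in> J"
proof (cases "cotransversal T")
  case True
  define g where "g b = (THE j. j \<in> A \<and> (rep b, j) \<notin> T)" for b
  have g: "g b \<in> A" "(rep b, g b) \<notin> T" "\<And>j. j \<in> A \<Longrightarrow> (rep b, j) \<notin> T \<Longrightarrow> j = g b" if "b \<in> range \<kappa>" for b
  proof -
    have ex: "\<exists>!j. j \<in> A \<and> (rep b, j) \<notin> T" using True that unfolding cotransversal_def by blast
    from theI'[OF ex] show "g b \<in> A" "(rep b, g b) \<notin> T" by (simp_all add: g_def)
    show "j = g b" if "j \<in> A" "(rep b, j) \<notin> T" for j
      unfolding g_def by (rule the1_equality[OF ex, symmetric]) (use that in simp)
  qed
  have "(if g (\<kappa> v) = w then 1 else 0) + (k - 1) * (if j0 = w then 1 else 0) \<le> Poly_Mapping.lookup (cofactor T) (v, w)" for v w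
  proof (cases "(v, w) \<in> T")
    case mem: True
    then have "(v, w) \<in> grid" using True by (auto simp: cotransversal_def)
    then have vw: "v = rep (\<kappa> v)" "w \<in> A" by (simp_all add: grid_iff)
    have "g (\<kappa> v) \<noteq> w" using g(2)[of "\<kappa> v"] vw(1) mem by auto
    then show ?thesis using mem vw(2) by (simp add: cofactor_def wt_def)
  next
    case False
    have "g (\<kappa> v) \<in> A" using g(1) by simp
    then show ?thesis using False k by (auto simp: cofactor_def wt_def)
  qed
  with g(1) have "Poly_Mapping.single (cofactor T) (cycle_sgn T) \<in> J" by (rule in_J)
  then show ?thesis using True by (simp add: cycle_def)
next
  case False
  \<comment> \<open>The locale puts only monomials into \<open>J\<close>, so zero enters as a
    monomial with coefficient zero.\<close>
  have "Poly_Mapping.single (cofactor {}) (0::'k) \<in> J"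
  proof (rule in_J[of "\<lambda>_. j0"])
    show "(if j0 = w then 1 else 0) + (k - 1) * (if j0 = w then 1 else 0) \<le> Poly_Mapping.lookup (cofactor {}) (v, w)" for v w
      using k by (auto simp: cofactor_def wt_def)
  qed (use j0 in simp)
  then show ?thesis using False by (simp add: cycle_def)
qed

lemma card_less_insert:
  assumes "finite Q" "y \<notin> Q"
  shows "card {u \<in> insert y Q. \<rho> u < \<rho> x} = card {u \<in> Q. \<rho> u < \<rho> x} + (if \<rho> y < \<rho> x then 1 else 0)"
proof -
  have "{u \<in> insert y Q. \<rho> u < \<rho> x} = (if \<rho> y < \<rho> x then insert y {u \<in> Q. \<rho> u < \<rho> x} else {u \<in> Q. \<rho> u < \<rho> x})"
    by auto
  then show ?thesis using assms by simp
qed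

text \<open>Both exponents contain the ranks of the other missing points and the counts of
  \<open>x\<close> and \<open>y\<close> in \<open>T\<close>. Those other points lie in different
  components, hence on the same side of \<open>x\<close> and \<open>y\<close>; what differs is
  whether \<open>x < y\<close> or \<open>y < x\<close> is counted.\<close>

lemma cycle_sgn_swap:
  assumes T: "T \<subseteq> grid" and xy: "x \<in> grid - T" "y \<in> grid - T" "x \<noteq> y"
    and comp: "\<kappa> (fst x) = \<kappa> (fst y)" and others: "\<And>u. u \<in> grid - T - {x, y} \<Longrightarrow> \<kappa> (fst u) \<noteq> \<kappa> (fst x)"
  shows "ksgn \<rho> x T * cycle_sgn (insert x T) + ksgn \<rho> y T * cycle_sgn (insert y T) = (0::'k)"
proof -
  define Q where "Q = grid - T - {x, y}"
  define N where "N v = card {u \<in> T. \<rho> u < \<rho> v}" for v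
  define q where "q v = card {u \<in> Q. \<rho> u < \<rho> v}" for v
  have fin: "finite Q" by simp
  have grid: "grid = T \<union> insert x (insert y Q)" using T xy by (auto simp: Q_def)
  have Qxy: "x \<notin> insert y Q" "y \<notin> Q" "T \<inter> insert x (insert y Q) = {}" using xy by (auto simp: Q_def)
  have rank: "rank v = N v + q v + (if \<rho> y < \<rho> v then 1 else 0) + (if \<rho> x < \<rho> v then 1 else 0)" for v
  proof -
    have "{u \<in> grid. \<rho> u < \<rho> v} = {u \<in> T. \<rho> u < \<rho> v} \<union> {u \<in> insert x (insert y Q). \<rho> u < \<rho> v}"
      unfolding grid by auto
    moreover have "card ({u \<in> T. \<rho> u < \<rho> v} \<union> {u \<in> insert x (insert y Q). \<rho> u < \<rho> v})
       = card {u \<in> T. \<rho> u < \<rho> v} + card {u \<in> insert x (insert y Q). \<rho> u < \<rho> v}"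
      by (rule card_Un_disjoint) (use Qxy(3) in auto)
    ultimately show ?thesis
      unfolding rank_def N_def q_def using card_less_insert[OF _ Qxy(1), of v] card_less_insert[OF _ Qxy(2), of v]
      by simp
  qed
  have qxy: "q x = q y"
  proof -
    have "\<rho> u < \<rho> x \<longleftrightarrow> \<rho> u < \<rho> y" if "u \<in> Q" for u
      using order_component[OF comp, of u "snd x" "snd y"] others[of u] that by (simp add: Q_def)
    then have "{u \<in> Q. \<rho> u < \<rho> x} = {u \<in> Q. \<rho> u < \<rho> y}" by blast
    then show ?thesis by (simp add: q_def)
  qed
  have D: "grid - insert x T = insert y Q" "grid - insert y T = insert x Q"
    using xy by (auto simp: Q_def)
  have "\<rho> x \<noteq> \<rho> y" using xy(3) inj by (auto dest: injD)
  then show ?thesis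
    unfolding ksgn_def cycle_sgn_def D using Qxy
    by (auto simp: rank qxy N_def[symmetric] power_add)
qed

text \<open>A set contributing to the boundary lacks exactly two grid points of one component and
  one of every other. Inserting either of the two gives a cotransversal set, no other insertion
  does, and the two terms have opposite signs.\<close>

lemma cycle_closed: "kdiff \<rho> UNIV cycle T = 0"
proof (cases "\<exists>x. x \<notin> T \<and> cotransversal (insert x T)")
  case False
  then have "\<not> cotransversal (insert x T)" if "x \<notin> T" for x using that by blast
  then have "cycle (insert x T) = 0" if "x \<notin> T" for x using that unfolding cycle_def by presburger
  then show ?thesis unfolding kdiff_def by (intro sum.neutral) simp
next
  case True
  then obtain x where x: "x \<notin> T" "cotransversal (insert x T)" by blast
  define b where "b = \<kappa> (fst x)"
  have Tg: "T \<subseteq> grid" and xg: "x \<in> grid" using x by (auto simp: cotransversal_def)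
  have xb: "x = (rep b, snd x)" "snd x \<in> A" using xg by (cases x; simp add: grid_iff b_def)+
  have "\<exists>!j. j \<in> A \<and> (rep b, j) \<notin> insert x T" using x(2) unfolding cotransversal_def b_def by blast
  then obtain j where j: "j \<in> A" "(rep b, j) \<notin> insert x T"
    "\<And>j'. j' \<in> A \<Longrightarrow> (rep b, j') \<notin> insert x T \<Longrightarrow> j' = j" by blast
  define y where "y = (rep b, j)"
  have kb: "\<kappa> (rep b) = b" using rep by (simp add: b_def)
  have yg: "y \<in> grid" using j(1) kb by (simp add: y_def grid_iff)
  have yT: "y \<notin> T" "x \<noteq> y" using j(2) by (auto simp: y_def)
  have miss: "u = x \<or> u = y" if "u \<in> grid - T" "\<kappa> (fst u) = b" for u
  proof -
    have u: "u = (rep b, snd u)" "snd u \<in> A" using that by (cases u; simp add: grid_iff)+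
    then show ?thesis using j(3)[of "snd u"] that(1) by (auto simp: y_def)
  qed
  have co: "cotransversal (insert u T) \<longleftrightarrow> u = x \<or> u = y" if "u \<notin> T" for u
  proof
    assume c: "cotransversal (insert u T)"
    have ex: "\<exists>!j. j \<in> A \<and> (rep b, j) \<notin> insert u T" using c unfolding cotransversal_def b_def by blast
    show "u = x \<or> u = y"
    proof (rule ccontr)
      assume "\<not> (u = x \<or> u = y)"
      then have "(rep b, snd x) \<notin> insert u T" "(rep b, j) \<notin> insert u T"
        using x(1) yT(1) xb(1) by (auto simp: y_def)
      then have "snd x = j" using ex xb(2) j(1) by blast
      then show False using yT(2) xb(1) by (simp add: y_def)
    qed
  next
    have "cotransversal (insert y T)"
      unfolding cotransversal_def
    proof (intro conjI ballI)
      show "insert y T \<subseteq> grid" using Tg yg by blast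
      fix b' assume b': "b' \<in> range \<kappa>"
      show "\<exists>!j. j \<in> A \<and> (rep b', j) \<notin> insert y T"
      proof (cases "b' = b")
        case True
        show ?thesis
        proof (rule ex1I[of _ "snd x"])
          show "snd x \<in> A \<and> (rep b', snd x) \<notin> insert y T" using x(1) yT(2) xb True by auto
          show "i = snd x" if "i \<in> A \<and> (rep b', i) \<notin> insert y T" for i
          proof -
            have "(rep b, i) \<in> grid - T" "(rep b, i) \<noteq> y" using that True kb by (auto simp: grid_iff)
            then have "(rep b, i) = x" using miss[of "(rep b, i)"] kb by auto
            then show ?thesis by auto
          qed
        qed
      next
        case False
        have "rep b' \<noteq> rep b" using False rep_eq_iff[OF b', of b] by (auto simp: b_def)
        then have eq: "(rep b', i) \<notin> insert y T \<longleftrightarrow> (rep b', i) \<notin> insert x T" for i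
          using xb(1) by (auto simp: y_def)
        show ?thesis unfolding eq using x(2) b' unfolding cotransversal_def by blast
      qed
    qed
    then show "cotransversal (insert u T)" if "u = x \<or> u = y" using that x(2) by auto
  qed
  have term_eq: "Poly_Mapping.single (Poly_Mapping.single u 1) (ksgn \<rho> u T) * cycle (insert u T)
      = Poly_Mapping.single (cofactor T) (ksgn \<rho> u T * cycle_sgn (insert u T))"
    if "u \<notin> T" "cotransversal (insert u T)" for u
    using cofactor_insert[OF that(1) cotransversal_wt[OF that(2)]] that(2)
    by (simp add: cycle_def mult_single)
  have "kdiff \<rho> UNIV cycle T = (\<Sum>u\<in>{x, y}. Poly_Mapping.single (Poly_Mapping.single u 1) (ksgn \<rho> u T) * cycle (insert u T))"
    unfolding kdiff_def
    by (rule sum.mono_neutral_cong_right) (use x(1) yT(1) co in \<open>auto simp: cycle_def\<close>)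
  also have "\<dots> = Poly_Mapping.single (cofactor T)
      (ksgn \<rho> x T * cycle_sgn (insert x T) + ksgn \<rho> y T * cycle_sgn (insert y T))"
    using yT term_eq[OF x] term_eq[of y] co[of y] by (simp add: single_add)
  also have "\<dots> = 0"
  proof -
    have "ksgn \<rho> x T * cycle_sgn (insert x T) + ksgn \<rho> y T * cycle_sgn (insert y T) = (0::'k)"
    proof (rule cycle_sgn_swap[OF Tg])
      show "\<kappa> (fst x) = \<kappa> (fst y)" by (simp add: y_def kb b_def[symmetric])
      show "\<kappa> (fst u) \<noteq> \<kappa> (fst x)" if "u \<in> grid - T - {x, y}" for u
        using miss[of u] that by (auto simp: b_def[symmetric])
    qed (use x(1) yT xg yg in auto)
    then show ?thesis by simp
  qed
  finally show ?thesis .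
qed

section \<open>The cocycle and its pairing with the cycle\<close>

lemma section_wt: "block_section T \<Longrightarrow> x \<in> T \<Longrightarrow> snd x \<in> A \<and> snd x \<noteq> j0"
  by (cases x) (auto simp: block_section_def)

lemma section_unique:
  assumes "block_section T" "(v, j) \<in> T" "(v', j) \<in> T" "\<kappa> v = \<kappa> v'"
  shows "v = v'"
proof -
  have "\<exists>!u. \<kappa> u = \<kappa> v \<and> (u, j) \<in> T" using assms(1,2) section_wt[of T "(v, j)"] by (simp add: block_section_def)
  then show ?thesis using assms(2-4) by metis
qed

lemma section_ex:
  assumes "block_section T" "j \<in> A" "j \<noteq> j0"
  obtains v' where "\<kappa> v' = \<kappa> v" "(v', j) \<in> T"
proof -
  have "\<exists>!u. \<kappa> u = \<kappa> v \<and> (u, j) \<in> T" using assms by (simp add: block_section_def)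
  then show thesis using that by blast
qed

lemma card_section:
  assumes T: "block_section T"
  shows "card T = hdeg"
proof -
  have "bij_betw (\<lambda>(v, j). (\<kappa> v, j)) T (range \<kappa> \<times> (A - {j0}))"
    unfolding bij_betw_def
  proof
    show "inj_on (\<lambda>(v, j). (\<kappa> v, j)) T"
      by (auto simp: inj_on_def intro: section_unique[OF T])
    show "(\<lambda>(v, j). (\<kappa> v, j)) ` T = range \<kappa> \<times> (A - {j0})"
    proof (intro equalityI subsetI)
      fix x assume "x \<in> (\<lambda>(v, j). (\<kappa> v, j)) ` T"
      then show "x \<in> range \<kappa> \<times> (A - {j0})" using section_wt[OF T] by force
    next
      fix x assume "x \<in> range \<kappa> \<times> (A - {j0})"
      then obtain v j where x: "x = (\<kappa> v, j)" "j \<in> A" "j \<noteq> j0" by auto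
      obtain v' where "\<kappa> v' = \<kappa> v" "(v', j) \<in> T" by (rule section_ex[OF T x(2,3), of v])
      then show "x \<in> (\<lambda>(v, j). (\<kappa> v, j)) ` T" using x(1) by (intro image_eqI[of _ _ "(v', j)"]) auto
    qed
  qed
  then have "card T = card (range \<kappa> \<times> (A - {j0}))" by (rule bij_betw_same_card)
  then show ?thesis using j0 by (simp add: hdeg_def card_cartesian_product)
qed

lemma section_corner: "block_section corner"
  unfolding block_section_def
proof (intro conjI ballI)
  show "case x of (v, j) \<Rightarrow> j \<in> A - {j0}" if "x \<in> corner" for x
    using that by (cases x) (simp add: corner_iff)
  fix b j assume b: "b \<in> range \<kappa>" and j: "j \<in> A - {j0}"
  show "\<exists>!v. \<kappa> v = b \<and> (v, j) \<in> corner"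
    by (rule ex1I[of _ "rep b"]) (use b j rep in \<open>auto simp: corner_iff\<close>)
qed

lemma cotransversal_corner: "cotransversal corner"
  unfolding cotransversal_def
proof (intro conjI ballI)
  show "corner \<subseteq> grid" by (auto simp: corner_iff grid_iff)
  fix b assume b: "b \<in> range \<kappa>"
  show "\<exists>!j. j \<in> A \<and> (rep b, j) \<notin> corner"
    by (rule ex1I[of _ j0]) (use b rep[OF b] j0 in \<open>auto simp: corner_iff\<close>)
qed

text \<open>Cotransversal sets use only representatives, and a section has just one point per block.
  Cycle and cocycle therefore meet in a single simplex, and their pairing is a sign.\<close>

lemma section_cotransversal:
  assumes "block_section T" "cotransversal T"
  shows "T = corner"
proof (intro equalityI subsetI)
  fix x assume "x \<in> T"
  then show "x \<in> corner" using section_wt[OF assms(1), of x] assms(2)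
    by (cases x) (auto simp: corner_iff cotransversal_def grid_iff)
next
  fix x assume "x \<in> corner"
  then obtain v j where x: "x = (v, j)" "v = rep (\<kappa> v)" "j \<in> A" "j \<noteq> j0"
    by (cases x) (simp add: corner_iff)
  obtain v' where v': "\<kappa> v' = \<kappa> v" "(v', j) \<in> T" by (rule section_ex[OF assms(1) x(3,4), of v])
  then have "v' = rep (\<kappa> v')" using assms(2) by (auto simp: cotransversal_def grid_iff)
  then have "v' = v" using v'(1) x(2) by simp
  then show "x \<in> T" using v'(2) x(1) by simp
qed

text \<open>The cocycle condition. Regrouped by the larger simplex \<open>U\<close>, a nonzero term
  adds to a section a point in a column of \<open>A\<close>: in column \<open>j0\<close> this
  contradicts membership in \<open>J\<close>, in any other column it doubles a block and the two
  ways of undoing this cancel.\<close>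

lemma sum_sections_kdiff_eq_0:
  assumes vJ: "\<And>T. card T = Suc hdeg \<Longrightarrow> f T \<in> J"
  shows "(\<Sum>T | block_section T. Poly_Mapping.lookup (kdiff \<rho> UNIV f T) (cofactor T)) = 0"
proof -
  define h where "h U x = (if x \<in> Poly_Mapping.keys (cofactor (U - {x}))
     then ksgn \<rho> x (U - {x}) * Poly_Mapping.lookup (f U) (cofactor U) else (0::'k))" for U x
  have "(\<Sum>T | block_section T. Poly_Mapping.lookup (kdiff \<rho> UNIV f T) (cofactor T))
      = (\<Sum>T | block_section T. \<Sum>x\<in>UNIV - T. h (insert x T) x)"
    unfolding lookup_kdiff h_def by (intro sum.cong refl) (simp add: cofactor_minus[simplified])
  also have "\<dots> = (\<Sum>(T, x)\<in>Sigma {T. block_section T} (\<lambda>T. UNIV - T). h (insert x T) x)"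
    by (rule sum.Sigma) auto
  also have "\<dots> = (\<Sum>(U, x)\<in>Sigma UNIV (\<lambda>U. {x \<in> U. block_section (U - {x})}). h U x)"
    by (rule sum.reindex_bij_witness[where i="\<lambda>(U, x). (U - {x}, x)" and j="\<lambda>(T, x). (insert x T, x)"])
      (auto simp: insert_absorb)
  also have "\<dots> = (\<Sum>U\<in>UNIV. \<Sum>x | x \<in> U \<and> block_section (U - {x}). h U x)"
    by (rule sum.Sigma[symmetric]) auto
  also have "\<dots> = 0"
  proof (rule sum.neutral, rule ballI)
    fix U :: "('v \<times> 'w) set"
    show "(\<Sum>x | x \<in> U \<and> block_section (U - {x}). h U x) = 0"
    proof (cases "\<exists>x\<in>U. block_section (U - {x}) \<and> h U x \<noteq> 0")
      case False
      then show ?thesis by (intro sum.neutral) auto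
    next
      case True
      then obtain v1 j1 where x: "(v1, j1) \<in> U" "block_section (U - {(v1, j1)})" "h U (v1, j1) \<noteq> 0" by auto
      define T where "T = U - {(v1, j1)}"
      have T: "block_section T" "(v1, j1) \<notin> T" and U: "U = insert (v1, j1) T" using x by (auto simp: T_def)
      have key: "cofactor U \<in> Poly_Mapping.keys (f U)" and pos: "(v1, j1) \<in> Poly_Mapping.keys (cofactor T)"
        using x(3) by (auto simp: h_def T_def in_keys_iff split: if_splits)
      \<comment> \<open>Outside the columns of \<open>A\<close> the weight is zero, and no such
        variable divides a cofactor.\<close>
      have j1A: "j1 \<in> A"
        using pos j0 by (auto simp: in_keys_iff cofactor_def wt_def split: if_splits)
      have "card U = Suc hdeg" using card_section[OF T(1)] T(2) by (simp add: U)
      then have fU: "f U \<in> J" by (rule vJ)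
      \<comment> \<open>With a point in column \<open>j0\<close> as well, \<open>U\<close> has a
        point of this component in every column of \<open>A\<close>. Along these points the cofactor
        has total exponent \<open>k - 1\<close>, so it cannot occur in an element of
        \<open>J\<close>.\<close>
      have j1: "j1 \<noteq> j0"
      proof
        assume [simp]: "j1 = j0"
        have "\<forall>j\<in>A. \<exists>v. \<kappa> v = \<kappa> v1 \<and> (v, j) \<in> U"
        proof
          fix j assume j: "j \<in> A"
          show "\<exists>v. \<kappa> v = \<kappa> v1 \<and> (v, j) \<in> U"
          proof (cases "j = j0")
            case False
            then obtain v where "\<kappa> v = \<kappa> v1" "(v, j) \<in> T" using section_ex[OF T(1) j] by blast
            then show ?thesis by (auto simp: U)
          qed (auto simp: U)
        qed
        from bchoice[OF this] obtain p where p: "\<forall>j\<in>A. \<kappa> (p j) = \<kappa> v1 \<and> (p j, j) \<in> U" ..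
        have "k \<le> (\<Sum>j\<in>A. Poly_Mapping.lookup (cofactor U) (p j, j))"
          by (rule not_in_J[OF fU key, of _ "\<kappa> v1"]) (use p j0 in \<open>auto simp: cofactor_def wt_def\<close>)
        also have "\<dots> = (\<Sum>j\<in>A. if j = j0 then k - 1 else 0)"
          by (rule sum.cong) (use p in \<open>auto simp: cofactor_def wt_def\<close>)
        also have "\<dots> = k - 1" using j0 by simp
        finally show False using k by simp
      qed
      \<comment> \<open>The section already has a point in the block of the added one. Removing
        either gives a section; removing anything else leaves two points in that block.\<close>
      obtain v2 where v2: "\<kappa> v2 = \<kappa> v1" "(v2, j1) \<in> T" by (rule section_ex[OF T(1) j1A j1, of v1])
      have ne: "v2 \<noteq> v1" using v2 T(2) by auto
      let ?x = "(v1, j1)" and ?y = "(v2, j1)"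
      define B where "B = U - {?x, ?y}"
      have UB: "U - {?x} = insert ?y B" "U - {?y} = insert ?x B" "?x \<notin> B" "?y \<notin> B"
        using x(1) v2(2) ne by (auto simp: B_def U)
      have Bblock: "(\<kappa> (fst u), snd u) \<noteq> (\<kappa> v1, j1)" if "u \<in> B" for u
      proof
        assume e: "(\<kappa> (fst u), snd u) = (\<kappa> v1, j1)"
        have "u \<in> T" "u \<noteq> ?y" using that by (auto simp: B_def T_def)
        then have "(fst u, j1) \<in> T" "\<kappa> (fst u) = \<kappa> v2" using e v2(1) by (auto simp: prod_eq_iff[symmetric])
        then have "fst u = v2" using section_unique[OF T(1) _ v2(2)] by blast
        then show False using \<open>u \<noteq> ?y\<close> e by (cases u) auto
      qed
      have sec_y: "block_section (U - {?y})"
        unfolding block_section_def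
      proof (intro conjI ballI)
        show "case u of (v, j) \<Rightarrow> j \<in> A - {j0}" if "u \<in> U - {?y}" for u
          using that section_wt[OF T(1), of u] j1A j1 by (auto simp: U)
        fix b j assume b: "b \<in> range \<kappa>" and j: "j \<in> A - {j0}"
        show "\<exists>!v. \<kappa> v = b \<and> (v, j) \<in> U - {?y}"
        proof (cases "b = \<kappa> v1 \<and> j = j1")
          case True
          show ?thesis
          proof (rule ex1I[of _ v1])
            show "\<kappa> v1 = b \<and> (v1, j) \<in> U - {?y}" using True x(1) ne by auto
            show "v = v1" if "\<kappa> v = b \<and> (v, j) \<in> U - {?y}" for v
              using that True Bblock[of "(v, j)"] unfolding UB(2) by auto
          qed
        next
          case False
          have eq: "\<kappa> v = b \<and> (v, j) \<in> U - {?y} \<longleftrightarrow> \<kappa> v = b \<and> (v, j) \<in> T" for v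
            using False v2(1) by (auto simp: U)
          have "\<exists>!v. \<kappa> v = b \<and> (v, j) \<in> T" using T(1) b j unfolding block_section_def by blast
          then show ?thesis unfolding eq .
        qed
      qed
      have only: "{u \<in> U. block_section (U - {u})} = {?x, ?y}"
      proof (intro equalityI subsetI)
        fix u assume u: "u \<in> {u \<in> U. block_section (U - {u})}"
        show "u \<in> {?x, ?y}"
        proof (rule ccontr)
          assume "u \<notin> {?x, ?y}"
          then have "?x \<in> U - {u}" "?y \<in> U - {u}" using x(1) v2(2) by (auto simp: U)
          then have "v1 = v2" using section_unique[of "U - {u}" v1 j1 v2] u v2(1) by auto
          then show False using ne by simp
        qed
      qed (use x v2(2) sec_y in \<open>auto simp: U\<close>)
      have cof: "u \<in> Poly_Mapping.keys (cofactor (U - {u}))" if "u \<in> {?x, ?y}" for u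
        using that j1A j1 by (auto simp: in_keys_iff cofactor_def wt_def)
      \<comment> \<open>The block is an interval for \<open>\<rho>\<close>, so the rest of
        \<open>U\<close> contributes equally to both signs, and only the comparison of the two
        points differs.\<close>
      have cB: "card {u \<in> B. \<rho> u < \<rho> ?x} = card {u \<in> B. \<rho> u < \<rho> ?y}"
      proof -
        have "\<rho> u < \<rho> ?x \<longleftrightarrow> \<rho> u < \<rho> ?y" if "u \<in> B" for u
          by (rule order_block[OF v2(1)[symmetric] Bblock[OF that]])
        then have "{u \<in> B. \<rho> u < \<rho> ?x} = {u \<in> B. \<rho> u < \<rho> ?y}" by blast
        then show ?thesis by simp
      qed
      have "\<rho> ?x \<noteq> \<rho> ?y" using ne inj by (auto dest: injD)
      then have "ksgn \<rho> ?x (U - {?x}) + ksgn \<rho> ?y (U - {?y}) = (0::'k)"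
        unfolding ksgn_def UB using card_less_insert[OF _ UB(4), of ?x] card_less_insert[OF _ UB(3), of ?y] cB
        by auto
      moreover have "(\<Sum>u\<in>{?x, ?y}. h U u) = (ksgn \<rho> ?x (U - {?x}) + ksgn \<rho> ?y (U - {?y})) * Poly_Mapping.lookup (f U) (cofactor U)"
        using ne cof by (simp add: h_def distrib_right)
      ultimately show ?thesis unfolding only by simp
    qed
  qed
  finally show ?thesis .
qed

lemma sum_sections_cycle_neq_0:
  "(\<Sum>T | block_section T. Poly_Mapping.lookup (cycle T) (cofactor T)) \<noteq> 0"
proof -
  have "(\<Sum>T | block_section T. Poly_Mapping.lookup (cycle T) (cofactor T))
      = (\<Sum>T | block_section T. if T = corner then cycle_sgn T else 0)"
  proof (rule sum.cong)
    fix T assume "T \<in> {T. block_section T}"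
    then have "cotransversal T \<longleftrightarrow> T = corner" using section_cotransversal cotransversal_corner by blast
    then show "Poly_Mapping.lookup (cycle T) (cofactor T) = (if T = corner then cycle_sgn T else 0)"
      by (simp add: cycle_def)
  qed simp
  also have "\<dots> = cycle_sgn corner" using section_corner by simp
  finally show ?thesis by (simp add: cycle_sgn_def)
qed

text \<open>Cofactor and simplex always add up to the multidegree \<open>wt\<close>, whose total is
  the internal degree.\<close>

lemma resolution_degree:
  assumes res: "graded_free_resolution J degs d"
  shows "CARD('v) * (k + card A - 1) \<in> set (degs hdeg)"
proof -
  have "degs hdeg \<noteq> [] \<and> ((UNIV :: ('v \<times> 'w) set) = UNIV \<longrightarrow> CARD('v) * (k + card A - 1) \<in> set (degs hdeg))"
  proof (rule graded_free_resolution_koszul[OF res inj, of UNIV _ cycle])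
    show "cycle T \<in> J" for T by (rule cycle_in_J)
    show "kdiff \<rho> UNIV cycle T = 0" for T by (rule cycle_closed)
    show "mon_deg t + hdeg = CARD('v) * (k + card A - 1)"
      if "card T = hdeg" "t \<in> Poly_Mapping.keys (cycle T)" for T t
      using that mon_deg_cofactor[of T] cotransversal_wt[of T] sum_wt
      by (auto simp: cycle_def split: if_splits)
  next
    fix f assume fJ: "\<And>T. T \<subseteq> UNIV \<Longrightarrow> card T = Suc hdeg \<Longrightarrow> f T \<in> J"
      and fz: "\<And>T. T \<subseteq> UNIV \<Longrightarrow> card T = hdeg \<Longrightarrow> kdiff \<rho> UNIV f T = cycle T"
    have "(\<Sum>T | block_section T. Poly_Mapping.lookup (kdiff \<rho> UNIV f T) (cofactor T)) = 0"
      by (rule sum_sections_kdiff_eq_0) (use fJ in simp)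
    moreover have "(\<Sum>T | block_section T. Poly_Mapping.lookup (kdiff \<rho> UNIV f T) (cofactor T))
       = (\<Sum>T | block_section T. Poly_Mapping.lookup (cycle T) (cofactor T))"
    proof (rule sum.cong)
      fix T assume "T \<in> {T. block_section T}"
      then have "card T = hdeg" using card_section by simp
      then show "Poly_Mapping.lookup (kdiff \<rho> UNIV f T) (cofactor T) = Poly_Mapping.lookup (cycle T) (cofactor T)"
        using fz[of T] by simp
    qed simp
    ultimately show False using sum_sections_cycle_neq_0 by simp
  qed
  then show ?thesis by simp
qed

end

section \<open>Ordering the variables and assembling the bound\<close>

lemma lex_less_iff:
  fixes p q p' q' N :: nat
  assumes "q < N" "q' < N"
  shows "p * N + q < p' * N + q' \<longleftrightarrow> p < p' \<or> p = p' \<and> q < q'"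
proof -
  have *: "a * N + b < a' * N + b'" if "a < a'" "b < N" for a b a' b'
  proof -
    have "a * N + b < Suc a * N" using that(2) by simp
    also have "\<dots> \<le> a' * N" using that(1) by (intro mult_le_mono1) simp
    finally show ?thesis by simp
  qed
  show ?thesis
  proof (cases p p' rule: linorder_cases)
    case less
    then show ?thesis using *[OF less assms(1)] by simp
  next
    case greater
    then show ?thesis using *[OF greater assms(2), of q] by simp
  qed simp
qed

lemma finite_type_index:
  "\<exists>(f :: 'a::finite \<Rightarrow> nat) N. inj f \<and> (\<forall>x. f x < N)"
proof -
  obtain f :: "'a \<Rightarrow> nat" and n where f: "range f = {i. i < n}" "inj f"
    using finite_imp_inj_to_nat_seg[of "UNIV :: 'a set"] by auto
  have "f x < n" for x using rangeI[of f x] unfolding f(1) by simp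
  then show ?thesis using f(2) by (intro exI conjI allI)
qed

text \<open>Lexicographic order by component, column and vertex, written as a number in mixed
  radix.\<close>

lemma component_order_ex:
  fixes \<kappa> :: "'v::finite \<Rightarrow> 'b::finite"
  shows "\<exists>\<rho> :: 'v \<times> 'w::finite \<Rightarrow> nat. inj \<rho> \<and>
    (\<forall>v v' j j' u. \<kappa> v = \<kappa> v' \<longrightarrow> \<kappa> (fst u) \<noteq> \<kappa> v \<longrightarrow> (\<rho> u < \<rho> (v, j) \<longleftrightarrow> \<rho> u < \<rho> (v', j'))) \<and>
    (\<forall>v v' j u. \<kappa> v = \<kappa> v' \<longrightarrow> (\<kappa> (fst u), snd u) \<noteq> (\<kappa> v, j) \<longrightarrow> (\<rho> u < \<rho> (v, j) \<longleftrightarrow> \<rho> u < \<rho> (v', j)))"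
proof -
  obtain f1 :: "'b \<Rightarrow> nat" and N1 where f1: "inj f1" "\<forall>x. f1 x < N1"
    using finite_type_index by blast
  obtain f2 :: "'w \<Rightarrow> nat" and N2 where f2: "inj f2" "\<forall>x. f2 x < N2"
    using finite_type_index by blast
  obtain f3 :: "'v \<Rightarrow> nat" and N3 where f3: "inj f3" "\<forall>x. f3 x < N3"
    using finite_type_index by blast
  define \<rho> where "\<rho> x = (f1 (\<kappa> (fst x)) * N2 + f2 (snd x)) * N3 + f3 (fst x)" for x
  have less: "\<rho> (v, j) < \<rho> (v', j') \<longleftrightarrow> f1 (\<kappa> v) < f1 (\<kappa> v') \<or>
     f1 (\<kappa> v) = f1 (\<kappa> v') \<and> (f2 j < f2 j' \<or> f2 j = f2 j' \<and> f3 v < f3 v')" for v j v' j'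
  proof -
    let ?p = "f1 (\<kappa> v) * N2 + f2 j" and ?p' = "f1 (\<kappa> v') * N2 + f2 j'"
    have "\<rho> (v, j) < \<rho> (v', j') \<longleftrightarrow> ?p < ?p' \<or> ?p = ?p' \<and> f3 v < f3 v'"
      unfolding \<rho>_def fst_conv snd_conv by (rule lex_less_iff[OF f3(2)[rule_format] f3(2)[rule_format]])
    moreover have "?p < ?p' \<longleftrightarrow> f1 (\<kappa> v) < f1 (\<kappa> v') \<or> f1 (\<kappa> v) = f1 (\<kappa> v') \<and> f2 j < f2 j'"
      by (rule lex_less_iff[OF f2(2)[rule_format] f2(2)[rule_format]])
    moreover have "?p' < ?p \<longleftrightarrow> f1 (\<kappa> v') < f1 (\<kappa> v) \<or> f1 (\<kappa> v') = f1 (\<kappa> v) \<and> f2 j' < f2 j"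
      by (rule lex_less_iff[OF f2(2)[rule_format] f2(2)[rule_format]])
    ultimately show ?thesis by linarith
  qed
  have i1: "f1 x = f1 y \<longleftrightarrow> x = y" for x y using f1(1) by (rule inj_eq)
  have i2: "f2 x = f2 y \<longleftrightarrow> x = y" for x y using f2(1) by (rule inj_eq)
  have i3: "f3 x = f3 y \<longleftrightarrow> x = y" for x y using f3(1) by (rule inj_eq)
  have "inj \<rho>"
  proof (rule injI)
    fix x y :: "'v \<times> 'w" assume e: "\<rho> x = \<rho> y"
    obtain v j v' j' where xy: "x = (v, j)" "y = (v', j')" by (metis surj_pair)
    have "\<not> \<rho> (v, j) < \<rho> (v', j')" "\<not> \<rho> (v', j') < \<rho> (v, j)" using e by (simp_all add: xy)
    then have "f2 j = f2 j' \<and> f3 v = f3 v'" unfolding less by linarith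
    then show "x = y" by (simp add: xy i2 i3)
  qed
  moreover have "\<rho> u < \<rho> (v, j) \<longleftrightarrow> \<rho> u < \<rho> (v', j')" if "\<kappa> v = \<kappa> v'" "\<kappa> (fst u) \<noteq> \<kappa> v" for v v' j j' u
    using that by (cases u) (simp add: less i1)
  moreover have "\<rho> u < \<rho> (v, j) \<longleftrightarrow> \<rho> u < \<rho> (v', j)" if "\<kappa> v = \<kappa> v'" "(\<kappa> (fst u), snd u) \<noteq> (\<kappa> v, j)" for v v' j u
    using that by (cases u) (auto simp: less i1 i2)
  ultimately have "inj \<rho> \<and>
    (\<forall>v v' j j' u. \<kappa> v = \<kappa> v' \<longrightarrow> \<kappa> (fst u) \<noteq> \<kappa> v \<longrightarrow> (\<rho> u < \<rho> (v, j) \<longleftrightarrow> \<rho> u < \<rho> (v', j'))) \<and>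
    (\<forall>v v' j u. \<kappa> v = \<kappa> v' \<longrightarrow> (\<kappa> (fst u), snd u) \<noteq> (\<kappa> v, j) \<longrightarrow> (\<rho> u < \<rho> (v, j) \<longleftrightarrow> \<rho> u < \<rho> (v', j)))"
    by (intro conjI allI impI)
  then show ?thesis by (rule exI[of _ \<rho>])
qed

text \<open>A weak homomorphism with a value outside \<open>A\<close> meets the second part. One
  with all values in \<open>A\<close> sends every edge to a point by independence, so it has a
  single value \<open>w\<close> on the component \<open>b\<close> and passes through
  \<open>(p w, w)\<close>.\<close>

lemma covers_transversal:
  fixes G :: "'v set set" and H :: "'w set set"
  assumes A: "independent_set H A" "j0 \<in> A"
    and \<kappa>: "\<And>(\<phi> :: 'v \<Rightarrow> 'w) v v'. (\<And>x y. {x, y} \<in> G \<Longrightarrow> \<phi> x = \<phi> y) \<Longrightarrow> \<kappa> v = \<kappa> v' \<Longrightarrow> \<phi> v = \<phi> v'"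
    and p: "\<And>j. j \<in> A \<Longrightarrow> \<kappa> (p j) = b"
  shows "covers G H ((\<lambda>j. (p j, j)) ` A \<union> UNIV \<times> - A)"
  unfolding covers_def
proof
  fix \<phi> assume \<phi>: "\<phi> \<in> weak_homs G H"
  show "\<exists>v. (v, \<phi> v) \<in> (\<lambda>j. (p j, j)) ` A \<union> UNIV \<times> - A"
  proof (cases "\<exists>v. \<phi> v \<notin> A")
    case False
    then have in_A: "\<phi> v \<in> A" for v by blast
    have const: "\<phi> v = \<phi> v'" if "\<kappa> v = \<kappa> v'" for v v'
    proof (rule \<kappa>[of \<phi>, OF _ that])
      fix x y assume "{x, y} \<in> G"
      then have "\<phi> x = \<phi> y \<or> {\<phi> x, \<phi> y} \<in> H" using \<phi> by (simp add: weak_homs_def)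
      moreover have "{\<phi> x, \<phi> y} \<notin> H" using A(1) in_A by (simp add: independent_set_def)
      ultimately show "\<phi> x = \<phi> y" by blast
    qed
    define w where "w = \<phi> (p j0)"
    have w: "w \<in> A" using in_A by (simp add: w_def)
    have "\<phi> (p w) = w" unfolding w_def by (rule const) (simp add: p A(2) in_A)
    then have "(p w, \<phi> (p w)) \<in> (\<lambda>j. (p j, j)) ` A" using w by simp
    then show ?thesis by blast
  qed auto
qed

lemma regularity_power_like:
  fixes G :: "'v::finite set set" and H :: "'w::finite set set"
    and J :: "('v \<times> 'w, 'k::field) polyn set"
  assumes H: "simple_graph H" and J: "power_like G H k J" and k: "k \<ge> 1"
  shows "regularity J \<ge> ereal (real k * real CARD('v) +
    (real CARD('v) - real (num_components G)) * (real (independence_number H) - 1))"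
proof -
  have mon: "monomial_ideal J" using J by (simp add: power_like_def)
  from graded_betti_resolution[OF mon] obtain degs d where
    res: "graded_free_resolution J degs d" and betti: "\<And>i j. graded_betti J i j = count_list (degs i) j"
    by blast
  define S where "S = {card A | A :: 'w set. independent_set H A}"
  have fin: "finite S" unfolding S_def by simp
  \<comment> \<open>There are no loops, so singletons are independent; the maximum is therefore at
    least 1 and the chosen \<open>A\<close> is nonempty.\<close>
  have single: "independent_set H {w}" for w
    using H by (auto simp: independent_set_def simple_graph_def)
  then have one: "1 \<in> S" unfolding S_def by (intro CollectI exI[of _ "{undefined}"]) simp
  have "Max S \<in> S" using fin one by (intro Max_in) auto
  then obtain A where A: "independent_set H A" "card A = independence_number H"
    unfolding S_def independence_number_def by auto
  have "1 \<le> card A" using Max_ge[OF fin one] by (simp add: A(2) independence_number_def S_def)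
  then obtain j0 where j0: "j0 \<in> A" by (metis card.empty equals0I not_one_le_zero)
  define R where "R = {(x, y). {x, y} \<in> G}\<^sup>*"
  define \<kappa> where "\<kappa> v = R `` {v}" for v
  define rep where "rep b = (SOME v. \<kappa> v = b)" for b
  have rep: "\<kappa> (rep b) = b" if "b \<in> range \<kappa>" for b
    unfolding rep_def by (rule someI_ex) (use that in auto)
  have R: "equiv UNIV R"
    unfolding R_def
    by (intro equivI refl_rtrancl sym_rtrancl trans_rtrancl) (auto simp: sym_def insert_commute)
  have comps: "num_components G = card (range \<kappa>)"
    unfolding num_components_def R_def[symmetric] by (simp add: quotient_def \<kappa>_def UNION_singleton_eq_range)
  have edge: "\<kappa> x = \<kappa> y" if "{x, y} \<in> G" for x y
    unfolding \<kappa>_def by (rule equiv_class_eq[OF R]) (use that in \<open>auto simp: R_def\<close>)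
  have const: "\<phi> v = \<phi> v'" if \<phi>: "\<And>x y. {x, y} \<in> G \<Longrightarrow> \<phi> x = \<phi> y" and "\<kappa> v = \<kappa> v'"
    for \<phi> :: "'v \<Rightarrow> 'w" and v v'
  proof -
    have "(v, v') \<in> R" using eq_equiv_class[OF _ R, of v v'] that(2) by (simp add: \<kappa>_def)
    then show ?thesis unfolding R_def by (induction rule: rtrancl_induct) (auto dest: \<phi>)
  qed
  from component_order_ex[of \<kappa>] obtain \<rho> :: "'v \<times> 'w \<Rightarrow> nat" where
    \<rho>: "inj \<rho> \<and> (\<forall>v v' j j' u. \<kappa> v = \<kappa> v' \<longrightarrow> \<kappa> (fst u) \<noteq> \<kappa> v \<longrightarrow> (\<rho> u < \<rho> (v, j) \<longleftrightarrow> \<rho> u < \<rho> (v', j'))) \<and>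
    (\<forall>v v' j u. \<kappa> v = \<kappa> v' \<longrightarrow> (\<kappa> (fst u), snd u) \<noteq> (\<kappa> v, j) \<longrightarrow> (\<rho> u < \<rho> (v, j) \<longleftrightarrow> \<rho> u < \<rho> (v', j)))" ..
  interpret component_grid \<kappa> rep A j0 \<rho> k J
  proof
    show "\<kappa> (rep b) = b" if "b \<in> range \<kappa>" for b by (rule rep[OF that])
    show "inj \<rho>" using \<rho> by (rule conjunct1)
    show "\<rho> u < \<rho> (v, j) \<longleftrightarrow> \<rho> u < \<rho> (v', j')" if "\<kappa> v = \<kappa> v'" "\<kappa> (fst u) \<noteq> \<kappa> v" for v v' j j' u
      by (rule \<rho>[THEN conjunct2, THEN conjunct1, rule_format, OF that])
    show "\<rho> u < \<rho> (v, j) \<longleftrightarrow> \<rho> u < \<rho> (v', j)" if "\<kappa> v = \<kappa> v'" "(\<kappa> (fst u), snd u) \<noteq> (\<kappa> v, j)" for v v' j u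
      by (rule \<rho>[THEN conjunct2, THEN conjunct2, rule_format, OF that])
    show "Poly_Mapping.single t c \<in> J"
      if "\<And>b. b \<in> range \<kappa> \<Longrightarrow> g b \<in> A"
        and le: "\<And>v w. (if g (\<kappa> v) = w then 1 else 0) + (k - 1) * (if j0 = w then 1 else 0) \<le> Poly_Mapping.lookup t (v, w)"
      for g t c
    proof (rule power_like_single[OF J k _ const_in_weak_homs[of j0]])
      show "(\<lambda>v. g (\<kappa> v)) \<in> weak_homs G H" using edge by (auto simp: weak_homs_def)
    qed (rule le)
    show "k \<le> (\<Sum>j\<in>A. Poly_Mapping.lookup t (p j, j))"
      if f: "f \<in> J" "t \<in> Poly_Mapping.keys f" and p: "\<And>j. j \<in> A \<Longrightarrow> \<kappa> (p j) = b"
        and z: "\<And>v w. w \<notin> A \<Longrightarrow> Poly_Mapping.lookup t (v, w) = 0" for f t b p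
    proof -
      \<comment> \<open>The degree bound for this cover includes all columns outside
        \<open>A\<close>, where \<open>t\<close> vanishes, so only the transversal
        contributes.\<close>
      have cov: "covers G H ((\<lambda>j. (p j, j)) ` A \<union> UNIV \<times> - A)"
      proof (rule covers_transversal[OF A(1) j0, where \<kappa>=\<kappa> and b=b])
        fix \<phi> :: "'v \<Rightarrow> 'w" and v v'
        assume "\<And>x y. {x, y} \<in> G \<Longrightarrow> \<phi> x = \<phi> y" "\<kappa> v = \<kappa> v'"
        then show "\<phi> v = \<phi> v'" by (rule const)
      qed (rule p)
      have "k \<le> part_deg ((\<lambda>j. (p j, j)) ` A \<union> UNIV \<times> - A) t"
        by (rule power_like_part_deg[OF J f cov])
      also have "\<dots> = (\<Sum>x\<in>(\<lambda>j. (p j, j)) ` A. Poly_Mapping.lookup t x)"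
        unfolding part_deg_def by (rule sum.mono_neutral_right) (use z in auto)
      also have "\<dots> = (\<Sum>j\<in>A. Poly_Mapping.lookup t (p j, j))"
        by (subst sum.reindex) (auto simp: inj_on_def)
      finally show ?thesis .
    qed
  qed (use j0 k in auto)
  have "CARD('v) * (k + card A - 1) \<in> set (degs hdeg)" by (rule resolution_degree[OF res])
  then have nz: "graded_betti J hdeg (CARD('v) * (k + card A - 1)) \<noteq> 0"
    by (simp add: betti count_list_0_iff)
  \<comment> \<open>Internal degree \<open>n(k + |A| - 1)\<close> minus homological degree
    \<open>c(|A| - 1)\<close>; since \<open>A\<close> is nonempty, the truncated subtractions are
    genuine.\<close>
  have eq: "real k * real CARD('v) + (real CARD('v) - real (num_components G)) * (real (independence_number H) - 1)
     = real (CARD('v) * (k + card A - 1)) - real hdeg"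
  proof -
    have "real (k + card A - 1) = real k + real (card A) - 1" "real (card A - 1) = real (card A) - 1"
      using \<open>1 \<le> card A\<close> by (simp_all add: of_nat_diff)
    then show ?thesis unfolding hdeg_def comps A(2)[symmetric] of_nat_mult by (simp add: algebra_simps)
  qed
  show ?thesis unfolding regularity_def eq using nz by (intro Sup_upper) blast
qed

theorem theorem2p12:
  fixes G :: "'v::finite set set"
    and H :: "'w::finite set set"
    and I :: "('v \<times> 'w, 'k::field) polyn set"
    and k :: nat
  assumes "simple_graph G"
    and "simple_graph H"
    and "I = weak_hom_ideal G H"
    and "k \<ge> 1"
  shows "proj_dim (ideal_power I k) \<ge> enat (CARD('w) - 1) \<and>
    proj_dim (symbolic_power I k) \<ge> enat (CARD('w) - 1) \<and>
    regularity (ideal_power I k) \<ge>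
      ereal (real k * real CARD('v) +
        (real CARD('v) - real (num_components G)) * (real (independence_number H) - 1)) \<and>
    regularity (symbolic_power I k) \<ge>
      ereal (real k * real CARD('v) +
        (real CARD('v) - real (num_components G)) * (real (independence_number H) - 1))"
  unfolding assms(3)
  using proj_dim_power_like[OF power_like_ideal_power[of G H k] assms(4)]
    proj_dim_power_like[OF power_like_symbolic_power[of G H k] assms(4)]
    regularity_power_like[OF assms(2) power_like_ideal_power[of G H k] assms(4)]
    regularity_power_like[OF assms(2) power_like_symbolic_power[of G H k] assms(4)]
  by (intro conjI)

end
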